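(* The $H$-module $\mathcal V_{\mathbf Z}=\bigoplus_{\mathfrak m\in\mathbf Z}\mathrm{Fock}_{\mathfrak m}$ has the structure of a conformal raviolo vertex algebra (of central charge $0$) such that $H=\mathrm{Fock}_0$ is a conformal raviolo vertex subalgebra.
   Context: Conventions. Spaces are over $\mathbf C$ and $\mathbf Z$-graded (cohomological degree $|\cdot|$); $[x,y]=xy-(-1)^{|x||y|}yx$; Koszul signs throughout. Raviolo functions. $\mathcal K=\mathbf C\langle\!\langle z\rangle\!\rangle$: graded commutative algebra with degree 0 part $\mathbf C[\![z]\!]$ and degree 1 part the span (finite combinations) of symbols $\Omega_z^m$, $m\ge0$, with $z^n\Omega_z^m=\Omega_z^{m-n}$ ($n\le m$), $z^n\Omega_z^m=0$ ($n>m$), $\Omega_z^n\Omega_z^m=0$; $\mathcal K_{dist}$ is the same with infinite sums of the $\Omega_z^m$ allowed. $\partial_zz^n=nz^{n-1}$, $\partial_z\Omega_z^m=-(m+1)\Omega_z^{m+1}$. $R\langle\!\langle z\rangle\!\rangle$: series $\sum_{n<0}z^{-n-1}r_n+\sum_{n\ge0}\Omega_z^nr_n$, $r_n\in R$, $r_n=0$ for $n\gg0$; $R\langle\!\langle z\rangle\!\rangle\langle\!\langle w\rangle\!\rangle=(R\langle\!\langle z\rangle\!\rangle)\langle\!\langle w\rangle\!\rangle$. $\mathrm{End}(\mathcal V)\otimes\mathcal K_{dist}$ denotes $\mathrm{End}(\mathcal V)$-valued infinite series. $\mathcal K_{z,w,z-w}$ is the quotient of the free graded commutative algebra $\mathbf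 C[\![z,w]\!][\Omega_z^n,\Omega_w^m,\Omega_{z-w}^k]$ ($\Omega$'s of degree 1) by: for $x\in\{z,w,z-w\}$, $x^n\Omega_x^m=\Omega_x^{m-n}$ ($n\le m$), $=0$ ($n>m$), $\Omega_x^n\Omega_x^m=0$; and $\Omega^0_{z-w}\Omega^0_z+\Omega^0_w\Omega^0_{z-w}+\Omega^0_z\Omega^0_w=0$ with all its $\partial_z,\partial_w$-derivatives. Expansions: (i) to $\mathbf C\langle\!\langle z\rangle\!\rangle\langle\!\langle w\rangle\!\rangle$: $\Omega_{z-w}^m\mapsto\sum_{n\ge0}\binom{m+n}{n}w^n\Omega_z^{m+n}$; (ii) to $\mathbf C\langle\!\langle w\rangle\!\rangle\langle\!\langle z\rangle\!\rangle$: $\Omega_{z-w}^m\mapsto(-1)^m\sum_{n\ge0}\binom{m+n}{n}z^n\Omega_w^{m+n}$; other generators fixed. Raviolo vertex algebras. A raviolo field on $\mathcal V$ is $A(z)=\sum_{m<0}z^{-m-1}A_m+\sum_{m\ge0}\Omega_z^mA_m$ with $A_m\in\mathrm{End}(\mathcal V)$, $A_mv=0$ for $m\gg0$ for each $v$; of degree $r$ if $A_m$ has degree $r$ for $m<0$, $r-1$ for $m\ge0$. $A,B$ are mutually local if for all $v\in\mathcal V$, $\varphi\in\mathcal V^*$, $\langle\varphi,A(z)B(w)v\rangle$ and $(-1)^{|A||B|}\langle\varphi,B(w)A(z)v\rangle$ are the expansions (i),(ii) of the same element of $\mathcal K_{z,w,z-w}$, with pole order in $z-w$ bounded uniformly in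 $v,\varphi$. A raviolo vertex algebra $(\mathcal V,|0\rangle,\partial,Y)$: graded space, $|0\rangle\in\mathcal V^0$, degree 0 endomorphism $\partial$, degree 0 linear map $Y(-,z):\mathcal V\to\mathrm{End}(\mathcal V)\otimes\mathcal K_{dist}$, $Y(a,z)=\sum_{m<0}z^{-m-1}a_{(m)}+\sum_{m\ge0}\Omega_z^ma_{(m)}$, with values raviolo fields, $[\partial,Y(a,z)]=\partial_zY(a,z)$, $\partial|0\rangle=0$, $Y(|0\rangle,z)=\mathrm{id}$, $Y(a,z)|0\rangle\in a+z\mathcal V[\![z]\!]$, all $Y(a,z),Y(b,w)$ mutually local. A subalgebra is a $\partial$-invariant subspace $\mathcal W\ni|0\rangle$ with $Y(a,z)b\in\mathcal W\langle\!\langle z\rangle\!\rangle$ for $a,b\in\mathcal W$. A spin grading is an extra grading $\mathcal V=\bigoplus_s\mathcal V^{(s)}$ with $|0\rangle$ of spin 0, $\partial$ raising spin by 1, and $a_{(n)}$ raising spin by $s-n-1$ for $a\in\mathcal V^{(s)}$. Conformal structure of central charge 0: a spin grading and a non-zero conformal vector $\gamma$ of cohomological degree 1 and spin 2 such that, writing $Y(\gamma,z)=\sum_{n\ge0}(z^n\Gamma_n+\Omega_z^nG_n)$, one has $[G_m,G_n]=(m-n)G_{m+n-1}$, $[\Gamma_m,\Gamma_n]=0$, $[G_m,\Gamma_n]=(m+n+1)\Gamma_{n-m+1}$ if $n+1\ge m$ and $0$ otherwise, and $G_0=\partial$, $G_1|_{\mathcal V^{(s)}}=s\,\mathrm{id}$.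 A conformal subalgebra is a subalgebra containing $\gamma$ and conformal with respect to it. The Heisenberg raviolo algebra. $\widehat{\mathcal H}$ is the central extension of the abelian graded Lie algebra $\mathcal K\oplus\mathcal K[1]$ (variable $u$) by $\mathbf CK$ ($K$ of degree 0). With $c_n=u^n$ (degree 0), $\nu_n=\Omega_u^n$ (degree 1) in $\mathcal K$ and $\varphi_n=u^n$ (degree $-1$), $b_n=\Omega_u^n$ (degree 0) in $\mathcal K[1]$, $n\ge0$, the non-zero brackets are $[c_n,b_m]=-n\delta_{n,m+1}K=-[b_m,c_n]$, $[\nu_n,\varphi_m]=m\delta_{n+1,m}K=[\varphi_m,\nu_n]$. $\widehat{\mathcal H}_{\ge0}=\mathbf C[\![u]\!]\oplus\mathbf C[\![u]\!][1]\oplus\mathbf CK$ (the $c$'s, $\varphi$'s and $K$). For $\lambda\in\mathbf C$, $\mathbf C_\lambda=\mathbf C|\lambda\rangle$ is the $\widehat{\mathcal H}_{\ge0}$-module with $f(u)=\sum f_nc_n$ acting by $\lambda f_0$ (so $c_0=\lambda$, $c_{n+1}=0$), all $\varphi$'s by 0, $K$ by 1, $|\lambda\rangle$ of degree 0 and spin 0; $\mathrm{Fock}_\lambda=U\widehat{\mathcal H}\otimes_{U\widehat{\mathcal H}_{\ge0}}\mathbf C_\lambda$. $H=\mathrm{Fock}_0$ is the raviolo vertex algebra with vacuum $|0\rangle$, translation operator induced from $\partial\nu_n=(n+1)\nu_{n+1}$, $\partial c_n=-nc_{n-1}$, $\partial b_n=(n+1)b_{n+1}$, $\partial\varphi_n=-n\varphi_{n-1}$,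 $\partial K=0$, strongly generated by $b(z)=Y(b_0|0\rangle,z)=\sum_{n\ge0}(z^nb_n+\Omega_z^n\varphi_n)$ and $\nu(z)=Y(\nu_0|0\rangle,z)=\sum_{n\ge0}(z^n\nu_n+\Omega_z^nc_n)$ (both of spin 1). It is conformal of central charge 0 with conformal vector $\gamma=-b_0\nu_0|0\rangle$. Each $\mathrm{Fock}_\lambda$ is an $H$-module, with $b(z),\nu(z)$ acting through the same formulas. *)

theory Defs
  imports
    Complex_Main
    "HOL-Library.Poly_Mapping"
    "HOL-Computational_Algebra.Computational_Algebra"
begin

section \<open>Complex vector spaces\<close>

class complex_space = ab_group_add +
  fixes cscale :: "complex \<Rightarrow> 'a \<Rightarrow> 'a" (infixr "*\<^sub>c" 75)
  assumes cscale_right_distrib: "a *\<^sub>c (x + y) = a *\<^sub>c x + a *\<^sub>c y"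
    and cscale_left_distrib: "(a + b) *\<^sub>c x = a *\<^sub>c x + b *\<^sub>c x"
    and cscale_cscale: "a *\<^sub>c (b *\<^sub>c x) = (a * b) *\<^sub>c x"
    and cscale_one: "1 *\<^sub>c x = x"

interpretation cs: vector_space "cscale :: complex \<Rightarrow> 'a \<Rightarrow> 'a::complex_space"
  by unfold_locales (simp_all add: cscale_right_distrib cscale_left_distrib cscale_cscale cscale_one)

instantiation complex :: complex_space
begin
definition "cscale_complex (a::complex) (x::complex) = a * x"
instance by standard (simp_all add: cscale_complex_def algebra_simps)
end

instantiation poly_mapping :: (type, complex_space) complex_space
begin
definition "cscale_poly_mapping a (p :: 'a \<Rightarrow>\<^sub>0 'b) = Poly_Mapping.map (cscale a) p"

lemma lookup_cscale: "Poly_Mapping.lookup (a *\<^sub>c p) k = a *\<^sub>c Poly_Mapping.lookup p k"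
  for p :: "'a \<Rightarrow>\<^sub>0 'b"
  by (simp add: cscale_poly_mapping_def map.rep_eq when_def)

instance
  by standard
    (auto intro!: poly_mapping_eqI
      simp: lookup_cscale lookup_add cscale_right_distrib cscale_left_distrib cscale_cscale cscale_one)
end

definition linear_on :: "'v::complex_space set \<Rightarrow> ('v \<Rightarrow> 'w::complex_space) \<Rightarrow> bool" where
  "linear_on W f \<longleftrightarrow> (\<forall>x\<in>W. \<forall>y\<in>W. f (x + y) = f x + f y) \<and> (\<forall>c. \<forall>x\<in>W. f (c *\<^sub>c x) = c *\<^sub>c f x)"

definition grading_on :: "'v::complex_space set \<Rightarrow> (int \<Rightarrow> 'v set) \<Rightarrow> bool" where
  "grading_on W G \<longleftrightarrow> cs.subspace W \<and> (\<forall>n. cs.subspace (G n) \<and> G n \<subseteq> W) \<and>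
     (\<forall>x\<in>W. \<exists>!f. (\<forall>n. f n \<in> G n) \<and> finite {n. f n \<noteq> 0} \<and> x = (\<Sum>n | f n \<noteq> 0. f n))"

definition graded_subspace :: "'v::complex_space set \<Rightarrow> (int \<Rightarrow> 'v set) \<Rightarrow> bool" where
  "graded_subspace S G \<longleftrightarrow> grading_on S (\<lambda>n. S \<inter> G n)"


section \<open>Free associative algebras\<close>

text \<open>Elements of the free associative algebra over \<open>'r\<close> on \<open>'x\<close> are finitely supported functions on
  words.\<close>

type_synonym ('x, 'r) free_alg = "'x list \<Rightarrow>\<^sub>0 'r"

abbreviation word :: "'x list \<Rightarrow> ('x, 'r::zero_neq_one) free_alg" where
  "word xs \<equiv> Poly_Mapping.single xs 1"

definition fmul :: "('x, 'r::comm_ring_1) free_alg \<Rightarrow> ('x, 'r) free_alg \<Rightarrow> ('x, 'r) free_alg"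
    (infixl "\<star>" 70) where
  "p \<star> q = (\<Sum>u\<in>Poly_Mapping.keys p. \<Sum>v\<in>Poly_Mapping.keys q.
     Poly_Mapping.single (u @ v) (Poly_Mapping.lookup p u * Poly_Mapping.lookup q v))"

lemma fmul_supset:
  assumes "finite A" "finite B" "Poly_Mapping.keys p \<subseteq> A" "Poly_Mapping.keys q \<subseteq> B"
  shows "p \<star> q = (\<Sum>u\<in>A. \<Sum>v\<in>B.
     Poly_Mapping.single (u @ v) (Poly_Mapping.lookup p u * Poly_Mapping.lookup q v))"
proof -
  have "(\<Sum>v\<in>Poly_Mapping.keys q.
      Poly_Mapping.single (u @ v) (Poly_Mapping.lookup p u * Poly_Mapping.lookup q v)) =
    (\<Sum>v\<in>B. Poly_Mapping.single (u @ v) (Poly_Mapping.lookup p u * Poly_Mapping.lookup q v))" for u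
    using assms by (intro sum.mono_neutral_left) (auto simp: in_keys_iff)
  then have "p \<star> q = (\<Sum>u\<in>Poly_Mapping.keys p. \<Sum>v\<in>B.
      Poly_Mapping.single (u @ v) (Poly_Mapping.lookup p u * Poly_Mapping.lookup q v))"
    by (simp add: fmul_def)
  also have "\<dots> = (\<Sum>u\<in>A. \<Sum>v\<in>B.
      Poly_Mapping.single (u @ v) (Poly_Mapping.lookup p u * Poly_Mapping.lookup q v))"
    using assms by (intro sum.mono_neutral_left) (auto simp: in_keys_iff)
  finally show ?thesis .
qed

lemma fmul_add_left: "(p + p') \<star> q = p \<star> q + p' \<star> q"
proof -
  let ?A = "Poly_Mapping.keys p \<union> Poly_Mapping.keys p'" and ?B = "Poly_Mapping.keys q"
  have "Poly_Mapping.keys (p + p') \<subseteq> ?A" by (rule Poly_Mapping.keys_add)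
  then show ?thesis
    by (simp add: fmul_supset[of ?A ?B] lookup_add distrib_right single_add sum.distrib)
qed

lemma fmul_add_right: "p \<star> (q + q') = p \<star> q + p \<star> q'"
proof -
  let ?A = "Poly_Mapping.keys p" and ?B = "Poly_Mapping.keys q \<union> Poly_Mapping.keys q'"
  have "Poly_Mapping.keys (q + q') \<subseteq> ?B" by (rule Poly_Mapping.keys_add)
  then show ?thesis
    by (simp add: fmul_supset[of ?A ?B] lookup_add distrib_left single_add sum.distrib)
qed

lemma fmul_zero [simp]: "0 \<star> q = 0" "p \<star> 0 = 0"
  by (simp_all add: fmul_def)

lemma fmul_diff_right: "p \<star> (q - q') = p \<star> q - p \<star> q'"
  by (metis add_diff_cancel diff_add_cancel fmul_add_right)

lemma fmul_single_single [simp]: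
  "Poly_Mapping.single u a \<star> Poly_Mapping.single v b = Poly_Mapping.single (u @ v) (a * b)"
  by (cases "a = 0"; cases "b = 0") (simp_all add: fmul_def)

lemma poly_mapping_additive_induct [case_names single add]:
  assumes "\<And>k a. P (Poly_Mapping.single k a)" "\<And>p q. P p \<Longrightarrow> P q \<Longrightarrow> P (p + q)"
  shows "P (p :: 'k \<Rightarrow>\<^sub>0 'b::ab_group_add)"
proof -
  have "p = (\<Sum>k\<in>Poly_Mapping.keys p. Poly_Mapping.single k (Poly_Mapping.lookup p k))"
    by (rule poly_mapping_eqI) (simp add: lookup_sum lookup_single when_def in_keys_iff)
  moreover have "P (\<Sum>k\<in>A. Poly_Mapping.single k (Poly_Mapping.lookup p k))" if "finite A" for A
    using that
  proof (induction A)
    case empty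
    then show ?case using assms(1)[of _ 0] by simp
  qed (simp add: assms)
  ultimately show ?thesis by (metis finite_keys)
qed

lemma fmul_assoc: "p \<star> q \<star> r = p \<star> (q \<star> r)"
proof (induction p rule: poly_mapping_additive_induct)
  case (single u a)
  show ?case
  proof (induction q rule: poly_mapping_additive_induct)
    case (single v b)
    show ?case
      by (induction r rule: poly_mapping_additive_induct) (simp_all add: fmul_add_right mult.assoc)
  qed (simp add: fmul_add_right fmul_add_left)
qed (simp add: fmul_add_left)

lemma fmul_cscale_right: "p \<star> (a *\<^sub>c q) = a *\<^sub>c (p \<star> q)" for p q :: "('x, complex) free_alg"
proof (induction p rule: poly_mapping_additive_induct)
  case (single u b)
  show ?case
  proof (induction q rule: poly_mapping_additive_induct)
    case (single v c)
    have *: "a *\<^sub>c Poly_Mapping.single w d = Poly_Mapping.single w (a * d)" for w :: "'x list" and d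
      by (rule poly_mapping_eqI) (simp add: lookup_cscale lookup_single when_def cscale_complex_def)
    show ?case by (simp add: * mult.left_commute)
  qed (simp add: fmul_add_right cs.scale_right_distrib)
qed (simp add: fmul_add_left cs.scale_right_distrib)


section \<open>The algebra of functions of two points and its expansions\<close>

text \<open>The ring \<open>\<complex>[[z,w]]\<close> is \<^typ>\<open>complex fps fps\<close>, with outer variable \<open>w\<close> and inner variable \<open>z\<close>.\<close>

datatype pt = Pz | Pw | Pzw

datatype omega = Om pt nat

primrec coord :: "pt \<Rightarrow> complex fps fps" where
  "coord Pz = fps_const fps_X"
| "coord Pw = fps_X"
| "coord Pzw = fps_const fps_X - fps_X"

type_synonym kfree = "(omega, complex fps fps) free_alg"

text \<open>The even derivation of the free algebra that extends a derivation \<open>\<delta>\<close> of the coefficients and maps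
  \<open>\<Omega>\<^sub>x\<^sup>m\<close> to \<open>-(m+1) \<epsilon>(x) \<Omega>\<^sub>x\<^sup>m\<^sup>+\<^sup>1\<close>, where \<open>\<epsilon>(x)\<close> is the derivative of \<open>x\<close>.\<close>

definition free_deriv ::
    "(complex fps fps \<Rightarrow> complex fps fps) \<Rightarrow> (pt \<Rightarrow> complex fps fps) \<Rightarrow> kfree \<Rightarrow> kfree" where
  "free_deriv \<delta> \<epsilon> p = (\<Sum>u\<in>Poly_Mapping.keys p.
     Poly_Mapping.single u (\<delta> (Poly_Mapping.lookup p u)) +
     (\<Sum>i<length u. case u ! i of Om x m \<Rightarrow>
        Poly_Mapping.single (u[i := Om x (Suc m)]) (- of_nat (Suc m) * \<epsilon> x * Poly_Mapping.lookup p u)))"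

definition free_dz :: "kfree \<Rightarrow> kfree" where
  "free_dz = free_deriv (\<lambda>f. Abs_fps (\<lambda>j. fps_deriv (fps_nth f j))) (\<lambda>x. case x of Pz \<Rightarrow> 1 | Pw \<Rightarrow> 0 | Pzw \<Rightarrow> 1)"

definition free_dw :: "kfree \<Rightarrow> kfree" where
  "free_dw = free_deriv fps_deriv (\<lambda>x. case x of Pz \<Rightarrow> 0 | Pw \<Rightarrow> 1 | Pzw \<Rightarrow> -1)"

inductive_set arnold_relations :: "kfree set" where
  base: "word [Om Pzw 0, Om Pz 0] + word [Om Pw 0, Om Pzw 0] + word [Om Pz 0, Om Pw 0] \<in> arnold_relations"
| dz: "r \<in> arnold_relations \<Longrightarrow> free_dz r \<in> arnold_relations"
| dw: "r \<in> arnold_relations \<Longrightarrow> free_dw r \<in> arnold_relations"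

text \<open>The anticommutators turn the free associative algebra into the free graded commutative algebra
  on the odd generators \<open>\<Omega>\<close>.\<close>

definition kzw_relations :: "kfree set" where
  "kzw_relations =
     {word [g, h] + word [h, g] | g h. True} \<union>
     {Poly_Mapping.single [Om x m] (coord x ^ n) - word [Om x (m - n)] | x m n. n \<le> m} \<union>
     {Poly_Mapping.single [Om x m] (coord x ^ n) | x m n. n > m} \<union>
     {word [Om x n, Om x m] | x n m. True} \<union>
     arnold_relations"

inductive_set kzw_ideal :: "kfree set" where
  zero: "0 \<in> kzw_ideal"
| add: "p \<in> kzw_ideal \<Longrightarrow> q \<in> kzw_ideal \<Longrightarrow> p + q \<in> kzw_ideal"
| mult: "r \<in> kzw_relations \<Longrightarrow> p \<star> r \<star> q \<in> kzw_ideal"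

text \<open>The elements of \<open>\<K>\<^bsub>z,w,z-w\<^esub>\<close> are the cosets of the ideal.\<close>

definition kzw :: "kfree set set" where
  "kzw = {{q. q - p \<in> kzw_ideal} | p. True}"

text \<open>A raviolo series is given by its coefficients with respect to the topological basis
  \<open>e\<^sub>m = z\<^sup>-\<^sup>m\<^sup>-\<^sup>1\<close> for \<open>m < 0\<close> and \<open>e\<^sub>m = \<Omega>\<^sub>z\<^sup>m\<close> for \<open>m \<ge> 0\<close>.  The product of two basis elements is zero or
  again a basis element.\<close>

definition basis_prod :: "int \<Rightarrow> int \<Rightarrow> int option" where
  "basis_prod m n =
     (if m < 0 \<and> n < 0 then Some (m + n + 1)
      else if m \<ge> 0 \<and> n \<ge> 0 then None
      else if m + n + 1 \<ge> 0 then Some (m + n + 1) else None)"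

text \<open>Series in two variables: \<open>a m n\<close> is the coefficient of \<open>e\<^sub>m(z) e\<^sub>n(w)\<close>, in this order.  Both
  \<open>\<complex>\<langle>\<langle>z\<rangle>\<rangle>\<langle>\<langle>w\<rangle>\<rangle>\<close> and \<open>\<complex>\<langle>\<langle>w\<rangle>\<rangle>\<langle>\<langle>z\<rangle>\<rangle>\<close> embed here, and the sum defining the product is finite on either of
  them.  The sign comes from moving \<open>e\<^sub>n(w)\<close> past \<open>e\<^sub>m\<^sub>'(z)\<close>.\<close>

type_synonym series2 = "int \<Rightarrow> int \<Rightarrow> complex"

definition series2_mult :: "series2 \<Rightarrow> series2 \<Rightarrow> series2" where
  "series2_mult a b = (\<lambda>k l. Sum_any (\<lambda>(m, n, m', n').
     if basis_prod m m' = Some k \<and> basis_prod n n' = Some l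
     then (if n \<ge> 0 \<and> m' \<ge> 0 then -1 else 1) * a m n * b m' n' else 0))"

definition series2_of_fps :: "complex fps fps \<Rightarrow> series2" where
  "series2_of_fps f = (\<lambda>m n. if m < 0 \<and> n < 0 then fps_nth (fps_nth f (nat (- n - 1))) (nat (- m - 1)) else 0)"

definition omega_zw :: "omega \<Rightarrow> series2" where
  "omega_zw g = (case g of
     Om Pz m \<Rightarrow> (\<lambda>p q. if p = int m \<and> q = -1 then 1 else 0)
   | Om Pw m \<Rightarrow> (\<lambda>p q. if p = -1 \<and> q = int m then 1 else 0)
   | Om Pzw m \<Rightarrow> (\<lambda>p q. if \<exists>n. q = - int n - 1 \<and> p = int (m + n)
                     then of_nat (nat p choose nat (- q - 1)) else 0))"

definition omega_wz :: "omega \<Rightarrow> series2" where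
  "omega_wz g = (case g of
     Om Pz m \<Rightarrow> (\<lambda>p q. if p = int m \<and> q = -1 then 1 else 0)
   | Om Pw m \<Rightarrow> (\<lambda>p q. if p = -1 \<and> q = int m then 1 else 0)
   | Om Pzw m \<Rightarrow> (\<lambda>p q. if \<exists>n. p = - int n - 1 \<and> q = int (m + n)
                     then (-1) ^ m * of_nat (nat q choose nat (- p - 1)) else 0))"

definition expand :: "(omega \<Rightarrow> series2) \<Rightarrow> kfree \<Rightarrow> series2" where
  "expand e p = (\<lambda>k l. \<Sum>u\<in>Poly_Mapping.keys p.
     foldl (\<lambda>s g. series2_mult s (e g)) (series2_of_fps (Poly_Mapping.lookup p u)) u k l)"

text \<open>Cosets of pole order at most \<open>N\<close> in \<open>z - w\<close>: those with a representative in the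
  \<open>\<complex>[[z,w]]\<close>-subalgebra generated by all \<open>\<Omega>\<^sub>z\<close>, \<open>\<Omega>\<^sub>w\<close> and by the \<open>\<Omega>\<^bsub>z-w\<^esub>\<^sup>k\<close> with \<open>k < N\<close>.\<close>

definition pole_order_le :: "nat \<Rightarrow> kfree set \<Rightarrow> bool" where
  "pole_order_le N X \<longleftrightarrow> (\<exists>p\<in>X. \<forall>u\<in>Poly_Mapping.keys p. \<forall>k. Om Pzw k \<in> set u \<longrightarrow> k < N)"


section \<open>Raviolo fields\<close>

text \<open>A series \<open>A(z) = \<Sum> e\<^sub>m(z) A\<^sub>m\<close> of endomorphisms of \<open>W\<close> is represented by \<open>m \<mapsto> A\<^sub>m\<close>; only the values
  of \<open>A\<^sub>m\<close> on \<open>W\<close> matter.\<close>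

definition endo_on :: "'v::complex_space set \<Rightarrow> ('v \<Rightarrow> 'v) \<Rightarrow> bool" where
  "endo_on W f \<longleftrightarrow> linear_on W f \<and> f ` W \<subseteq> W"

definition raviolo_field :: "'v::complex_space set \<Rightarrow> (int \<Rightarrow> 'v \<Rightarrow> 'v) \<Rightarrow> bool" where
  "raviolo_field W A \<longleftrightarrow> (\<forall>m. endo_on W (A m)) \<and> (\<forall>v\<in>W. \<exists>N. \<forall>m\<ge>N. A m v = 0)"

definition field_degree :: "(int \<Rightarrow> 'v set) \<Rightarrow> int \<Rightarrow> (int \<Rightarrow> 'v \<Rightarrow> 'v) \<Rightarrow> bool" where
  "field_degree G r A \<longleftrightarrow>
     (\<forall>m n. A m ` G n \<subseteq> G (n + (if m < 0 then r else r - 1)))"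

definition ksign :: "int \<Rightarrow> complex" where
  "ksign r = (if even r then 1 else -1)"

text \<open>Coefficients of \<open>\<langle>\<phi>, A(z) B(w) v\<rangle>\<close> and \<open>(-1)\<^bsup>|A||B|\<^esup> \<langle>\<phi>, B(w) A(z) v\<rangle>\<close> for \<open>|A| = r\<close>, \<open>|B| = s\<close>, after
  moving the basis elements to the left in the order \<open>e\<^sub>m(z) e\<^sub>n(w)\<close>.  In the first, \<open>e\<^sub>n(w)\<close>
  passes \<open>A\<^sub>m\<close>.  In the second, \<open>e\<^sub>m(z)\<close> passes \<open>B\<^sub>n\<close> and then \<open>e\<^sub>n(w)\<close>.  The functional is applied to
  coefficients: the Koszul sign of moving \<open>\<phi>\<close> past the basis elements depends only on \<open>\<phi>\<close> and
  on the number of \<open>\<Omega>\<close>'s, and the parity automorphism of \<open>\<K>\<^bsub>z,w,z-w\<^esub>\<close> absorbs it.\<close>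

definition matrix_AB :: "('v \<Rightarrow> complex) \<Rightarrow> int \<Rightarrow> (int \<Rightarrow> 'v \<Rightarrow> 'v) \<Rightarrow> (int \<Rightarrow> 'v \<Rightarrow> 'v) \<Rightarrow> 'v \<Rightarrow> series2" where
  "matrix_AB \<phi> r A B v = (\<lambda>m n.
     (if n \<ge> 0 then ksign (if m < 0 then r else r - 1) else 1) * \<phi> (A m (B n v)))"

definition matrix_BA ::
    "('v \<Rightarrow> complex) \<Rightarrow> int \<Rightarrow> int \<Rightarrow> (int \<Rightarrow> 'v \<Rightarrow> 'v) \<Rightarrow> (int \<Rightarrow> 'v \<Rightarrow> 'v) \<Rightarrow> 'v \<Rightarrow> series2" where
  "matrix_BA \<phi> r s A B v = (\<lambda>m n.
     ksign (r * s) *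
     (if m \<ge> 0 then ksign (if n < 0 then s else s - 1) * (if n \<ge> 0 then -1 else 1) else 1) *
     \<phi> (B n (A m v)))"

definition mutually_local ::
    "'v::complex_space set \<Rightarrow> int \<Rightarrow> (int \<Rightarrow> 'v \<Rightarrow> 'v) \<Rightarrow> int \<Rightarrow> (int \<Rightarrow> 'v \<Rightarrow> 'v) \<Rightarrow> bool" where
  "mutually_local W r A s B \<longleftrightarrow>
     (\<exists>N. \<forall>v\<in>W. \<forall>\<phi>. linear_on W \<phi> \<longrightarrow>
        (\<exists>X\<in>kzw. pole_order_le N X \<and>
           (\<exists>p\<in>X. expand omega_zw p = matrix_AB \<phi> r A B v) \<and>
           (\<exists>q\<in>X. expand omega_wz q = matrix_BA \<phi> r s A B v)))"


section \<open>Raviolo vertex algebras\<close>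

text \<open>\<open>modes V a m\<close> is the mode \<open>a\<^bsub>(m)\<^esub>\<close>.\<close>

record 'v raviolo =
  rspace :: "'v set"
  rdegree :: "int \<Rightarrow> 'v set"
  vacuum :: 'v
  translation :: "'v \<Rightarrow> 'v"
  modes :: "'v \<Rightarrow> int \<Rightarrow> 'v \<Rightarrow> 'v"

definition raviolo_vertex_algebra :: "'v::complex_space raviolo \<Rightarrow> bool" where
  "raviolo_vertex_algebra V \<longleftrightarrow>
     grading_on (rspace V) (rdegree V) \<and>
     vacuum V \<in> rdegree V 0 \<and>
     endo_on (rspace V) (translation V) \<and> (\<forall>n. translation V ` rdegree V n \<subseteq> rdegree V n) \<and>
     (\<forall>m. \<forall>v\<in>rspace V. linear_on (rspace V) (\<lambda>a. modes V a m v)) \<and>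
     (\<forall>a\<in>rspace V. raviolo_field (rspace V) (modes V a)) \<and>
     (\<forall>r. \<forall>a\<in>rdegree V r. field_degree (rdegree V) r (modes V a)) \<and>
     (\<forall>a\<in>rspace V. \<forall>m. \<forall>v\<in>rspace V.
        translation V (modes V a m v) - modes V a m (translation V v) = of_int (- m) *\<^sub>c modes V a (m - 1) v) \<and>
     translation V (vacuum V) = 0 \<and>
     (\<forall>m. \<forall>v\<in>rspace V. modes V (vacuum V) m v = (if m = -1 then v else 0)) \<and>
     (\<forall>a\<in>rspace V. modes V a (-1) (vacuum V) = a \<and> (\<forall>m\<ge>0. modes V a m (vacuum V) = 0)) \<and>
     (\<forall>r s. \<forall>a\<in>rdegree V r. \<forall>b\<in>rdegree V s.
        mutually_local (rspace V) r (modes V a) s (modes V b))"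

definition raviolo_subalgebra :: "'v::complex_space raviolo \<Rightarrow> 'v set \<Rightarrow> bool" where
  "raviolo_subalgebra V U \<longleftrightarrow>
     U \<subseteq> rspace V \<and> graded_subspace U (rdegree V) \<and> vacuum V \<in> U \<and>
     translation V ` U \<subseteq> U \<and> (\<forall>a\<in>U. \<forall>b\<in>U. \<forall>m. modes V a m b \<in> U)"

definition sub_raviolo :: "'v raviolo \<Rightarrow> 'v set \<Rightarrow> 'v raviolo" where
  "sub_raviolo V U = V\<lparr>rspace := U, rdegree := \<lambda>n. U \<inter> rdegree V n\<rparr>"

definition spin_grading :: "'v::complex_space raviolo \<Rightarrow> (int \<Rightarrow> 'v set) \<Rightarrow> bool" where
  "spin_grading V S \<longleftrightarrow>
     grading_on (rspace V) S \<and> (\<forall>s. graded_subspace (S s) (rdegree V)) \<and>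
     vacuum V \<in> S 0 \<and> (\<forall>s. translation V ` S s \<subseteq> S (s + 1)) \<and>
     (\<forall>s t n. \<forall>a\<in>S s. modes V a n ` S t \<subseteq> S (t + (s - n - 1)))"

text \<open>The central charge is 0: the brackets of the modes \<open>G\<^sub>n = \<gamma>\<^bsub>(n)\<^esub>\<close> and \<open>\<Gamma>\<^sub>n = \<gamma>\<^bsub>(-n-1)\<^esub>\<close> have no central terms.\<close>

definition conformal_structure :: "'v::complex_space raviolo \<Rightarrow> (int \<Rightarrow> 'v set) \<Rightarrow> 'v \<Rightarrow> bool" where
  "conformal_structure V S \<gamma> \<longleftrightarrow>
     spin_grading V S \<and> \<gamma> \<noteq> 0 \<and> \<gamma> \<in> rdegree V 1 \<and> \<gamma> \<in> S 2 \<and>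
     (let G = (\<lambda>n::nat. modes V \<gamma> (int n)); \<Gamma> = (\<lambda>n::nat. modes V \<gamma> (- int n - 1)) in
       (\<forall>m n. \<forall>v\<in>rspace V.
          G m (G n v) - G n (G m v) = (of_nat m - of_nat n) *\<^sub>c G (m + n - 1) v) \<and>
       (\<forall>m n. \<forall>v\<in>rspace V. \<Gamma> m (\<Gamma> n v) + \<Gamma> n (\<Gamma> m v) = 0) \<and>
       (\<forall>m n. \<forall>v\<in>rspace V.
          G m (\<Gamma> n v) - \<Gamma> n (G m v) =
            (if n + 1 \<ge> m then of_nat (m + n + 1) *\<^sub>c \<Gamma> (n + 1 - m) v else 0)) \<and>
       (\<forall>v\<in>rspace V. G 0 v = translation V v) \<and>
       (\<forall>s. \<forall>v\<in>S s. G 1 v = of_int s *\<^sub>c v))"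

definition conformal_raviolo_vertex_algebra ::
    "'v::complex_space raviolo \<Rightarrow> (int \<Rightarrow> 'v set) \<Rightarrow> 'v \<Rightarrow> bool" where
  "conformal_raviolo_vertex_algebra V S \<gamma> \<longleftrightarrow> raviolo_vertex_algebra V \<and> conformal_structure V S \<gamma>"

definition conformal_subalgebra ::
    "'v::complex_space raviolo \<Rightarrow> (int \<Rightarrow> 'v set) \<Rightarrow> 'v \<Rightarrow> 'v set \<Rightarrow> bool" where
  "conformal_subalgebra V S \<gamma> U \<longleftrightarrow>
     raviolo_subalgebra V U \<and> \<gamma> \<in> U \<and>
     conformal_raviolo_vertex_algebra (sub_raviolo V U) (\<lambda>s. U \<inter> S s) \<gamma>"

definition strongly_generated :: "'v::complex_space raviolo \<Rightarrow> 'v set \<Rightarrow> bool" where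
  "strongly_generated V A \<longleftrightarrow>
     rspace V = cs.span {foldr (\<lambda>(a, m) v. modes V a m v) ams (vacuum V) | ams.
                          set ams \<subseteq> A \<times> {..<0}}"


section \<open>The Heisenberg Lie algebra and its Fock modules\<close>

text \<open>\<open>Heis f p g q k\<close> is \<open>\<Sum> f\<^sub>n c\<^sub>n + \<Sum> p\<^sub>n \<nu>\<^sub>n + \<Sum> g\<^sub>n \<phi>\<^sub>n + \<Sum> q\<^sub>n b\<^sub>n + k K\<close>; the first and third sums
  may be infinite.\<close>

datatype heis = Heis (hc: "complex fps") (h\<nu>: "complex poly") (h\<phi>: "complex fps") (hb: "complex poly") (hK: complex)

abbreviation c_gen :: "nat \<Rightarrow> heis" where "c_gen n \<equiv> Heis (fps_X ^ n) 0 0 0 0"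
abbreviation \<nu>_gen :: "nat \<Rightarrow> heis" where "\<nu>_gen n \<equiv> Heis 0 (monom 1 n) 0 0 0"
abbreviation \<phi>_gen :: "nat \<Rightarrow> heis" where "\<phi>_gen n \<equiv> Heis 0 0 (fps_X ^ n) 0 0"
abbreviation b_gen :: "nat \<Rightarrow> heis" where "b_gen n \<equiv> Heis 0 0 0 (monom 1 n) 0"

definition heis_add :: "heis \<Rightarrow> heis \<Rightarrow> heis" where
  "heis_add x y = Heis (hc x + hc y) (h\<nu> x + h\<nu> y) (h\<phi> x + h\<phi> y) (hb x + hb y) (hK x + hK y)"

definition heis_scale :: "complex \<Rightarrow> heis \<Rightarrow> heis" where
  "heis_scale a x =
     Heis (fps_const a * hc x) (smult a (h\<nu> x)) (fps_const a * h\<phi> x) (smult a (hb x)) (a * hK x)"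

text \<open>\<open>pairing f p\<close> is \<open>\<Sum>\<^sub>m (m+1) f\<^bsub>m+1\<^esub> p\<^sub>m\<close>, the residue of \<open>f' p\<close>.\<close>

definition pairing :: "complex fps \<Rightarrow> complex poly \<Rightarrow> complex" where
  "pairing f p = (\<Sum>m\<le>degree p. of_nat (m + 1) * fps_nth f (m + 1) * coeff p m)"

definition heis_bracket :: "heis \<Rightarrow> heis \<Rightarrow> heis" where
  "heis_bracket x y = Heis 0 0 0 0
     (- pairing (hc x) (hb y) + pairing (hc y) (hb x) + pairing (h\<phi> y) (h\<nu> x) + pairing (h\<phi> x) (h\<nu> y))"

definition heis_degree :: "int \<Rightarrow> heis set" where
  "heis_degree d = {x. (d \<noteq> 0 \<longrightarrow> hc x = 0 \<and> hb x = 0 \<and> hK x = 0) \<and>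
                       (d \<noteq> 1 \<longrightarrow> h\<nu> x = 0) \<and> (d \<noteq> -1 \<longrightarrow> h\<phi> x = 0)}"

text \<open>\<open>c\<^sub>n\<close> and \<open>\<phi>\<^sub>n\<close> have spin \<open>-n\<close>, \<open>\<nu>\<^sub>n\<close> and \<open>b\<^sub>n\<close> have spin \<open>n+1\<close>: for a field \<open>a(z)\<close> of spin 1, the mode
  \<open>a\<^bsub>(m)\<^esub>\<close> has spin \<open>-m\<close>, and \<open>c\<^sub>n = \<nu>\<^bsub>(n)\<^esub>\<close>, \<open>\<phi>\<^sub>n = b\<^bsub>(n)\<^esub>\<close>, \<open>\<nu>\<^sub>n = \<nu>\<^bsub>(-n-1)\<^esub>\<close>, \<open>b\<^sub>n = b\<^bsub>(-n-1)\<^esub>\<close>.\<close>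

definition heis_spin :: "int \<Rightarrow> heis set" where
  "heis_spin s = {x. (\<forall>n. s \<noteq> - int n \<longrightarrow> fps_nth (hc x) n = 0 \<and> fps_nth (h\<phi> x) n = 0) \<and>
                     (\<forall>n. s \<noteq> int n + 1 \<longrightarrow> coeff (h\<nu> x) n = 0 \<and> coeff (hb x) n = 0) \<and>
                     (s \<noteq> 0 \<longrightarrow> hK x = 0)}"

definition heis_nonneg :: "heis set" where
  "heis_nonneg = {x. h\<nu> x = 0 \<and> hb x = 0}"

text \<open>The action of \<open>heis_nonneg\<close> on the one-dimensional module \<open>\<complex>|\<mu>\<rangle>\<close>.\<close>

definition fock_character :: "complex \<Rightarrow> heis \<Rightarrow> complex" where
  "fock_character \<mu> x = \<mu> * fps_nth (hc x) 0 + hK x"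

text \<open>The relations of the enveloping algebra, as a quotient of the free algebra on the set
  \<^typ>\<open>heis\<close>: the first two sets give the tensor algebra of the vector space.\<close>

definition enveloping_relations :: "(heis, complex) free_alg set" where
  "enveloping_relations =
     {word [heis_add x y] - word [x] - word [y] | x y. True} \<union>
     {word [heis_scale a x] - a *\<^sub>c word [x] | a x. True} \<union>
     {word [x, y] - ksign (d * e) *\<^sub>c word [y, x] - word [heis_bracket x y] | x y d e.
        x \<in> heis_degree d \<and> y \<in> heis_degree e}"

text \<open>\<open>Fock\<^sub>\<mu>\<close> is the free algebra modulo \<open>fock_relations \<mu>\<close>.  The class of a word \<open>u\<close> stands for
  \<open>u \<otimes> |\<mu>\<rangle>\<close>, and the second set consists of the balancing relations \<open>p h \<otimes> |\<mu>\<rangle> = p \<otimes> h|\<mu>\<rangle>\<close>.\<close>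

definition fock_relations :: "complex \<Rightarrow> (heis, complex) free_alg set" where
  "fock_relations \<mu> = cs.span
     ({p \<star> r \<star> q | p r q. r \<in> enveloping_relations} \<union>
      {p \<star> (word [h] - fock_character \<mu> h *\<^sub>c word []) | p h. h \<in> heis_nonneg})"

lemma subspace_fock_relations: "cs.subspace (fock_relations \<mu>)"
  by (simp add: fock_relations_def)

lemma fock_relations_left_ideal:
  assumes "t \<in> fock_relations \<mu>"
  shows "p \<star> t \<in> fock_relations \<mu>"
  using assms unfolding fock_relations_def
proof (induction rule: cs.span_induct_alt)
  case base
  show ?case by (simp add: cs.span_zero)
next
  case (step a x y)
  let ?R = "{p \<star> r \<star> q | p r q. r \<in> enveloping_relations} \<union>
      {p \<star> (word [h] - fock_character \<mu> h *\<^sub>c word []) | p h. h \<in> heis_nonneg}"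
  have "p \<star> x \<in> ?R"
    using step(1)
  proof
    assume "x \<in> {p \<star> r \<star> q | p r q. r \<in> enveloping_relations}"
    then obtain p' r q where "x = p' \<star> r \<star> q" "r \<in> enveloping_relations" by blast
    then have "p \<star> x = (p \<star> p') \<star> r \<star> q" "r \<in> enveloping_relations" by (simp_all add: fmul_assoc)
    then show ?thesis by blast
  next
    assume "x \<in> {p \<star> (word [h] - fock_character \<mu> h *\<^sub>c word []) | p h. h \<in> heis_nonneg}"
    then obtain p' h where "x = p' \<star> (word [h] - fock_character \<mu> h *\<^sub>c word [])" "h \<in> heis_nonneg"
      by blast
    then have "p \<star> x = (p \<star> p') \<star> (word [h] - fock_character \<mu> h *\<^sub>c word [])" "h \<in> heis_nonneg"
      by (simp_all add: fmul_assoc)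
    then show ?thesis by blast
  qed
  then show ?case
    unfolding fmul_add_right fmul_cscale_right
    by (rule cs.span_add[OF cs.span_scale[OF cs.span_base] step(2)])
qed

text \<open>The direct sum of the modules \<open>Fock\<^sub>m\<close>, \<open>m \<in> \<int>\<close>: families of elements of the free algebra with
  finite support, modulo the families of relations.\<close>

quotient_type lattice_fock = "int \<Rightarrow>\<^sub>0 (heis, complex) free_alg" /
  "\<lambda>F G. \<forall>m. Poly_Mapping.lookup F m - Poly_Mapping.lookup G m \<in> fock_relations (of_int m)"
proof (rule equivpI)
  let ?R = "\<lambda>F G :: int \<Rightarrow>\<^sub>0 (heis, complex) free_alg. \<forall>m.
    Poly_Mapping.lookup F m - Poly_Mapping.lookup G m \<in> fock_relations (of_int m)"
  show "reflp ?R" by (rule reflpI) (simp add: cs.subspace_0 subspace_fock_relations)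
  show "symp ?R"
  proof (rule sympI, rule allI)
    fix F G m assume "?R F G"
    then have "- (Poly_Mapping.lookup F m - Poly_Mapping.lookup G m) \<in> fock_relations (of_int m)"
      by (intro cs.subspace_neg subspace_fock_relations) simp
    then show "Poly_Mapping.lookup G m - Poly_Mapping.lookup F m \<in> fock_relations (of_int m)" by simp
  qed
  show "transp ?R"
  proof (rule transpI, rule allI)
    fix F G H m assume "?R F G" "?R G H"
    then have "(Poly_Mapping.lookup F m - Poly_Mapping.lookup G m) +
        (Poly_Mapping.lookup G m - Poly_Mapping.lookup H m) \<in> fock_relations (of_int m)"
      by (intro cs.subspace_add subspace_fock_relations) simp_all
    then show "Poly_Mapping.lookup F m - Poly_Mapping.lookup H m \<in> fock_relations (of_int m)" by simp
  qed
qed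

instantiation lattice_fock :: complex_space
begin

lift_definition zero_lattice_fock :: lattice_fock is 0 .

lift_definition plus_lattice_fock :: "lattice_fock \<Rightarrow> lattice_fock \<Rightarrow> lattice_fock" is "(+)"
proof -
  fix F F' G G' :: "int \<Rightarrow>\<^sub>0 (heis, complex) free_alg" and m
  assume "\<And>m. Poly_Mapping.lookup F m - Poly_Mapping.lookup F' m \<in> fock_relations (of_int m)"
    and "\<And>m. Poly_Mapping.lookup G m - Poly_Mapping.lookup G' m \<in> fock_relations (of_int m)"
  then have "(Poly_Mapping.lookup F m - Poly_Mapping.lookup F' m) +
      (Poly_Mapping.lookup G m - Poly_Mapping.lookup G' m) \<in> fock_relations (of_int m)"
    by (intro cs.subspace_add subspace_fock_relations) simp_all
  then show "Poly_Mapping.lookup (F + G) m - Poly_Mapping.lookup (F' + G') m \<in> fock_relations (of_int m)"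
    by (simp add: lookup_add algebra_simps)
qed

lift_definition uminus_lattice_fock :: "lattice_fock \<Rightarrow> lattice_fock" is uminus
proof -
  fix F G :: "int \<Rightarrow>\<^sub>0 (heis, complex) free_alg" and m
  assume "\<And>m. Poly_Mapping.lookup F m - Poly_Mapping.lookup G m \<in> fock_relations (of_int m)"
  then have "- (Poly_Mapping.lookup F m - Poly_Mapping.lookup G m) \<in> fock_relations (of_int m)"
    by (intro cs.subspace_neg subspace_fock_relations) simp
  then show "Poly_Mapping.lookup (- F) m - Poly_Mapping.lookup (- G) m \<in> fock_relations (of_int m)"
    by simp
qed

definition minus_lattice_fock :: "lattice_fock \<Rightarrow> lattice_fock \<Rightarrow> lattice_fock" where
  "minus_lattice_fock x y = x + (- y)"

lift_definition cscale_lattice_fock :: "complex \<Rightarrow> lattice_fock \<Rightarrow> lattice_fock" is cscale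
proof -
  fix a and F G :: "int \<Rightarrow>\<^sub>0 (heis, complex) free_alg" and m
  assume "\<And>m. Poly_Mapping.lookup F m - Poly_Mapping.lookup G m \<in> fock_relations (of_int m)"
  then have "a *\<^sub>c (Poly_Mapping.lookup F m - Poly_Mapping.lookup G m) \<in> fock_relations (of_int m)"
    by (intro cs.subspace_scale subspace_fock_relations) simp
  then show "Poly_Mapping.lookup (a *\<^sub>c F) m - Poly_Mapping.lookup (a *\<^sub>c G) m \<in> fock_relations (of_int m)"
    by (simp add: lookup_cscale cs.scale_right_diff_distrib)
qed

instance
proof
  note z = cs.subspace_0[OF subspace_fock_relations]
  fix x y u :: lattice_fock and a b :: complex
  show "x + y + u = x + (y + u)" by transfer (simp add: add.assoc z)
  show "x + y = y + x" by transfer (simp add: add.commute z)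
  show "0 + x = x" by transfer (simp add: z)
  show "- x + x = 0" by transfer (simp add: z)
  show "x - y = x + - y" by (simp add: minus_lattice_fock_def)
  show "a *\<^sub>c (x + y) = a *\<^sub>c x + a *\<^sub>c y" by transfer (simp add: cscale_right_distrib z)
  show "(a + b) *\<^sub>c x = a *\<^sub>c x + b *\<^sub>c x" by transfer (simp add: cscale_left_distrib z)
  show "a *\<^sub>c b *\<^sub>c x = (a * b) *\<^sub>c x" by transfer (simp add: z)
  show "1 *\<^sub>c x = x" by transfer (simp add: z)
qed

end

lift_definition fock_action :: "heis \<Rightarrow> lattice_fock \<Rightarrow> lattice_fock" is
  "\<lambda>x. Poly_Mapping.map (\<lambda>t. word [x] \<star> t)"
proof -
  fix x and F G :: "int \<Rightarrow>\<^sub>0 (heis, complex) free_alg" and m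
  assume "\<And>m. Poly_Mapping.lookup F m - Poly_Mapping.lookup G m \<in> fock_relations (of_int m)"
  then have "word [x] \<star> (Poly_Mapping.lookup F m - Poly_Mapping.lookup G m) \<in> fock_relations (of_int m)"
    by (intro fock_relations_left_ideal) simp
  moreover have "Poly_Mapping.lookup (Poly_Mapping.map (\<lambda>t. word [x] \<star> t) F) m =
      word [x] \<star> Poly_Mapping.lookup F m" for F :: "int \<Rightarrow>\<^sub>0 (heis, complex) free_alg"
    by (simp add: map.rep_eq when_def)
  ultimately show "Poly_Mapping.lookup (Poly_Mapping.map (\<lambda>t. word [x] \<star> t) F) m -
      Poly_Mapping.lookup (Poly_Mapping.map (\<lambda>t. word [x] \<star> t) G) m \<in> fock_relations (of_int m)"
    by (simp add: fmul_diff_right)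
qed

text \<open>The inclusion of the summand \<open>Fock\<^sub>m\<close>, on representatives.\<close>

definition fock_class :: "int \<Rightarrow> (heis, complex) free_alg \<Rightarrow> lattice_fock" where
  "fock_class m t = abs_lattice_fock (Poly_Mapping.single m t)"

definition fock :: "int \<Rightarrow> lattice_fock set" where
  "fock m = range (fock_class m)"

definition fock_ket :: "int \<Rightarrow> lattice_fock" where
  "fock_ket m = fock_class m (word [])"

definition fock_degree :: "int \<Rightarrow> lattice_fock set" where
  "fock_degree n = cs.span {foldr fock_action xs (fock_ket m) | m xs ds.
     list_all2 (\<lambda>x d. x \<in> heis_degree d) xs ds \<and> sum_list ds = n}"

definition fock_spin :: "int \<Rightarrow> lattice_fock set" where
  "fock_spin s = cs.span {foldr fock_action xs (fock_ket m) | m xs ss.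
     list_all2 (\<lambda>x t. x \<in> heis_spin t) xs ss \<and> sum_list ss = s}"


section \<open>The Heisenberg raviolo vertex algebra\<close>

definition b_field :: "int \<Rightarrow> lattice_fock \<Rightarrow> lattice_fock" where
  "b_field m = fock_action (if m < 0 then b_gen (nat (- m - 1)) else \<phi>_gen (nat m))"

definition \<nu>_field :: "int \<Rightarrow> lattice_fock \<Rightarrow> lattice_fock" where
  "\<nu>_field m = fock_action (if m < 0 then \<nu>_gen (nat (- m - 1)) else c_gen (nat m))"

definition b_vec :: lattice_fock where
  "b_vec = fock_action (b_gen 0) (fock_ket 0)"

definition \<nu>_vec :: lattice_fock where
  "\<nu>_vec = fock_action (\<nu>_gen 0) (fock_ket 0)"

definition conformal_vec :: lattice_fock where
  "conformal_vec = - fock_action (b_gen 0) (fock_action (\<nu>_gen 0) (fock_ket 0))"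

text \<open>The derivation \<open>\<nu>\<^sub>n \<mapsto> (n+1)\<nu>\<^bsub>n+1\<^esub>\<close>, \<open>c\<^sub>n \<mapsto> -n c\<^bsub>n-1\<^esub>\<close>, \<open>b\<^sub>n \<mapsto> (n+1)b\<^bsub>n+1\<^esub>\<close>, \<open>\<phi>\<^sub>n \<mapsto> -n \<phi>\<^bsub>n-1\<^esub>\<close>, \<open>K \<mapsto> 0\<close>;
  on the polynomials \<open>p\<close> representing combinations of \<open>\<nu>\<close>'s or \<open>b\<close>'s it is \<open>p \<mapsto> u (u p)'\<close>.\<close>

definition heis_translation :: "heis \<Rightarrow> heis" where
  "heis_translation x = Heis (- fps_deriv (hc x)) (pCons 0 (pderiv (pCons 0 (h\<nu> x))))
     (- fps_deriv (h\<phi> x)) (pCons 0 (pderiv (pCons 0 (hb x)))) 0"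

text \<open>These conditions determine the structure on \<open>H = Fock\<^sub>0\<close> uniquely.\<close>

definition heisenberg_raviolo_algebra :: "lattice_fock raviolo \<Rightarrow> bool" where
  "heisenberg_raviolo_algebra H \<longleftrightarrow>
     raviolo_vertex_algebra H \<and>
     rspace H = fock 0 \<and> rdegree H = (\<lambda>n. fock 0 \<inter> fock_degree n) \<and> vacuum H = fock_ket 0 \<and>
     translation H (fock_ket 0) = 0 \<and>
     (\<forall>x. \<forall>v\<in>fock 0. translation H (fock_action x v) =
        fock_action (heis_translation x) v + fock_action x (translation H v)) \<and>
     (\<forall>m. \<forall>v\<in>fock 0. modes H b_vec m v = b_field m v \<and> modes H \<nu>_vec m v = \<nu>_field m v) \<and>
     strongly_generated H {b_vec, \<nu>_vec}"

text \<open>The \<open>H\<close>-module structure of the direct sum is the one coming from the fields of \<open>V\<close>.  It is fixed by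
  the action of the strong generators \<open>b(z)\<close> and \<open>\<nu>(z)\<close>.\<close>

definition extends_heisenberg_module :: "lattice_fock raviolo \<Rightarrow> bool" where
  "extends_heisenberg_module V \<longleftrightarrow>
     (\<forall>m v. modes V b_vec m v = b_field m v \<and> modes V \<nu>_vec m v = \<nu>_field m v)"

end

theory Submission
  imports Defs "HOL-Library.FSet" "HOL-Library.Multiset"
begin

text \<open>
The operators \<open>b\<^sub>n\<close> and \<open>\<nu>\<^sub>n\<close> act on the direct sum of the Fock modules as multiplications, and the
vectors \<open>|m\<rangle>\<close> multiply like the powers of an invertible element.  So the sum is a supercommutative algebra,
the tensor product of the Laurent polynomials in \<open>|1\<rangle>\<close>, the polynomials in the \<open>b\<^sub>n\<close> and the exterior
algebra on the \<open>\<nu>\<^sub>n\<close>.  It is best understood through formal variables \<open>x\<^sub>n\<close> with \<open>|1\<rangle> = exp x\<^sub>0\<close> and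
\<open>b\<^sub>n = -(n+1) x\<^bsub>n+1\<^esub>\<close>: the translation operator \<open>T\<close> is the derivation with \<open>T x\<^sub>n = (n+1) x\<^bsub>n+1\<^esub>\<close> and
\<open>T \<nu>\<^sub>n = (n+1) \<nu>\<^bsub>n+1\<^esub>\<close>, and the annihilation modes are the derivatives \<open>c\<^sub>n = \<partial>/\<partial>x\<^sub>n\<close> and
\<open>\<phi>\<^bsub>n+1\<^esub> = (n+1) \<partial>/\<partial>\<nu>\<^sub>n\<close>.

Since \<open>\<Omega>\<^sub>z\<^sup>m \<Omega>\<^sub>z\<^sup>n = 0\<close>, a normally ordered product of fields contains at most one annihilation mode.  The
modes \<open>a\<^bsub>(-j-1)\<^esub>\<close> are therefore multiplications by \<open>T\<^sup>j a / j!\<close>, and the modes \<open>a\<^bsub>(n)\<^esub>\<close> with \<open>n \<ge> 0\<close> are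
derivations, obtained by a single contraction (\<open>br\<close>).  There are no quantum corrections: the structure is that
of a Poisson vertex algebra with a bracket of odd degree.

For locality, the normally ordered part of \<open>A(z) B(w)\<close> is always an element of \<open>\<K>\<^bsub>z,w,z-w\<^esub>\<close>; what has to be
shown is that the commutators of modes are the two expansions of one polar part
\<open>\<Sum>\<^sub>k \<Omega>\<^bsub>z-w\<^esub>\<^sup>k C\<^sub>k(w)\<close>.  One explicit representative serves both expansions (\<open>mutually_local_criterion\<close>).  The
commutator of \<open>a\<^bsub>(m)\<^esub>\<close> with a multiplication follows from the Leibniz rule and \<open>[T, a\<^bsub>(m)\<^esub>] = -m a\<^bsub>(m-1)\<^esub>\<close>
(\<open>br_mul\<close>, \<open>br_Tp\<close>).  Exchanging the roles of \<open>a\<close> and \<open>b\<close> requires skew symmetry, which is integration by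
parts (\<open>br_skew\<close>, \<open>br_Tp_skew\<close>).  For two modes with non-negative index only one of the expansions sees the
polar part, and it suffices that \<open>(z-w)\<^sup>N\<close> annihilates their commutator (\<open>br_commutator\<close>).

The Fock modules are given by generators and relations, so a concrete model is needed to see that the creation
monomials are linearly independent.  This yields a recursion principle (\<open>fock_rec\<close>), by which the product and
the automorphisms that scale the generators are defined, and all identities are proved by induction along
creation operators (\<open>creation_induct\<close>).  Degree and spin are eigenspace decompositions for scaling
automorphisms, \<open>Fock\<^sub>0\<close> is the kernel of \<open>c\<^sub>0\<close>, and all axioms are verified simultaneously for the whole space
and for \<open>Fock\<^sub>0\<close>.  The modes of the conformal vector are explicit vector fields, and their brackets are
compared on generators.
\<close>

section \<open>Linear maps and gradings by eigenvalues\<close>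

definition clinear :: "('v::complex_space \<Rightarrow> 'w::complex_space) \<Rightarrow> bool" where
  "clinear f \<longleftrightarrow> (\<forall>x y. f (x + y) = f x + f y) \<and> (\<forall>a x. f (a *\<^sub>c x) = a *\<^sub>c f x)"

lemma clinearI:
  "(\<And>x y. f (x + y) = f x + f y) \<Longrightarrow> (\<And>a x. f (a *\<^sub>c x) = a *\<^sub>c f x) \<Longrightarrow> clinear f"
  by (simp add: clinear_def)

lemma clinear_add: "clinear f \<Longrightarrow> f (x + y) = f x + f y"
  and clinear_scale: "clinear f \<Longrightarrow> f (a *\<^sub>c x) = a *\<^sub>c f x"
  by (simp_all add: clinear_def)

lemma clinear_0: "clinear f \<Longrightarrow> f 0 = 0"
  using clinear_scale[of f 0 0] by simp

lemma clinear_uminus: "clinear f \<Longrightarrow> f (- x) = - f x"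
  using clinear_scale[of f "-1" x] by simp

lemma clinear_diff: "clinear f \<Longrightarrow> f (x - y) = f x - f y"
  using clinear_add[of f x "- y"] by (simp add: clinear_uminus)

lemma clinear_sum: "clinear f \<Longrightarrow> f (\<Sum>i\<in>I. g i) = (\<Sum>i\<in>I. f (g i))"
  by (induction I rule: infinite_finite_induct) (simp_all add: clinear_0 clinear_add)

lemmas clinear_simps = clinear_add clinear_scale clinear_0 clinear_uminus clinear_diff clinear_sum

lemma clinear_linear_on: "clinear f \<Longrightarrow> linear_on W f"
  by (simp add: linear_on_def clinear_simps)

lemma clinear_comp: "clinear f \<Longrightarrow> clinear g \<Longrightarrow> clinear (\<lambda>x. f (g x))"
  by (simp add: clinear_def)

lemma clinear_id: "clinear (\<lambda>x. x)"
  by (simp add: clinear_def)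

lemma clinear_sum_fun: "(\<And>i. i \<in> I \<Longrightarrow> clinear (f i)) \<Longrightarrow> clinear (\<lambda>x. \<Sum>i\<in>I. f i x)"
  by (auto simp: clinear_def sum.distrib cs.scale_sum_right)

lemma clinear_add_fun: "clinear f \<Longrightarrow> clinear g \<Longrightarrow> clinear (\<lambda>x. f x + g x)"
  by (simp add: clinear_def cs.scale_right_distrib algebra_simps)

lemma clinear_scale_fun: "clinear f \<Longrightarrow> clinear (\<lambda>x. a *\<^sub>c f x)"
  by (simp add: clinear_def cs.scale_right_distrib mult.commute)

lemma subspace_eigen: "clinear f \<Longrightarrow> cs.subspace {v. f v = a *\<^sub>c v}"
  by (auto simp: cs.subspace_def clinear_simps cs.scale_right_distrib mult.commute)

text \<open>Induction on the number of terms: subtracting \<open>e j\<close> times the sum from its image under \<open>f\<close> removes one term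
  and rescales the others by nonzero factors.\<close>

lemma eigenvectors_sum_zero:
  assumes f: "clinear f" and "finite I" "inj_on e I"
    and "\<And>i. i \<in> I \<Longrightarrow> f (x i) = e i *\<^sub>c x i" and "(\<Sum>i\<in>I. x i) = 0" and "i \<in> I"
  shows "x i = 0"
  using assms(2-)
proof (induction I arbitrary: x i rule: finite_induct)
  case empty
  then show ?case by simp
next
  case (insert j I)
  let ?y = "\<lambda>i. (e i - e j) *\<^sub>c x i"
  have s: "x j + (\<Sum>i\<in>I. x i) = 0" using insert by simp
  have "f (x j + (\<Sum>i\<in>I. x i)) = 0" using s f by (simp add: clinear_0)
  then have "e j *\<^sub>c x j + (\<Sum>i\<in>I. e i *\<^sub>c x i) = 0"
    using insert.prems(2) by (simp add: clinear_simps f)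
  moreover have "e j *\<^sub>c x j + (\<Sum>i\<in>I. e j *\<^sub>c x i) = 0"
    using s by (metis cs.scale_right_distrib cs.scale_sum_right cs.scale_zero_right)
  ultimately have "(\<Sum>i\<in>I. e i *\<^sub>c x i) = (\<Sum>i\<in>I. e j *\<^sub>c x i)"
    by (metis add_left_cancel)
  then have "(\<Sum>i\<in>I. ?y i) = 0"
    by (simp add: cs.scale_left_diff_distrib sum_subtractf)
  then have *: "?y i = 0" if "i \<in> I" for i
    using insert.IH[of ?y i] insert.prems that
    by (auto simp: clinear_scale[OF f] mult.commute)
  have I0: "x i = 0" if "i \<in> I" for i
    using *[OF that] that insert.hyps insert.prems(1) by (auto simp: inj_on_def)
  then have "x j = 0" using s by simp
  with I0 show ?case using insert.prems by auto
qed

lemma sum_nonzero_support: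
  assumes "finite A" "\<And>n. n \<notin> A \<Longrightarrow> f n = 0"
  shows "(\<Sum>n | f n \<noteq> 0. f n) = (\<Sum>n\<in>A. f n)"
  by (rule sum.mono_neutral_left) (use assms in auto)

lemma powi_2_inj: "inj (\<lambda>n::int. (2::complex) powi n)"
proof (rule injI)
  fix m n :: int assume "(2::complex) powi m = 2 powi n"
  then have "norm ((2::complex) powi m) = norm ((2::complex) powi n)" by simp
  then have "(2::real) powi m = 2 powi n" by (simp add: norm_power_int)
  then show "m = n"
    using power_int_strict_increasing[of m n "2::real"] power_int_strict_increasing[of n m "2::real"]
    by (cases m n rule: linorder_cases) simp_all
qed

text \<open>The gradings are recognised as eigenspace decompositions: powers of \<open>2\<close> serve as pairwise
  distinct eigenvalues.\<close>

lemma grading_by_eigenvalues: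
  assumes f: "clinear f" and sub: "\<And>n. cs.subspace (G n)"
    and eig: "\<And>n v. v \<in> G n \<Longrightarrow> f v = (2 powi n) *\<^sub>c v"
    and ex: "\<And>v. \<exists>g. (\<forall>n. g n \<in> G n) \<and> finite {n. g n \<noteq> 0} \<and> v = (\<Sum>n | g n \<noteq> 0. g n)"
  shows "grading_on UNIV G" and "G n = {v. f v = (2 powi n) *\<^sub>c v}"
proof -
  have uniq: "g = h" if g: "\<forall>n. f (g n) = (2 powi n) *\<^sub>c g n" "finite {n. g n \<noteq> 0}"
    and h: "\<forall>n. f (h n) = (2 powi n) *\<^sub>c h n" "finite {n. h n \<noteq> 0}"
    and eq: "(\<Sum>n | g n \<noteq> 0. g n) = (\<Sum>n | h n \<noteq> 0. h n)" for g h :: "int \<Rightarrow> 'a"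
  proof
    fix n
    let ?A = "insert n ({n. g n \<noteq> 0} \<union> {n. h n \<noteq> 0})"
    have fin: "finite ?A" using g h by simp
    have "(\<Sum>n\<in>?A. g n - h n) = 0"
      using eq sum_nonzero_support[OF fin, of g] sum_nonzero_support[OF fin, of h]
      by (simp add: sum_subtractf)
    then have "g n - h n = 0"
      by (intro eigenvectors_sum_zero[OF f fin, of "\<lambda>n. 2 powi n" "\<lambda>n. g n - h n"])
        (use g h powi_2_inj in \<open>auto simp: inj_on_def clinear_simps f cs.scale_right_diff_distrib\<close>)
    then show "g n = h n" by simp
  qed
  show "grading_on UNIV G"
    unfolding grading_on_def
  proof (intro conjI allI ballI)
    fix v
    obtain g where g: "\<forall>n. g n \<in> G n" "finite {n. g n \<noteq> 0}" "v = (\<Sum>n | g n \<noteq> 0. g n)"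
      using ex by blast
    show "\<exists>!g. (\<forall>n. g n \<in> G n) \<and> finite {n. g n \<noteq> 0} \<and> v = (\<Sum>n | g n \<noteq> 0. g n)"
    proof (rule ex1I[of _ g])
      fix h assume "(\<forall>n. h n \<in> G n) \<and> finite {n. h n \<noteq> 0} \<and> v = (\<Sum>n | h n \<noteq> 0. h n)"
      then show "h = g" using g eig by (intro uniq) auto
    qed (use g in simp)
  qed (use sub in \<open>auto simp: cs.subspace_UNIV\<close>)
  have "v \<in> G n" if v: "f v = (2 powi n) *\<^sub>c v" for v
  proof -
    obtain g where g: "\<forall>n. g n \<in> G n" "finite {n. g n \<noteq> 0}" "v = (\<Sum>n | g n \<noteq> 0. g n)"
      using ex by blast
    let ?h = "\<lambda>m. if m = n then v else 0"
    have "{m. ?h m \<noteq> 0} \<subseteq> {n}" by auto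
    then have fh: "finite {m. ?h m \<noteq> 0}" by (rule finite_subset) simp
    have "(\<Sum>m | ?h m \<noteq> 0. ?h m) = (\<Sum>m\<in>{n}. ?h m)"
      by (rule sum_nonzero_support) auto
    then have "g = ?h"
      by (intro uniq) (use g v eig fh in \<open>auto simp: clinear_0[OF f]\<close>)
    then have "g n = v" by simp
    then show ?thesis using g(1) by auto
  qed
  then show "G n = {v. f v = (2 powi n) *\<^sub>c v}" using eig by blast
qed

lemma grading_components:
  assumes "grading_on W G" "x \<in> W"
  obtains f where "\<And>n. f n \<in> G n" "finite {n. f n \<noteq> 0}" "(\<Sum>n | f n \<noteq> 0. f n) = x"
proof -
  have "\<exists>!f. (\<forall>n. f n \<in> G n) \<and> finite {n. f n \<noteq> 0} \<and> x = (\<Sum>n | f n \<noteq> 0. f n)"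
    using assms by (simp add: grading_on_def)
  then obtain f where "\<forall>n. f n \<in> G n" "finite {n. f n \<noteq> 0}" "x = (\<Sum>n | f n \<noteq> 0. f n)"
    by (elim ex1E conjE)
  then show ?thesis using that[of f] by simp
qed

lemma grading_unique:
  assumes "grading_on W G" "\<And>n. f n \<in> G n" "finite {n. f n \<noteq> 0}"
    and "\<And>n. g n \<in> G n" "finite {n. g n \<noteq> 0}" "(\<Sum>n | f n \<noteq> 0. f n) = (\<Sum>n | g n \<noteq> 0. g n)"
  shows "f = g"
proof -
  define x where "x = (\<Sum>n | f n \<noteq> 0. f n)"
  have "x \<in> W" unfolding x_def
    by (rule cs.subspace_sum) (use assms in \<open>auto simp: grading_on_def\<close>)
  then have "\<exists>!h. (\<forall>n. h n \<in> G n) \<and> finite {n. h n \<noteq> 0} \<and> x = (\<Sum>n | h n \<noteq> 0. h n)"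
    using assms(1) by (simp add: grading_on_def)
  then obtain h where h: "\<And>k. (\<forall>n. k n \<in> G n) \<and> finite {n. k n \<noteq> 0} \<and> x = (\<Sum>n | k n \<noteq> 0. k n) \<Longrightarrow> k = h"
    by (elim ex1E) blast
  have "f = h" by (rule h) (simp add: assms x_def)
  moreover have "g = h" by (rule h) (simp add: assms x_def)
  ultimately show ?thesis by simp
qed

lemma graded_subspaceI:
  assumes G: "grading_on UNIV G" and U: "cs.subspace U"
    and comp: "\<And>g n. (\<And>k. g k \<in> G k) \<Longrightarrow> finite {k. g k \<noteq> 0} \<Longrightarrow> (\<Sum>k | g k \<noteq> 0. g k) \<in> U \<Longrightarrow> g n \<in> U"
  shows "graded_subspace U G"
  unfolding graded_subspace_def grading_on_def
proof (intro conjI allI ballI)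
  fix x assume x: "x \<in> U"
  obtain f where f: "\<And>n. f n \<in> G n" "finite {n. f n \<noteq> 0}" "(\<Sum>n | f n \<noteq> 0. f n) = x"
    by (rule grading_components[OF G UNIV_I[of x]]) blast
  have "f n \<in> U \<inter> G n" for n using comp[of f n] f x by simp
  moreover have "h = f" if "\<forall>n. h n \<in> U \<inter> G n" "finite {n. h n \<noteq> 0}" "x = (\<Sum>n | h n \<noteq> 0. h n)" for h
    by (rule grading_unique[OF G]) (use f that in auto)
  ultimately show "\<exists>!f. (\<forall>n. f n \<in> U \<inter> G n) \<and> finite {n. f n \<noteq> 0} \<and> x = (\<Sum>n | f n \<noteq> 0. f n)"
    by (intro ex1I[of _ f] conjI) (use f in simp_all)
qed (use G U in \<open>auto simp: grading_on_def cs.subspace_inter\<close>)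

text \<open>Applying the operator to the components of an eigenvector, and scaling them by the eigenvalue, gives two
  decompositions of the same vector; by uniqueness each component is an eigenvector.\<close>

lemma graded_subspace_eigen:
  assumes G: "grading_on UNIV G" and f: "clinear f" and pres: "\<And>n v. v \<in> G n \<Longrightarrow> f v \<in> G n"
  shows "graded_subspace {v. f v = a *\<^sub>c v} G"
proof (rule graded_subspaceI[OF G subspace_eigen[OF f]])
  fix g :: "int \<Rightarrow> 'a" and n
  assume g: "\<And>k. g k \<in> G k" "finite {k. g k \<noteq> 0}" and x: "(\<Sum>k | g k \<noteq> 0. g k) \<in> {v. f v = a *\<^sub>c v}"
  let ?x = "\<Sum>k | g k \<noteq> 0. g k"
  let ?u = "\<lambda>k. f (g k)" and ?w = "\<lambda>k. a *\<^sub>c g k"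
  have nz: "{k. ?u k \<noteq> 0} \<subseteq> {k. g k \<noteq> 0}" "{k. ?w k \<noteq> 0} \<subseteq> {k. g k \<noteq> 0}"
    by (auto simp: clinear_0[OF f])
  have fin: "finite {k. ?u k \<noteq> 0}" "finite {k. ?w k \<noteq> 0}"
    by (rule finite_subset[OF nz(1) g(2)], rule finite_subset[OF nz(2) g(2)])
  have "(\<Sum>k | ?u k \<noteq> 0. ?u k) = f ?x"
    by (subst sum_nonzero_support[OF g(2)]) (auto simp: clinear_simps f)
  moreover have "(\<Sum>k | ?w k \<noteq> 0. ?w k) = f ?x"
    by (subst sum_nonzero_support[OF g(2)]) (use x in \<open>auto simp: cs.scale_sum_right\<close>)
  moreover have "cs.subspace (G k)" for k using G by (simp add: grading_on_def)
  then have "?u k \<in> G k" "?w k \<in> G k" for k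
    using pres g by (auto simp: cs.subspace_scale)
  ultimately have "?u = ?w" by (intro grading_unique[OF G _ fin(1) _ fin(2)]) simp_all
  then have "?u n = ?w n" by (rule fun_cong)
  then show "g n \<in> {v. f v = a *\<^sub>c v}" by simp
qed

lemma graded_subspace_Int:
  assumes G: "grading_on UNIV G" and "graded_subspace U G" "graded_subspace U' G"
  shows "graded_subspace (U \<inter> U') G"
proof (rule graded_subspaceI[OF G])
  show "cs.subspace (U \<inter> U')"
    using assms by (auto simp: graded_subspace_def grading_on_def cs.subspace_inter)
  have *: "g n \<in> U" if *: "graded_subspace U G" "\<And>k. g k \<in> G k" "finite {k. g k \<noteq> 0}"
      "(\<Sum>k | g k \<noteq> 0. g k) \<in> U" for g :: "int \<Rightarrow> 'a" and n U
  proof -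
    have U: "grading_on U (\<lambda>n. U \<inter> G n)" using *(1) by (simp add: graded_subspace_def)
    obtain h where h: "\<And>n. h n \<in> U \<inter> G n" "finite {n. h n \<noteq> 0}"
      "(\<Sum>n | h n \<noteq> 0. h n) = (\<Sum>k | g k \<noteq> 0. g k)"
      by (rule grading_components[OF U *(4)]) blast
    have "g = h" by (rule grading_unique[OF G]) (use h * in auto)
    then show ?thesis using h by simp
  qed
  fix g :: "int \<Rightarrow> 'a" and n
  assume "\<And>k. g k \<in> G k" "finite {k. g k \<noteq> 0}" "(\<Sum>k | g k \<noteq> 0. g k) \<in> U \<inter> U'"
  then show "g n \<in> U \<inter> U'" using *[OF assms(2)] *[OF assms(3)] by blast
qed

section \<open>The Heisenberg action\<close>

lemma fmul_word_Nil [simp]: "word [] \<star> p = p" for p :: "('x, complex) free_alg"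
  by (induction p rule: poly_mapping_additive_induct) (simp_all add: fmul_add_right)

lemma fmul_diff_left: "(p - p') \<star> q = p \<star> q - p' \<star> q"
  by (metis add_diff_cancel diff_add_cancel fmul_add_left)

lemma cscale_single: "a *\<^sub>c Poly_Mapping.single w d = Poly_Mapping.single w (a *\<^sub>c d)"
  by (rule poly_mapping_eqI) (simp add: lookup_cscale lookup_single when_def)

lemma fmul_cscale_left: "(a *\<^sub>c p) \<star> q = a *\<^sub>c (p \<star> q)" for p q :: "('x, complex) free_alg"
proof (induction p rule: poly_mapping_additive_induct)
  case (single u b)
  show ?case
    by (induction q rule: poly_mapping_additive_induct)
      (simp_all add: cscale_single cscale_complex_def fmul_add_right cs.scale_right_distrib mult.assoc)
qed (simp add: fmul_add_left cs.scale_right_distrib)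

lemma enveloping_relations_in_fock_relations:
  "r \<in> enveloping_relations \<Longrightarrow> r \<star> t \<in> fock_relations \<mu>"
  unfolding fock_relations_def
  by (rule cs.span_base, rule UnI1, rule CollectI, rule exI[of _ "word []"]) auto

lemma lookup_map_fmul:
  "Poly_Mapping.lookup (Poly_Mapping.map (\<lambda>t. word [x] \<star> t) F) m = word [x] \<star> Poly_Mapping.lookup F m"
  for F :: "int \<Rightarrow>\<^sub>0 (heis, complex) free_alg"
  by (simp add: map.rep_eq when_def)

lemmas fock_relations_0 = cs.subspace_0[OF subspace_fock_relations]

lemma clinear_fock_action: "clinear (fock_action x)"
proof (rule clinearI)
  show "fock_action x (u + v) = fock_action x u + fock_action x v" for u v
    by transfer (simp add: lookup_map_fmul lookup_add fmul_add_right fock_relations_0)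
  show "fock_action x (a *\<^sub>c v) = a *\<^sub>c fock_action x v" for a v
    by transfer (simp add: lookup_map_fmul lookup_cscale fmul_cscale_right fock_relations_0)
qed

lemmas fock_action_simps = clinear_simps[OF clinear_fock_action]

lemma fock_action_heis_add: "fock_action (heis_add x y) v = fock_action x v + fock_action y v"
proof transfer
  fix x y and F :: "int \<Rightarrow>\<^sub>0 (heis, complex) free_alg"
  have "word [heis_add x y] - word [x] - word [y] \<in> enveloping_relations"
    unfolding enveloping_relations_def by blast
  then have "(word [heis_add x y] - word [x] - word [y]) \<star> Poly_Mapping.lookup F m \<in> fock_relations (of_int m)" for m
    by (rule enveloping_relations_in_fock_relations)
  then show "\<forall>m. Poly_Mapping.lookup (Poly_Mapping.map ((\<star>) (word [heis_add x y])) F) m -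
      Poly_Mapping.lookup (Poly_Mapping.map ((\<star>) (word [x])) F + Poly_Mapping.map ((\<star>) (word [y])) F) m
      \<in> fock_relations (of_int m)"
    by (simp add: lookup_map_fmul lookup_add fmul_diff_left fmul_add_left algebra_simps)
qed

lemma fock_action_heis_scale: "fock_action (heis_scale a x) v = a *\<^sub>c fock_action x v"
proof transfer
  fix a x and F :: "int \<Rightarrow>\<^sub>0 (heis, complex) free_alg"
  have "word [heis_scale a x] - a *\<^sub>c word [x] \<in> enveloping_relations"
    unfolding enveloping_relations_def by blast
  then have "(word [heis_scale a x] - a *\<^sub>c word [x]) \<star> Poly_Mapping.lookup F m \<in> fock_relations (of_int m)" for m
    by (rule enveloping_relations_in_fock_relations)
  then show "\<forall>m. Poly_Mapping.lookup (Poly_Mapping.map ((\<star>) (word [heis_scale a x])) F) m -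
      Poly_Mapping.lookup (a *\<^sub>c Poly_Mapping.map ((\<star>) (word [x])) F) m \<in> fock_relations (of_int m)"
    by (simp add: lookup_map_fmul lookup_cscale fmul_diff_left fmul_cscale_left)
qed

lemma fock_action_bracket:
  assumes "x \<in> heis_degree d" "y \<in> heis_degree e"
  shows "fock_action x (fock_action y v) =
    ksign (d * e) *\<^sub>c fock_action y (fock_action x v) + fock_action (heis_bracket x y) v"
  using assms
proof transfer
  fix x y d e and F :: "int \<Rightarrow>\<^sub>0 (heis, complex) free_alg"
  assume "x \<in> heis_degree d" "y \<in> heis_degree e"
  then have "word [x, y] - ksign (d * e) *\<^sub>c word [y, x] - word [heis_bracket x y] \<in> enveloping_relations"
    unfolding enveloping_relations_def by blast
  then have "(word [x, y] - ksign (d * e) *\<^sub>c word [y, x] - word [heis_bracket x y]) \<star> Poly_Mapping.lookup F m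
      \<in> fock_relations (of_int m)" for m
    by (rule enveloping_relations_in_fock_relations)
  then show "\<forall>m. Poly_Mapping.lookup (Poly_Mapping.map ((\<star>) (word [x])) (Poly_Mapping.map ((\<star>) (word [y])) F)) m -
      Poly_Mapping.lookup (ksign (d * e) *\<^sub>c Poly_Mapping.map ((\<star>) (word [y])) (Poly_Mapping.map ((\<star>) (word [x])) F) +
        Poly_Mapping.map ((\<star>) (word [heis_bracket x y])) F) m \<in> fock_relations (of_int m)"
    by (simp add: lookup_map_fmul lookup_add lookup_cscale fmul_diff_left fmul_add_left fmul_cscale_left
        diff_diff_eq flip: fmul_assoc)
qed

lemma fock_action_ket:
  assumes "h \<in> heis_nonneg"
  shows "fock_action h (fock_ket m) = fock_character (of_int m) h *\<^sub>c fock_ket m"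
proof -
  have "word [] \<star> (word [h] - fock_character (of_int m) h *\<^sub>c word []) \<in> fock_relations (of_int m)"
    unfolding fock_relations_def by (rule cs.span_base) (use assms in blast)
  then show ?thesis
    unfolding fock_ket_def fock_class_def
    by (auto simp: fock_action.abs_eq cscale_lattice_fock.abs_eq lattice_fock.abs_eq_iff lookup_map_fmul
        lookup_cscale lookup_single when_def fock_relations_0)
qed

lemma clinear_fock_class: "clinear (fock_class m)"
  by (rule clinearI)
    (simp_all add: fock_class_def plus_lattice_fock.abs_eq cscale_lattice_fock.abs_eq single_add cscale_single)

lemma fock_class_word: "fock_class m (word u) = foldr fock_action u (fock_ket m)"
proof (induction u)
  case Nil
  then show ?case by (simp add: fock_ket_def)
next
  case (Cons x u)
  have "fock_class m (word (x # u)) = fock_action x (fock_class m (word u))"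
    unfolding fock_class_def fock_action.abs_eq
    by (rule arg_cong[where f = abs_lattice_fock], rule poly_mapping_eqI)
      (simp add: lookup_map_fmul lookup_single when_def)
  then show ?case using Cons by simp
qed

lemma fock_class_single: "fock_class m (Poly_Mapping.single u a) = a *\<^sub>c foldr fock_action u (fock_ket m)"
  using clinear_scale[OF clinear_fock_class, of m a "word u"]
  by (simp add: cscale_single cscale_complex_def fock_class_word)

lemma lattice_fock_word_induct [case_names add scale ket action]:
  assumes "\<And>v w. P v \<Longrightarrow> P w \<Longrightarrow> P (v + w)" "\<And>a v. P v \<Longrightarrow> P (a *\<^sub>c v)"
    and "\<And>m. P (fock_ket m)" "\<And>x v. P v \<Longrightarrow> P (fock_action x v)"
  shows "P v"
proof -
  have word: "P (foldr fock_action u (fock_ket m))" for u m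
    by (induction u) (simp_all add: assms)
  have cls: "P (fock_class m t)" for m t
    by (induction t rule: poly_mapping_additive_induct)
      (simp_all add: fock_class_single clinear_simps[OF clinear_fock_class] assms word)
  have "P (abs_lattice_fock F)" for F
    by (induction F rule: poly_mapping_additive_induct)
      (simp_all add: assms(1) cls plus_lattice_fock.abs_eq[symmetric] flip: fock_class_def)
  then show ?thesis by (induction v rule: lattice_fock.abs_induct)
qed

text \<open>The four families of modes, smeared with a series or a polynomial.\<close>

abbreviation c_act :: "complex fps \<Rightarrow> lattice_fock \<Rightarrow> lattice_fock" where
  "c_act f \<equiv> fock_action (Heis f 0 0 0 0)"
abbreviation \<nu>_act :: "complex poly \<Rightarrow> lattice_fock \<Rightarrow> lattice_fock" where
  "\<nu>_act p \<equiv> fock_action (Heis 0 p 0 0 0)"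
abbreviation \<phi>_act :: "complex fps \<Rightarrow> lattice_fock \<Rightarrow> lattice_fock" where
  "\<phi>_act f \<equiv> fock_action (Heis 0 0 f 0 0)"
abbreviation b_act :: "complex poly \<Rightarrow> lattice_fock \<Rightarrow> lattice_fock" where
  "b_act p \<equiv> fock_action (Heis 0 0 0 p 0)"

lemma fock_action_zero [simp]: "fock_action (Heis 0 0 0 0 0) v = 0"
  using fock_action_heis_scale[of 0 "Heis 0 0 0 0 0" v] by (simp add: heis_scale_def)

lemma fock_action_split5:
  "fock_action (Heis f p g q k) v = c_act f v + \<nu>_act p v + \<phi>_act g v + b_act q v + fock_action (Heis 0 0 0 0 k) v"
proof -
  have "Heis f p g q k = heis_add (heis_add (heis_add (heis_add (Heis f 0 0 0 0) (Heis 0 p 0 0 0))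
      (Heis 0 0 g 0 0)) (Heis 0 0 0 q 0)) (Heis 0 0 0 0 k)"
    by (simp add: heis_add_def)
  then show ?thesis by (simp only: fock_action_heis_add)
qed

lemma pairing_0 [simp]: "pairing 0 p = 0" "pairing f 0 = 0"
  by (simp_all add: pairing_def)

text \<open>\<open>K\<close> is central because its brackets with homogeneous elements vanish, so its action is determined by the
  vectors \<open>|m\<rangle>\<close>.\<close>

lemma fock_action_central [simp]: "fock_action (Heis 0 0 0 0 k) v = k *\<^sub>c v"
proof (induction v rule: lattice_fock_word_induct)
  case (ket m)
  show ?case by (subst fock_action_ket) (simp_all add: heis_nonneg_def fock_character_def)
next
  case (action x v)
  have *: "fock_action (Heis 0 0 0 0 k) (fock_action y v) = fock_action y (fock_action (Heis 0 0 0 0 k) v)"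
    if "y \<in> heis_degree d" for y d
    by (subst fock_action_bracket[of _ 0 _ d])
      (use that in \<open>auto simp: heis_bracket_def ksign_def, auto simp: heis_degree_def\<close>)
  obtain f p g q k' where x: "x = Heis f p g q k'" by (cases x)
  have "fock_action (Heis 0 0 0 0 k) (fock_action x v) = fock_action x (k *\<^sub>c v)"
    unfolding x fock_action_split5[of f p g q k']
    by (simp add: clinear_add[OF clinear_fock_action] *[of "Heis f 0 0 0 0" 0] *[of "Heis 0 p 0 0 0" 1] *[of "Heis 0 0 g 0 0" "-1"]
        *[of "Heis 0 0 0 q 0" 0] *[of "Heis 0 0 0 0 k'" 0] heis_degree_def action)
  then show ?case by (simp add: clinear_scale[OF clinear_fock_action])
qed (simp_all add: fock_action_simps cs.scale_right_distrib mult.commute)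

lemma fock_action_split:
  "fock_action (Heis f p g q k) v = c_act f v + \<nu>_act p v + \<phi>_act g v + b_act q v + k *\<^sub>c v"
  by (subst fock_action_split5) simp

lemma smeared_commutators:
  "c_act f (c_act g v) = c_act g (c_act f v)"
  "b_act p (b_act q v) = b_act q (b_act p v)"
  "c_act f (b_act q v) = b_act q (c_act f v) - pairing f q *\<^sub>c v"
  "\<nu>_act p (\<nu>_act q v) = - \<nu>_act q (\<nu>_act p v)"
  "\<phi>_act f (\<phi>_act g v) = - \<phi>_act g (\<phi>_act f v)"
  "\<phi>_act f (\<nu>_act q v) = - \<nu>_act q (\<phi>_act f v) + pairing f q *\<^sub>c v"
  "c_act f (\<nu>_act q v) = \<nu>_act q (c_act f v)"
  "c_act f (\<phi>_act g v) = \<phi>_act g (c_act f v)"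
  "b_act p (\<nu>_act q v) = \<nu>_act q (b_act p v)"
  "\<phi>_act f (b_act q v) = b_act q (\<phi>_act f v)"
  using fock_action_bracket[of "Heis f 0 0 0 0" 0 "Heis g 0 0 0 0" 0 v]
    fock_action_bracket[of "Heis 0 0 0 p 0" 0 "Heis 0 0 0 q 0" 0 v]
    fock_action_bracket[of "Heis f 0 0 0 0" 0 "Heis 0 0 0 q 0" 0 v]
    fock_action_bracket[of "Heis 0 p 0 0 0" 1 "Heis 0 q 0 0 0" 1 v]
    fock_action_bracket[of "Heis 0 0 f 0 0" "-1" "Heis 0 0 g 0 0" "-1" v]
    fock_action_bracket[of "Heis 0 0 f 0 0" "-1" "Heis 0 q 0 0 0" 1 v]
    fock_action_bracket[of "Heis f 0 0 0 0" 0 "Heis 0 q 0 0 0" 1 v]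
    fock_action_bracket[of "Heis f 0 0 0 0" 0 "Heis 0 0 g 0 0" "-1" v]
    fock_action_bracket[of "Heis 0 0 0 p 0" 0 "Heis 0 q 0 0 0" 1 v]
    fock_action_bracket[of "Heis 0 0 f 0 0" "-1" "Heis 0 0 0 q 0" 0 v]
  by (simp_all add: heis_degree_def heis_bracket_def ksign_def)

lemma smeared_ket:
  "c_act f (fock_ket m) = (of_int m * fps_nth f 0) *\<^sub>c fock_ket m"
  "\<phi>_act g (fock_ket m) = 0"
  by (subst fock_action_ket; simp add: heis_nonneg_def fock_character_def)+

lemma smeared_linear:
  "c_act (f + f') v = c_act f v + c_act f' v" "\<nu>_act (p + p') v = \<nu>_act p v + \<nu>_act p' v"
  "\<phi>_act (f + f') v = \<phi>_act f v + \<phi>_act f' v" "b_act (p + p') v = b_act p v + b_act p' v"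
  "c_act (fps_const a * f) v = a *\<^sub>c c_act f v" "\<nu>_act (smult a p) v = a *\<^sub>c \<nu>_act p v"
  "\<phi>_act (fps_const a * f) v = a *\<^sub>c \<phi>_act f v" "b_act (smult a p) v = a *\<^sub>c b_act p v"
  using fock_action_heis_add[of "Heis f 0 0 0 0" "Heis f' 0 0 0 0" v]
    fock_action_heis_add[of "Heis 0 p 0 0 0" "Heis 0 p' 0 0 0" v]
    fock_action_heis_add[of "Heis 0 0 f 0 0" "Heis 0 0 f' 0 0" v]
    fock_action_heis_add[of "Heis 0 0 0 p 0" "Heis 0 0 0 p' 0" v]
    fock_action_heis_scale[of a "Heis f 0 0 0 0" v]
    fock_action_heis_scale[of a "Heis 0 p 0 0 0" v]
    fock_action_heis_scale[of a "Heis 0 0 f 0 0" v]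
    fock_action_heis_scale[of a "Heis 0 0 0 p 0" v]
  by (simp_all add: heis_add_def heis_scale_def)

definition bb :: "nat \<Rightarrow> lattice_fock \<Rightarrow> lattice_fock" where "bb n = b_act (monom 1 n)"
definition nn :: "nat \<Rightarrow> lattice_fock \<Rightarrow> lattice_fock" where "nn n = \<nu>_act (monom 1 n)"

lemma clinear_bb: "clinear (bb n)" and clinear_nn: "clinear (nn n)"
  by (simp_all add: bb_def nn_def clinear_fock_action)

lemmas creation_simps = clinear_simps[OF clinear_bb] clinear_simps[OF clinear_nn]

lemma \<nu>_act_sum: "\<nu>_act p v = (\<Sum>i\<le>degree p. coeff p i *\<^sub>c nn i v)"
proof -
  have s: "\<nu>_act (\<Sum>i\<in>I. g i) v = (\<Sum>i\<in>I. \<nu>_act (g i) v)" for I :: "nat set" and g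
    by (induction I rule: infinite_finite_induct) (simp_all add: smeared_linear)
  have "\<nu>_act (\<Sum>i\<le>degree p. monom (coeff p i) i) v = (\<Sum>i\<le>degree p. \<nu>_act (smult (coeff p i) (monom 1 i)) v)"
    by (simp only: s smult_monom mult_1_right)
  then show ?thesis by (simp only: smeared_linear poly_as_sum_of_monoms nn_def bb_def)
qed

lemma b_act_sum: "b_act p v = (\<Sum>i\<le>degree p. coeff p i *\<^sub>c bb i v)"
proof -
  have s: "b_act (\<Sum>i\<in>I. g i) v = (\<Sum>i\<in>I. b_act (g i) v)" for I :: "nat set" and g
    by (induction I rule: infinite_finite_induct) (simp_all add: smeared_linear)
  have "b_act (\<Sum>i\<le>degree p. monom (coeff p i) i) v = (\<Sum>i\<le>degree p. b_act (smult (coeff p i) (monom 1 i)) v)"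
    by (simp only: s smult_monom mult_1_right)
  then show ?thesis by (simp only: smeared_linear poly_as_sum_of_monoms nn_def bb_def)
qed

lemma pairing_monom [simp]: "pairing f (monom 1 n) = of_nat (n + 1) * fps_nth f (n + 1)"
proof -
  have "pairing f (monom 1 n) = (\<Sum>m\<le>n. if m = n then of_nat (n + 1) * fps_nth f (n + 1) else 0)"
    unfolding pairing_def degree_monom_eq[OF one_neq_zero] by (rule sum.cong) (auto simp: coeff_monom)
  then show ?thesis by simp
qed

lemma creation_commutators:
  "c_act f (bb n v) = bb n (c_act f v) - (of_nat (n + 1) * fps_nth f (n + 1)) *\<^sub>c v"
  "\<phi>_act f (nn n v) = - nn n (\<phi>_act f v) + (of_nat (n + 1) * fps_nth f (n + 1)) *\<^sub>c v"
  "c_act f (nn n v) = nn n (c_act f v)" "\<phi>_act f (bb n v) = bb n (\<phi>_act f v)"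
  by (simp_all only: bb_def nn_def smeared_commutators pairing_monom)

lemma bb_bb: "bb n (bb k v) = bb k (bb n v)" and nn_nn: "nn n (nn k v) = - nn k (nn n v)"
  and bb_nn: "bb n (nn k v) = nn k (bb n v)"
  unfolding bb_def nn_def by (rule smeared_commutators)+

text \<open>The creation operators alone generate the module from the vectors \<open>|m\<rangle>\<close>: the annihilation
  operators can be moved to the right, where they act by scalars.\<close>

inductive created :: "lattice_fock \<Rightarrow> bool" where
  add: "created v \<Longrightarrow> created w \<Longrightarrow> created (v + w)"
| scale: "created v \<Longrightarrow> created (a *\<^sub>c v)"
| ket: "created (fock_ket m)"
| bb: "created v \<Longrightarrow> created (bb n v)"
| nn: "created v \<Longrightarrow> created (nn n v)"

lemma created_0: "created 0"
  using created.scale[OF created.ket, of 0] by simp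

lemma created_diff: "created v \<Longrightarrow> created w \<Longrightarrow> created (v - w)"
  using created.add[of v "- w"] created.scale[of w "-1"] by simp

lemma created_sum: "(\<And>i. i \<in> I \<Longrightarrow> created (g i)) \<Longrightarrow> created (\<Sum>i\<in>I. g i)"
  by (induction I rule: infinite_finite_induct) (auto intro: created_0 created.add)

lemma created_annihilation: "created v \<Longrightarrow> (\<forall>f. created (c_act f v)) \<and> (\<forall>f. created (\<phi>_act f v))"
proof (induction rule: created.induct)
  case (nn v n)
  have "created (\<phi>_act f (nn n v))" for f
  proof -
    have "created ((of_nat (n + 1) * fps_nth f (n + 1)) *\<^sub>c v - nn n (\<phi>_act f v))"
      by (intro created_diff created.scale created.nn) (use nn in auto)
    then show ?thesis by (simp only: creation_commutators uminus_add_conv_diff)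
  qed
  then show ?case using nn by (simp add: creation_commutators created.nn)
qed (auto simp: fock_action_simps smeared_ket creation_commutators
    intro: created.intros created_diff created_0)

lemma created_all: "created v"
proof (induction v rule: lattice_fock_word_induct)
  case (action x v)
  obtain f p g q k where x: "x = Heis f p g q k" by (cases x)
  show ?case
    unfolding x fock_action_split[of f p g q k] \<nu>_act_sum[of p] b_act_sum[of q]
    using created_annihilation[OF action]
    by (intro created.add created_sum created.scale created.nn created.bb action) auto
qed (auto intro: created.intros)

lemma creation_induct [case_names add scale ket bb nn]:
  assumes "\<And>v w. P v \<Longrightarrow> P w \<Longrightarrow> P (v + w)" "\<And>a v. P v \<Longrightarrow> P (a *\<^sub>c v)"
    and "\<And>m. P (fock_ket m)" "\<And>n v. P v \<Longrightarrow> P (bb n v)" "\<And>n v. P v \<Longrightarrow> P (nn n v)"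
  shows "P v"
  using created_all[of v] by (induction rule: created.induct) (auto intro: assms)

section \<open>A concrete model of the direct sum of Fock modules\<close>

definition linear_extension :: "('k \<Rightarrow> 'x::complex_space) \<Rightarrow> ('k \<Rightarrow>\<^sub>0 complex) \<Rightarrow> 'x" where
  "linear_extension h p = (\<Sum>k\<in>Poly_Mapping.keys p. Poly_Mapping.lookup p k *\<^sub>c h k)"

lemma linear_extension_superset:
  "finite A \<Longrightarrow> Poly_Mapping.keys p \<subseteq> A \<Longrightarrow> linear_extension h p = (\<Sum>k\<in>A. Poly_Mapping.lookup p k *\<^sub>c h k)"
  unfolding linear_extension_def by (rule sum.mono_neutral_left) (auto simp: in_keys_iff)

lemma clinear_linear_extension: "clinear (linear_extension h)"
proof (rule clinearI)
  fix p q :: "'a \<Rightarrow>\<^sub>0 complex"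
  let ?A = "Poly_Mapping.keys p \<union> Poly_Mapping.keys q"
  have "Poly_Mapping.keys (p + q) \<subseteq> ?A" by (rule Poly_Mapping.keys_add)
  then show "linear_extension h (p + q) = linear_extension h p + linear_extension h q"
    by (simp add: linear_extension_superset[of ?A] lookup_add cs.scale_left_distrib sum.distrib)
next
  fix a and p :: "'a \<Rightarrow>\<^sub>0 complex"
  have "Poly_Mapping.keys (a *\<^sub>c p) \<subseteq> Poly_Mapping.keys p"
    by (auto simp: in_keys_iff lookup_cscale cscale_complex_def)
  then have "linear_extension h (a *\<^sub>c p) = (\<Sum>k\<in>Poly_Mapping.keys p. Poly_Mapping.lookup (a *\<^sub>c p) k *\<^sub>c h k)"
    by (intro linear_extension_superset) simp_all
  then show "linear_extension h (a *\<^sub>c p) = a *\<^sub>c linear_extension h p"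
    by (simp add: linear_extension_def lookup_cscale cscale_complex_def cs.scale_sum_right)
qed

abbreviation basis_vec :: "'k \<Rightarrow> 'k \<Rightarrow>\<^sub>0 complex" where
  "basis_vec k \<equiv> Poly_Mapping.single k 1"

lemma linear_extension_basis [simp]: "linear_extension h (basis_vec k) = h k"
  by (simp add: linear_extension_def)

lemma basis_induct [case_names add scale basis]:
  assumes "\<And>p q. P p \<Longrightarrow> P q \<Longrightarrow> P (p + q)" "\<And>a p. P p \<Longrightarrow> P (a *\<^sub>c p)" "\<And>k. P (basis_vec k)"
  shows "P (p :: 'k \<Rightarrow>\<^sub>0 complex)"
proof (induction p rule: poly_mapping_additive_induct)
  case (single k a)
  then show ?case using assms(2)[OF assms(3), of a k] by (simp add: cscale_single cscale_complex_def)
qed (rule assms(1))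

lemma clinear_eqI:
  assumes "clinear f" "clinear g" "\<And>k. f (basis_vec k) = g (basis_vec k)"
  shows "f p = g p"
  by (induction p rule: basis_induct) (simp_all add: assms clinear_simps[OF assms(1)] clinear_simps[OF assms(2)])

text \<open>A basis vector \<open>(m, E, S)\<close> stands for \<open>\<nu>\<^sub>S b\<^sup>E |m\<rangle>\<close>, the factors \<open>\<nu>\<close> in increasing order.\<close>

type_synonym fock_key = "int \<times> nat multiset \<times> nat fset"
type_synonym fock_model = "fock_key \<Rightarrow>\<^sub>0 complex"

text \<open>The sign of moving \<open>\<nu>\<^sub>n\<close> to its place in the increasing product \<open>\<nu>\<^sub>S\<close>.\<close>

definition order_sign :: "nat \<Rightarrow> nat fset \<Rightarrow> complex" where
  "order_sign n S = (-1) ^ card {i \<in> fset S. i < n}"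

lemma order_sign_finsert:
  assumes "n |\<notin>| S"
  shows "order_sign k (finsert n S) = (if n < k then - order_sign k S else order_sign k S)"
proof -
  have "{i \<in> fset (finsert n S). i < k} =
      (if n < k then insert n {i \<in> fset S. i < k} else {i \<in> fset S. i < k})"
    by auto
  then show ?thesis using assms by (simp add: order_sign_def)
qed

lemma order_sign_fminus:
  assumes "n |\<in>| S"
  shows "order_sign k (S |-| {|n|}) = (if n < k then - order_sign k S else order_sign k S)"
proof -
  have "finsert n (S |-| {|n|}) = S" using assms by auto
  then show ?thesis using order_sign_finsert[of n "S |-| {|n|}" k] by (auto split: if_splits)
qed

lemma order_sign_square [simp]: "order_sign n S * order_sign n S = 1"
  by (simp add: order_sign_def flip: power_add)

definition charge_op :: "fock_model \<Rightarrow> fock_model" where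
  "charge_op = linear_extension (\<lambda>(m, E, S). of_int m *\<^sub>c basis_vec (m, E, S))"

definition b_op :: "nat \<Rightarrow> fock_model \<Rightarrow> fock_model" where
  "b_op n = linear_extension (\<lambda>(m, E, S). basis_vec (m, add_mset n E, S))"

definition \<nu>_op :: "nat \<Rightarrow> fock_model \<Rightarrow> fock_model" where
  "\<nu>_op n = linear_extension (\<lambda>(m, E, S). if n |\<in>| S then 0 else order_sign n S *\<^sub>c basis_vec (m, E, finsert n S))"

definition db_op :: "nat \<Rightarrow> fock_model \<Rightarrow> fock_model" where
  "db_op n = linear_extension (\<lambda>(m, E, S). of_nat (count E n) *\<^sub>c basis_vec (m, E - {#n#}, S))"

definition d\<nu>_op :: "nat \<Rightarrow> fock_model \<Rightarrow> fock_model" where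
  "d\<nu>_op n = linear_extension (\<lambda>(m, E, S). if n |\<in>| S then order_sign n S *\<^sub>c basis_vec (m, E, S |-| {|n|}) else 0)"

lemma clinear_ops: "clinear charge_op" "clinear (b_op n)" "clinear (\<nu>_op n)" "clinear (db_op n)" "clinear (d\<nu>_op n)"
  by (simp_all add: charge_op_def b_op_def \<nu>_op_def db_op_def d\<nu>_op_def clinear_linear_extension)

lemma ops_basis [simp]:
  "charge_op (basis_vec (m, E, S)) = of_int m *\<^sub>c basis_vec (m, E, S)"
  "b_op n (basis_vec (m, E, S)) = basis_vec (m, add_mset n E, S)"
  "\<nu>_op n (basis_vec (m, E, S)) = (if n |\<in>| S then 0 else order_sign n S *\<^sub>c basis_vec (m, E, finsert n S))"
  "db_op n (basis_vec (m, E, S)) = of_nat (count E n) *\<^sub>c basis_vec (m, E - {#n#}, S)"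
  "d\<nu>_op n (basis_vec (m, E, S)) = (if n |\<in>| S then order_sign n S *\<^sub>c basis_vec (m, E, S |-| {|n|}) else 0)"
  by (simp_all add: charge_op_def b_op_def \<nu>_op_def db_op_def d\<nu>_op_def)

lemmas ops_linear = clinear_simps[OF clinear_ops(1)] clinear_simps[OF clinear_ops(2)]
  clinear_simps[OF clinear_ops(3)] clinear_simps[OF clinear_ops(4)] clinear_simps[OF clinear_ops(5)]

lemma commute_on_basis:
  assumes "clinear f" "clinear g"
    and "\<And>m E S. f (g (basis_vec (m, E, S))) = a *\<^sub>c g (f (basis_vec (m, E, S)))"
  shows "f (g v) = a *\<^sub>c g (f (v :: fock_model))"
proof (induction v rule: basis_induct)
  case (basis k)
  then show ?case using assms(3) by (cases k) simp
qed (simp_all add: clinear_simps[OF assms(1)] clinear_simps[OF assms(2)] cs.scale_right_distrib mult.commute)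

lemmas commute_on_basis_1 = commute_on_basis[where a = 1, simplified]
lemmas anticommute_on_basis = commute_on_basis[where a = "-1", simplified]

lemma even_ops_commute:
  "b_op n (b_op k v) = b_op k (b_op n v)"
  "db_op n (db_op k v) = db_op k (db_op n v)"
  "charge_op (b_op k v) = b_op k (charge_op v)"
  "charge_op (db_op k v) = db_op k (charge_op v)"
  "charge_op (\<nu>_op k v) = \<nu>_op k (charge_op v)"
  "charge_op (d\<nu>_op k v) = d\<nu>_op k (charge_op v)"
  "b_op n (\<nu>_op k v) = \<nu>_op k (b_op n v)"
  "b_op n (d\<nu>_op k v) = d\<nu>_op k (b_op n v)"
  "db_op n (\<nu>_op k v) = \<nu>_op k (db_op n v)"
  "db_op n (d\<nu>_op k v) = d\<nu>_op k (db_op n v)"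
  by (rule commute_on_basis_1; auto simp: clinear_ops ops_linear add_mset_commute diff_right_commute mult.commute)+

lemma db_op_b_op: "db_op n (b_op k v) = b_op k (db_op n v) + (if n = k then v else 0)"
proof (rule clinear_eqI[where f = "\<lambda>v. db_op n (b_op k v)" and g = "\<lambda>v. b_op k (db_op n v) + (if n = k then v else 0)"])
  show "clinear (\<lambda>v. b_op k (db_op n v) + (if n = k then v else 0))"
    by (auto simp: clinear_def ops_linear cs.scale_right_distrib)
  fix key :: fock_key
  obtain m E S where key: "key = (m, E, S)" by (cases key)
  have "add_mset n (E - {#n#}) = E" if "count E n > 0"
    using that by simp
  then show "db_op n (b_op k (basis_vec key)) = b_op k (db_op n (basis_vec key)) +
      (if n = k then basis_vec key else 0)"
    unfolding key
    by (cases "count E n = 0") (auto simp: ops_linear cs.scale_left_distrib add_mset_diff_bothsides)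
qed (rule clinear_comp; rule clinear_ops)

lemma \<nu>_op_anticommute: "\<nu>_op n (\<nu>_op k v) = - \<nu>_op k (\<nu>_op n v)"
proof (rule anticommute_on_basis[OF clinear_ops(3) clinear_ops(3)])
  fix m :: int and E :: "nat multiset" and S :: "nat fset"
  have "finsert n (finsert k S) = finsert k (finsert n S)" by auto
  then show "\<nu>_op n (\<nu>_op k (basis_vec (m, E, S))) = - \<nu>_op k (\<nu>_op n (basis_vec (m, E, S)))"
    by (auto simp: ops_linear order_sign_finsert mult.commute)
qed

lemma d\<nu>_op_anticommute: "d\<nu>_op n (d\<nu>_op k v) = - d\<nu>_op k (d\<nu>_op n v)"
proof (rule anticommute_on_basis[OF clinear_ops(5) clinear_ops(5)])
  fix m :: int and E :: "nat multiset" and S :: "nat fset"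
  have "S |-| {|n|} |-| {|k|} = S |-| {|k|} |-| {|n|}" by auto
  then show "d\<nu>_op n (d\<nu>_op k (basis_vec (m, E, S))) = - d\<nu>_op k (d\<nu>_op n (basis_vec (m, E, S)))"
    by (auto simp: ops_linear order_sign_fminus mult.commute)
qed

lemma d\<nu>_op_\<nu>_op: "d\<nu>_op n (\<nu>_op k v) = - \<nu>_op k (d\<nu>_op n v) + (if n = k then v else 0)"
proof (rule clinear_eqI[where f = "\<lambda>v. d\<nu>_op n (\<nu>_op k v)" and g = "\<lambda>v. - \<nu>_op k (d\<nu>_op n v) + (if n = k then v else 0)"])
  show "clinear (\<lambda>v. - \<nu>_op k (d\<nu>_op n v) + (if n = k then v else 0))"
    by (auto simp: clinear_def ops_linear cs.scale_right_distrib cs.scale_right_diff_distrib)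
  fix key :: fock_key
  obtain m E S where key: "key = (m, E, S)" by (cases key)
  have "finsert k S |-| {|n|} = finsert k (S |-| {|n|})" if "n \<noteq> k" using that by auto
  moreover have "finsert n S |-| {|n|} = S" if "n |\<notin>| S" using that by auto
  moreover have "finsert n (S |-| {|n|}) = S" if "n |\<in>| S" using that by auto
  ultimately show "d\<nu>_op n (\<nu>_op k (basis_vec key)) = - \<nu>_op k (d\<nu>_op n (basis_vec key)) +
      (if n = k then basis_vec key else 0)"
    unfolding key
    by (cases "n = k") (auto simp: ops_linear order_sign_finsert order_sign_fminus mult.commute)
qed (rule clinear_comp; rule clinear_ops)

text \<open>Since \<open>[c\<^sub>n, b\<^bsub>n-1\<^esub>] = -n\<close> and \<open>[\<phi>\<^sub>n, \<nu>\<^bsub>n-1\<^esub>] = n\<close>, the annihilation modes are multiples of partial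
  derivatives, except that \<open>c\<^sub>0\<close> measures \<open>m\<close> and \<open>\<phi>\<^sub>0\<close> vanishes.\<close>

definition c_mode :: "nat \<Rightarrow> fock_model \<Rightarrow> fock_model" where
  "c_mode n v = (case n of 0 \<Rightarrow> charge_op v | Suc k \<Rightarrow> (- of_nat n) *\<^sub>c db_op k v)"

definition \<phi>_mode :: "nat \<Rightarrow> fock_model \<Rightarrow> fock_model" where
  "\<phi>_mode n v = (case n of 0 \<Rightarrow> 0 | Suc k \<Rightarrow> of_nat n *\<^sub>c d\<nu>_op k v)"

lemma clinear_modes: "clinear (c_mode n)" "clinear (\<phi>_mode n)"
  by (auto simp: clinear_def c_mode_def \<phi>_mode_def ops_linear cs.scale_right_distrib mult.commute split: nat.split)

lemma mode_commutators:
  "c_mode n (c_mode k v) = 1 *\<^sub>c c_mode k (c_mode n v) + 0 *\<^sub>c v"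
  "b_op n (b_op k v) = 1 *\<^sub>c b_op k (b_op n v) + 0 *\<^sub>c v"
  "c_mode n (b_op k v) = 1 *\<^sub>c b_op k (c_mode n v) + (if n = Suc k then - of_nat n else 0) *\<^sub>c v"
  "\<nu>_op n (\<nu>_op k v) = (-1) *\<^sub>c \<nu>_op k (\<nu>_op n v) + 0 *\<^sub>c v"
  "\<phi>_mode n (\<phi>_mode k v) = (-1) *\<^sub>c \<phi>_mode k (\<phi>_mode n v) + 0 *\<^sub>c v"
  "\<phi>_mode n (\<nu>_op k v) = (-1) *\<^sub>c \<nu>_op k (\<phi>_mode n v) + (if n = Suc k then of_nat n else 0) *\<^sub>c v"
  "c_mode n (\<nu>_op k v) = 1 *\<^sub>c \<nu>_op k (c_mode n v) + 0 *\<^sub>c v"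
  "c_mode n (\<phi>_mode k v) = 1 *\<^sub>c \<phi>_mode k (c_mode n v) + 0 *\<^sub>c v"
  "b_op n (\<nu>_op k v) = 1 *\<^sub>c \<nu>_op k (b_op n v) + 0 *\<^sub>c v"
  "b_op n (\<phi>_mode k v) = 1 *\<^sub>c \<phi>_mode k (b_op n v) + 0 *\<^sub>c v"
  using \<nu>_op_anticommute[of n k v] d\<nu>_op_anticommute[of "n - 1" "k - 1" v] even_ops_commute(2)[of "n - 1" "k - 1" v]
  by (auto simp: c_mode_def \<phi>_mode_def ops_linear even_ops_commute db_op_b_op d\<nu>_op_\<nu>_op mult.commute
      cs.scale_right_distrib cs.scale_right_diff_distrib split: nat.split)

lemma modes_locally_finite: "\<exists>N. \<forall>n\<ge>N. c_mode n v = 0 \<and> \<phi>_mode n v = 0"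
proof (induction v rule: basis_induct)
  case (add p q)
  then obtain M N where "\<forall>n\<ge>M. c_mode n p = 0 \<and> \<phi>_mode n p = 0" "\<forall>n\<ge>N. c_mode n q = 0 \<and> \<phi>_mode n q = 0"
    by blast
  then have "\<forall>n\<ge>max M N. c_mode n (p + q) = 0 \<and> \<phi>_mode n (p + q) = 0"
    by (simp add: clinear_simps[OF clinear_modes(1)] clinear_simps[OF clinear_modes(2)])
  then show ?case by blast
next
  case (scale a p)
  then show ?case by (auto simp: clinear_simps[OF clinear_modes(1)] clinear_simps[OF clinear_modes(2)])
next
  case (basis key)
  obtain m E S where key: "key = (m, E, S)" by (cases key)
  have "finite (set_mset E \<union> fset S)" by simp
  then obtain N where N: "\<forall>n\<in>set_mset E \<union> fset S. n < N" using finite_nat_set_iff_bounded by blast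
  have "c_mode n (basis_vec key) = 0 \<and> \<phi>_mode n (basis_vec key) = 0" if "n > N" for n
  proof (cases n)
    case (Suc k)
    have "N \<le> k" using that Suc by simp
    then have "k \<notin># E" "k |\<notin>| S" using N by (meson UnI1 UnI2 not_less)+
    then have "count E k = 0" by (simp add: not_in_iff)
    with \<open>k |\<notin>| S\<close> show ?thesis using Suc by (simp add: key c_mode_def \<phi>_mode_def)
  qed (use that in simp)
  then show ?case by (intro exI[of _ "Suc N"]) auto
qed

text \<open>The elements \<open>\<Sum> f\<^sub>n c\<^sub>n\<close> and \<open>\<Sum> g\<^sub>n \<phi>\<^sub>n\<close> may be infinite sums; on a vector they are cut off where its modes
  vanish.\<close>

definition mode_bound :: "fock_model \<Rightarrow> nat" where
  "mode_bound v = (LEAST N. \<forall>n\<ge>N. c_mode n v = 0 \<and> \<phi>_mode n v = 0)"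

lemma mode_bound: "n \<ge> mode_bound v \<Longrightarrow> c_mode n v = 0" "n \<ge> mode_bound v \<Longrightarrow> \<phi>_mode n v = 0"
proof -
  have "\<forall>n\<ge>mode_bound v. c_mode n v = 0 \<and> \<phi>_mode n v = 0"
    unfolding mode_bound_def by (rule LeastI_ex[OF modes_locally_finite])
  then show "n \<ge> mode_bound v \<Longrightarrow> c_mode n v = 0" "n \<ge> mode_bound v \<Longrightarrow> \<phi>_mode n v = 0" by blast+
qed

definition smear :: "nat set \<Rightarrow> (nat \<Rightarrow> complex) \<Rightarrow> (nat \<Rightarrow> fock_model \<Rightarrow> fock_model) \<Rightarrow> fock_model \<Rightarrow> fock_model" where
  "smear I a X v = (\<Sum>n\<in>I. a n *\<^sub>c X n v)"

lemma clinear_smear: "(\<And>n. clinear (X n)) \<Longrightarrow> clinear (smear I a X)"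
  unfolding smear_def by (intro clinear_sum_fun clinear_scale_fun)

lemma smear_smear:
  assumes "\<And>n. clinear (X n)" "\<And>n. clinear (Y n)"
    and "\<And>n k. X n (Y k v) = s *\<^sub>c Y k (X n v) + t n k *\<^sub>c v"
  shows "smear I a X (smear J b Y v) =
    s *\<^sub>c smear J b Y (smear I a X v) + (\<Sum>n\<in>I. \<Sum>k\<in>J. a n * b k * t n k) *\<^sub>c v"
proof -
  have "smear I a X (smear J b Y v) = (\<Sum>n\<in>I. \<Sum>k\<in>J. (a n * b k) *\<^sub>c X n (Y k v))"
    by (simp add: smear_def clinear_simps[OF assms(1)] cs.scale_sum_right)
  also have "\<dots> = (\<Sum>n\<in>I. \<Sum>k\<in>J. (s * (b k * a n)) *\<^sub>c Y k (X n v)) + (\<Sum>n\<in>I. \<Sum>k\<in>J. (a n * b k * t n k) *\<^sub>c v)"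
    by (simp add: assms(3) cs.scale_right_distrib sum.distrib ac_simps)
  also have "(\<Sum>n\<in>I. \<Sum>k\<in>J. (s * (b k * a n)) *\<^sub>c Y k (X n v)) = s *\<^sub>c smear J b Y (smear I a X v)"
    by (subst sum.swap) (simp add: smear_def clinear_simps[OF assms(2)] cs.scale_sum_right)
  finally show ?thesis by (simp add: cs.scale_sum_left)
qed

definition c_smear :: "complex fps \<Rightarrow> fock_model \<Rightarrow> fock_model" where
  "c_smear f v = smear {..<mode_bound v} (fps_nth f) c_mode v"
definition \<phi>_smear :: "complex fps \<Rightarrow> fock_model \<Rightarrow> fock_model" where
  "\<phi>_smear f v = smear {..<mode_bound v} (fps_nth f) \<phi>_mode v"
definition \<nu>_smear :: "complex poly \<Rightarrow> fock_model \<Rightarrow> fock_model" where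
  "\<nu>_smear p = smear {..degree p} (coeff p) \<nu>_op"
definition b_smear :: "complex poly \<Rightarrow> fock_model \<Rightarrow> fock_model" where
  "b_smear p = smear {..degree p} (coeff p) b_op"

lemma c_smear_eq: "(\<And>n. n \<ge> N \<Longrightarrow> c_mode n v = 0) \<Longrightarrow> c_smear f v = smear {..<N} (fps_nth f) c_mode v"
  unfolding c_smear_def smear_def
  by (rule sum.mono_neutral_cong) (auto simp: mode_bound not_less)

lemma \<phi>_smear_eq: "(\<And>n. n \<ge> N \<Longrightarrow> \<phi>_mode n v = 0) \<Longrightarrow> \<phi>_smear f v = smear {..<N} (fps_nth f) \<phi>_mode v"
  unfolding \<phi>_smear_def smear_def
  by (rule sum.mono_neutral_cong) (auto simp: mode_bound not_less)

lemma common_bound: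
  assumes "finite V"
  shows "\<exists>N\<ge>M. \<forall>v\<in>V. \<forall>n\<ge>N. c_mode n v = 0 \<and> \<phi>_mode n v = 0"
proof -
  have "\<exists>N. \<forall>v\<in>V. mode_bound v \<le> N"
    using assms finite_nat_set_iff_bounded_le[of "mode_bound ` V"] by auto
  then obtain N where "\<forall>v\<in>V. mode_bound v \<le> N" by blast
  then show ?thesis by (intro exI[of _ "max M N"]) (auto simp: mode_bound)
qed

lemma clinear_smears: "clinear (c_smear f)" "clinear (\<phi>_smear f)" "clinear (\<nu>_smear p)" "clinear (b_smear p)"
proof -
  have *: "clinear (\<lambda>v. smear {..<mode_bound v} a X v)"
    if X: "\<And>n. clinear (X n)" "\<And>v n. n \<ge> mode_bound v \<Longrightarrow> X n v = 0" for X a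
  proof -
    have eq: "smear {..<mode_bound v} a X v = smear {..<N} a X v" if "\<And>n. n \<ge> N \<Longrightarrow> X n v = 0" for N v
      unfolding smear_def by (rule sum.mono_neutral_cong) (use that X in \<open>auto simp: not_less\<close>)
    show ?thesis
    proof (rule clinearI)
      fix u v
      let ?N = "max (mode_bound u) (mode_bound v)"
      have z: "X n u = 0" "X n v = 0" if "n \<ge> ?N" for n using that X by auto
      then have "X n (u + v) = 0" if "n \<ge> ?N" for n using that by (simp add: clinear_simps[OF X(1)])
      then show "smear {..<mode_bound (u + v)} a X (u + v) =
          smear {..<mode_bound u} a X u + smear {..<mode_bound v} a X v"
        using z eq[of ?N u] eq[of ?N v] eq[of ?N "u + v"] clinear_add[OF clinear_smear[of X], OF X(1)] by simp
    next
      fix c v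
      have "X n (c *\<^sub>c v) = 0" if "n \<ge> mode_bound v" for n using that X by (simp add: clinear_simps[OF X(1)])
      then show "smear {..<mode_bound (c *\<^sub>c v)} a X (c *\<^sub>c v) = c *\<^sub>c smear {..<mode_bound v} a X v"
        using eq[of "mode_bound v" "c *\<^sub>c v"] clinear_scale[OF clinear_smear[of X], OF X(1)] by simp
    qed
  qed
  show "clinear (c_smear f)" unfolding c_smear_def by (rule *) (simp_all add: clinear_modes mode_bound)
  show "clinear (\<phi>_smear f)" unfolding \<phi>_smear_def by (rule *) (simp_all add: clinear_modes mode_bound)
qed (simp_all add: \<nu>_smear_def b_smear_def clinear_smear clinear_ops)

lemma smear_poly: "degree p < N \<Longrightarrow> smear {..degree p} (coeff p) X v = smear {..<N} (coeff p) X v"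
  unfolding smear_def by (rule sum.mono_neutral_left) (auto simp: coeff_eq_0)

lemma smear_add: "smear I (\<lambda>n. a n + b n) X v = smear I a X v + smear I b X v"
  by (simp add: smear_def cs.scale_left_distrib sum.distrib)

lemma smear_scale: "smear I (\<lambda>n. s * a n) X v = s *\<^sub>c smear I a X v"
  by (simp add: smear_def cs.scale_sum_right)

lemma smears_linear:
  "c_smear (f + g) v = c_smear f v + c_smear g v" "c_smear (fps_const a * f) v = a *\<^sub>c c_smear f v"
  "\<phi>_smear (f + g) v = \<phi>_smear f v + \<phi>_smear g v" "\<phi>_smear (fps_const a * f) v = a *\<^sub>c \<phi>_smear f v"
  "\<nu>_smear (p + q) v = \<nu>_smear p v + \<nu>_smear q v" "\<nu>_smear (smult a p) v = a *\<^sub>c \<nu>_smear p v"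
  "b_smear (p + q) v = b_smear p v + b_smear q v" "b_smear (smult a p) v = a *\<^sub>c b_smear p v"
proof -
  obtain N where N: "degree p < N" "degree q < N" "degree (p + q) < N" "degree (smult a p) < N"
    using that[of "Suc (max (degree p) (max (degree q) (max (degree (p + q)) (degree (smult a p)))))"]
    by (simp only: less_Suc_eq_le max.cobounded1 max.cobounded2 max.coboundedI1 max.coboundedI2)
  have coeff: "coeff (p + q) = (\<lambda>n. coeff p n + coeff q n)" "coeff (smult a p) = (\<lambda>n. a * coeff p n)"
    by (simp_all add: fun_eq_iff)
  show "\<nu>_smear (p + q) v = \<nu>_smear p v + \<nu>_smear q v" "\<nu>_smear (smult a p) v = a *\<^sub>c \<nu>_smear p v"
    "b_smear (p + q) v = b_smear p v + b_smear q v" "b_smear (smult a p) v = a *\<^sub>c b_smear p v"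
    unfolding \<nu>_smear_def b_smear_def smear_poly[OF N(1)] smear_poly[OF N(2)] smear_poly[OF N(3)] smear_poly[OF N(4)]
    by (simp_all only: coeff smear_add smear_scale)
qed (simp_all add: c_smear_def \<phi>_smear_def smear_def cs.scale_left_distrib sum.distrib cs.scale_sum_right)

lemma smears_0 [simp]: "c_smear 0 v = 0" "\<phi>_smear 0 v = 0" "\<nu>_smear 0 v = 0" "b_smear 0 v = 0"
  by (simp_all add: c_smear_def \<phi>_smear_def \<nu>_smear_def b_smear_def smear_def)

lemma pairing_as_double_sum:
  assumes "degree p < N"
  shows "(\<Sum>n<Suc N. \<Sum>k\<le>degree p. fps_nth f n * coeff p k * (if n = Suc k then s * of_nat n else 0)) = s * pairing f p"
proof -
  have "(\<Sum>n<Suc N. \<Sum>k\<le>degree p. fps_nth f n * coeff p k * (if n = Suc k then s * of_nat n else 0)) =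
      (\<Sum>k\<le>degree p. \<Sum>n<Suc N. if n = Suc k then fps_nth f (Suc k) * coeff p k * (s * of_nat (Suc k)) else 0)"
    by (subst sum.swap) (intro sum.cong, auto)
  also have "\<dots> = (\<Sum>k\<le>degree p. fps_nth f (Suc k) * coeff p k * (s * of_nat (Suc k)))"
    using assms by (intro sum.cong) auto
  finally show ?thesis by (simp add: pairing_def sum_distrib_left ac_simps)
qed

text \<open>Passing to a common bound reduces every commutator of smeared operators to one of modes.\<close>

lemma smear_commutators:
  "c_smear f (c_smear g v) = c_smear g (c_smear f v)"
  "b_smear p (b_smear q v) = b_smear q (b_smear p v)"
  "c_smear f (b_smear q v) = b_smear q (c_smear f v) - pairing f q *\<^sub>c v"
  "\<nu>_smear p (\<nu>_smear q v) = - \<nu>_smear q (\<nu>_smear p v)"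
  "\<phi>_smear f (\<phi>_smear g v) = - \<phi>_smear g (\<phi>_smear f v)"
  "\<phi>_smear f (\<nu>_smear q v) = - \<nu>_smear q (\<phi>_smear f v) + pairing f q *\<^sub>c v"
  "c_smear f (\<nu>_smear q v) = \<nu>_smear q (c_smear f v)"
  "c_smear f (\<phi>_smear g v) = \<phi>_smear g (c_smear f v)"
  "b_smear p (\<nu>_smear q v) = \<nu>_smear q (b_smear p v)"
  "b_smear q (\<phi>_smear f v) = \<phi>_smear f (b_smear q v)"
proof -
  let ?V = "{v, c_smear f v, c_smear g v, \<phi>_smear f v, \<phi>_smear g v, \<nu>_smear q v, b_smear q v}"
  obtain N' where N': "Suc (degree q) \<le> N'" "\<forall>u\<in>?V. \<forall>n\<ge>N'. c_mode n u = 0 \<and> \<phi>_mode n u = 0"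
    using common_bound[of ?V "Suc (degree q)"] by auto
  define N where "N = Suc N'"
  have c: "smear {..<N} (fps_nth h) c_mode u = c_smear h u"
    and \<phi>: "smear {..<N} (fps_nth h) \<phi>_mode u = \<phi>_smear h u" if "u \<in> ?V" for u h
  proof -
    have "c_mode n u = 0 \<and> \<phi>_mode n u = 0" if "n \<ge> N" for n
      using N'(2) \<open>u \<in> ?V\<close> that unfolding N_def by (metis Suc_leD)
    then show "smear {..<N} (fps_nth h) c_mode u = c_smear h u"
      "smear {..<N} (fps_nth h) \<phi>_mode u = \<phi>_smear h u"
      using c_smear_eq[of N u h] \<phi>_smear_eq[of N u h] by simp_all
  qed
  note lin = clinear_modes clinear_ops
  note sm =
    smear_smear[where X = c_mode and Y = c_mode and s = "1" and t = "\<lambda>n k. 0",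
      OF lin(1) lin(1) mode_commutators(1)]
    smear_smear[where X = b_op and Y = b_op and s = "1" and t = "\<lambda>n k. 0",
      OF lin(4) lin(4) mode_commutators(2)]
    smear_smear[where X = c_mode and Y = b_op and s = "1" and t = "\<lambda>n k. if n = Suc k then - of_nat n else 0",
      OF lin(1) lin(4) mode_commutators(3)]
    smear_smear[where X = \<nu>_op and Y = \<nu>_op and s = "-1" and t = "\<lambda>n k. 0",
      OF lin(5) lin(5) mode_commutators(4)]
    smear_smear[where X = \<phi>_mode and Y = \<phi>_mode and s = "-1" and t = "\<lambda>n k. 0",
      OF lin(2) lin(2) mode_commutators(5)]
    smear_smear[where X = \<phi>_mode and Y = \<nu>_op and s = "-1" and t = "\<lambda>n k. if n = Suc k then of_nat n else 0",
      OF lin(2) lin(5) mode_commutators(6)]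
    smear_smear[where X = c_mode and Y = \<nu>_op and s = "1" and t = "\<lambda>n k. 0",
      OF lin(1) lin(5) mode_commutators(7)]
    smear_smear[where X = c_mode and Y = \<phi>_mode and s = "1" and t = "\<lambda>n k. 0",
      OF lin(1) lin(2) mode_commutators(8)]
    smear_smear[where X = b_op and Y = \<nu>_op and s = "1" and t = "\<lambda>n k. 0",
      OF lin(4) lin(5) mode_commutators(9)]
    smear_smear[where X = b_op and Y = \<phi>_mode and s = "1" and t = "\<lambda>n k. 0",
      OF lin(4) lin(2) mode_commutators(10)]
  have pair: "(\<Sum>n<N. \<Sum>k\<le>degree q. fps_nth f n * coeff q k * (if n = Suc k then - of_nat n else 0)) = - pairing f q"
    "(\<Sum>n<N. \<Sum>k\<le>degree q. fps_nth f n * coeff q k * (if n = Suc k then of_nat n else 0)) = pairing f q"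
    using pairing_as_double_sum[of q N' f "-1"] pairing_as_double_sum[of q N' f 1] N'(1)
    by (simp_all add: N_def del: sum.lessThan_Suc cong: if_cong)
  show "c_smear f (c_smear g v) = c_smear g (c_smear f v)"
    using sm(1)[of "{..<N}" "fps_nth f" "{..<N}" "fps_nth g" v] by (simp add: c)
  show "b_smear p (b_smear q v) = b_smear q (b_smear p v)"
    using sm(2)[of "{..degree p}" "coeff p" "{..degree q}" "coeff q" v] by (simp add: b_smear_def)
  show "c_smear f (b_smear q v) = b_smear q (c_smear f v) - pairing f q *\<^sub>c v"
    using sm(3)[of "{..<N}" "fps_nth f" "{..degree q}" "coeff q" v] pair
    by (simp add: c flip: b_smear_def)
  show "\<nu>_smear p (\<nu>_smear q v) = - \<nu>_smear q (\<nu>_smear p v)"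
    using sm(4)[of "{..degree p}" "coeff p" "{..degree q}" "coeff q" v] by (simp add: \<nu>_smear_def)
  show "\<phi>_smear f (\<phi>_smear g v) = - \<phi>_smear g (\<phi>_smear f v)"
    using sm(5)[of "{..<N}" "fps_nth f" "{..<N}" "fps_nth g" v] by (simp add: \<phi>)
  show "\<phi>_smear f (\<nu>_smear q v) = - \<nu>_smear q (\<phi>_smear f v) + pairing f q *\<^sub>c v"
    using sm(6)[of "{..<N}" "fps_nth f" "{..degree q}" "coeff q" v] pair
    by (simp add: \<phi> flip: \<nu>_smear_def)
  show "c_smear f (\<nu>_smear q v) = \<nu>_smear q (c_smear f v)"
    using sm(7)[of "{..<N}" "fps_nth f" "{..degree q}" "coeff q" v]
    by (simp add: c flip: \<nu>_smear_def)
  show "c_smear f (\<phi>_smear g v) = \<phi>_smear g (c_smear f v)"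
    using sm(8)[of "{..<N}" "fps_nth f" "{..<N}" "fps_nth g" v] by (simp add: c \<phi>)
  show "b_smear p (\<nu>_smear q v) = \<nu>_smear q (b_smear p v)"
    using sm(9)[of "{..degree p}" "coeff p" "{..degree q}" "coeff q" v] by (simp add: b_smear_def \<nu>_smear_def)
  show "b_smear q (\<phi>_smear f v) = \<phi>_smear f (b_smear q v)"
    using sm(10)[of "{..degree q}" "coeff q" "{..<N}" "fps_nth f" v]
    by (simp add: \<phi> flip: b_smear_def)
qed

definition model_action :: "heis \<Rightarrow> fock_model \<Rightarrow> fock_model" where
  "model_action x v = c_smear (hc x) v + \<nu>_smear (h\<nu> x) v + \<phi>_smear (h\<phi> x) v + b_smear (hb x) v + hK x *\<^sub>c v"

lemma clinear_model_action: "clinear (model_action x)"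
proof -
  have "clinear (\<lambda>v. hK x *\<^sub>c v)" by (simp add: clinear_def cs.scale_right_distrib mult.commute)
  then show ?thesis
    unfolding model_action_def[abs_def] by (intro clinear_add_fun clinear_smears)
qed

lemma model_action_linear:
  "model_action (heis_add x y) v = model_action x v + model_action y v"
  "model_action (heis_scale a x) v = a *\<^sub>c model_action x v"
  by (simp_all add: model_action_def heis_add_def heis_scale_def smears_linear cs.scale_left_distrib
      cs.scale_right_distrib)

lemma model_action_bracket:
  assumes "x \<in> heis_degree d" "y \<in> heis_degree e"
  shows "model_action x (model_action y v) =
    ksign (d * e) *\<^sub>c model_action y (model_action x v) + model_action (heis_bracket x y) v"
proof -
  note lin = clinear_simps[OF clinear_smears(1)] clinear_simps[OF clinear_smears(2)]
    clinear_simps[OF clinear_smears(3)] clinear_simps[OF clinear_smears(4)]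
  obtain f p g q k where x: "x = Heis f p g q k" by (cases x)
  obtain f' p' g' q' k' where y: "y = Heis f' p' g' q' k'" by (cases y)
  have a: "p = 0" "g = 0" if "d \<noteq> 1" "d \<noteq> -1" using assms(1) that by (simp_all add: x heis_degree_def)
  have b: "f = 0" "q = 0" "k = 0" if "d \<noteq> 0" using assms(1) that by (simp_all add: x heis_degree_def)
  have c: "p' = 0" "g' = 0" if "e \<noteq> 1" "e \<noteq> -1" using assms(2) that by (simp_all add: y heis_degree_def)
  have d: "f' = 0" "q' = 0" "k' = 0" if "e \<noteq> 0" using assms(2) that by (simp_all add: y heis_degree_def)
  have even_even: ?thesis if "p = 0" "g = 0" "p' = 0" "g' = 0" "ksign (d * e) = 1"
    by (simp add: smear_commutators(1)[of f f'] smear_commutators(2)[of q q'] smear_commutators(3)[of f q']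
      smear_commutators(3)[of f' q]
        that x y model_action_def heis_bracket_def lin cs.scale_left_distrib
        cs.scale_right_distrib cs.scale_left_diff_distrib algebra_simps)
  have even_odd: ?thesis if "p = 0" "g = 0" "f' = 0" "q' = 0" "k' = 0" "ksign (d * e) = 1"
    by (simp add: smear_commutators(7)[of f p'] smear_commutators(8)[of f g'] smear_commutators(9)[of q p']
      smear_commutators(10)[of q g']
        that x y model_action_def heis_bracket_def lin cs.scale_right_distrib algebra_simps)
  have odd_even: ?thesis if "p' = 0" "g' = 0" "f = 0" "q = 0" "k = 0" "ksign (d * e) = 1"
    by (simp add: smear_commutators(7)[of f' p] smear_commutators(8)[of f' g] smear_commutators(9)[of q' p]
      smear_commutators(10)[of q' g]
        that x y model_action_def heis_bracket_def lin cs.scale_right_distrib algebra_simps)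
  have odd_odd: ?thesis if "f = 0" "q = 0" "k = 0" "f' = 0" "q' = 0" "k' = 0" "ksign (d * e) = -1"
    by (simp add: smear_commutators(4)[of p p'] smear_commutators(5)[of g g'] smear_commutators(6)[of g p']
      smear_commutators(6)[of g' p]
        that x y model_action_def heis_bracket_def lin cs.scale_left_distrib
        cs.scale_right_distrib algebra_simps)
  show ?thesis
  proof (cases "d = 1 \<or> d = -1")
    case True
    then show ?thesis
    proof (cases "e = 1 \<or> e = -1")
      case True
      then show ?thesis using \<open>d = 1 \<or> d = -1\<close> by (intro odd_odd b d) (auto simp: ksign_def)
    next
      case False
      then have pg': "p' = 0" "g' = 0" using c by auto
      have fqk: "f = 0" "q = 0" "k = 0" using b \<open>d = 1 \<or> d = -1\<close> by auto
      show ?thesis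
      proof (cases "e = 0")
        case True
        then show ?thesis by (intro odd_even pg' fqk) (simp add: ksign_def)
      next
        case False
        then show ?thesis using pg' d by (simp add: x y model_action_def heis_bracket_def lin)
      qed
    qed
  next
    case False
    then have pg: "p = 0" "g = 0" using a by auto
    show ?thesis
    proof (cases "d = 0")
      case True
      then show ?thesis
        using even_even even_odd pg c d by (cases "e = 0") (auto simp: ksign_def)
    next
      case d0: False
      then show ?thesis using pg b by (auto simp: x y model_action_def heis_bracket_def lin ksign_def)
    qed
  qed
qed

lemma model_action_ket:
  assumes "h \<in> heis_nonneg"
  shows "model_action h (basis_vec (m, {#}, {||})) = fock_character (of_int m) h *\<^sub>c basis_vec (m, {#}, {||})"
proof -
  let ?v = "basis_vec (m, {#}, {||}) :: fock_model"
  have z: "c_mode n ?v = 0" if "n \<ge> 1" for n using that by (cases n) (simp_all add: c_mode_def)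
  have zp: "\<phi>_mode n ?v = 0" for n by (cases n) (simp_all add: \<phi>_mode_def)
  have "c_smear (hc h) ?v = smear {..<1} (fps_nth (hc h)) c_mode ?v" by (rule c_smear_eq) (rule z)
  moreover have "\<phi>_smear (h\<phi> h) ?v = 0" by (simp add: \<phi>_smear_def smear_def zp)
  ultimately show ?thesis
    using assms by (simp add: model_action_def heis_nonneg_def fock_character_def smear_def c_mode_def
        cs.scale_left_distrib mult.commute)
qed

text \<open>The word algebra acts on the model; the relations of \<open>Fock\<^sub>m\<close> annihilate the vector \<open>|m\<rangle>\<close>.\<close>

definition word_action :: "(heis, complex) free_alg \<Rightarrow> fock_model \<Rightarrow> fock_model" where
  "word_action t v = linear_extension (\<lambda>u. foldr model_action u v) t"

lemma clinear_foldr: "(\<And>x. clinear (F x)) \<Longrightarrow> clinear (foldr F u)"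
  by (induction u) (simp_all add: clinear_def)

lemma word_action_linear:
  "clinear (\<lambda>t. word_action t v)" "clinear (word_action t)"
proof -
  show "clinear (\<lambda>t. word_action t v)" unfolding word_action_def by (rule clinear_linear_extension)
  show "clinear (word_action t)" unfolding word_action_def[abs_def] linear_extension_def
    by (intro clinear_sum_fun clinear_scale_fun clinear_foldr clinear_model_action)
qed

lemmas word_action_simps = clinear_simps[OF word_action_linear(1)] clinear_simps[OF word_action_linear(2)]

lemma word_action_word [simp]: "word_action (word u) v = foldr model_action u v"
  by (simp add: word_action_def)

lemma word_action_fmul: "word_action (p \<star> q) v = word_action p (word_action q v)"
proof (induction p rule: basis_induct)
  case (basis u)
  show ?case
    by (induction q rule: basis_induct)
      (simp_all add: fmul_add_right fmul_cscale_right word_action_simps)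
qed (simp_all add: fmul_add_left fmul_cscale_left word_action_simps)

lemma word_action_enveloping: "r \<in> enveloping_relations \<Longrightarrow> word_action r v = 0"
  unfolding enveloping_relations_def
proof (elim UnE CollectE exE conjE)
  fix x y d e
  assume r: "r = word [x, y] - ksign (d * e) *\<^sub>c word [y, x] - word [heis_bracket x y]"
    and "x \<in> heis_degree d" "y \<in> heis_degree e"
  then have "model_action x (model_action y v) =
      ksign (d * e) *\<^sub>c model_action y (model_action x v) + model_action (heis_bracket x y) v"
    by (intro model_action_bracket)
  then show "word_action r v = 0" by (simp add: r word_action_simps)
qed (simp_all add: word_action_simps model_action_linear)

lemma word_action_relations:
  assumes "t \<in> fock_relations (of_int m)"
  shows "word_action t (basis_vec (m, {#}, {||})) = 0"
  using assms unfolding fock_relations_def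
proof (induction rule: cs.span_induct_alt)
  case base
  show ?case by (simp add: word_action_simps)
next
  case (step c x y)
  have "word_action x (basis_vec (m, {#}, {||})) = 0"
    using step(1)
    by (auto simp: word_action_fmul word_action_enveloping word_action_simps model_action_ket)
  then show ?case using step(2) by (simp add: word_action_simps)
qed

text \<open>The map to the model is equivariant for the Heisenberg algebra, so it sends the creation monomials to distinct
  basis vectors up to sign: they are independent in the Fock modules.\<close>

lift_definition to_model :: "lattice_fock \<Rightarrow> fock_model" is
  "\<lambda>F. \<Sum>m\<in>Poly_Mapping.keys F. word_action (Poly_Mapping.lookup F m) (basis_vec (m, {#}, {||}))"
proof -
  fix F G :: "int \<Rightarrow>\<^sub>0 (heis, complex) free_alg"
  assume *: "\<And>m. Poly_Mapping.lookup F m - Poly_Mapping.lookup G m \<in> fock_relations (of_int m)"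
  let ?A = "Poly_Mapping.keys F \<union> Poly_Mapping.keys G"
  let ?e = "\<lambda>F m. word_action (Poly_Mapping.lookup F m) (basis_vec (m, {#}, {||}))"
  have "(\<Sum>m\<in>Poly_Mapping.keys F. ?e F m) = (\<Sum>m\<in>?A. ?e F m)"
    by (rule sum.mono_neutral_left) (auto simp: in_keys_iff word_action_simps)
  also have "\<dots> = (\<Sum>m\<in>?A. ?e G m)"
    using word_action_relations[OF *] by (simp add: word_action_simps)
  also have "\<dots> = (\<Sum>m\<in>Poly_Mapping.keys G. ?e G m)"
    by (rule sum.mono_neutral_right) (auto simp: in_keys_iff word_action_simps)
  finally show "(\<Sum>m\<in>Poly_Mapping.keys F. ?e F m) = (\<Sum>m\<in>Poly_Mapping.keys G. ?e G m)" .
qed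

lemma to_model_superset:
  assumes "finite A" "Poly_Mapping.keys F \<subseteq> A"
  shows "to_model (abs_lattice_fock F) =
    (\<Sum>m\<in>A. word_action (Poly_Mapping.lookup F m) (basis_vec (m, {#}, {||})))"
  unfolding to_model.abs_eq
  by (rule sum.mono_neutral_left) (use assms in \<open>auto simp: in_keys_iff word_action_simps\<close>)

lemma lattice_fock_representative: obtains F where "v = abs_lattice_fock F"
  by (induction v rule: lattice_fock.abs_induct) blast

lemma clinear_to_model: "clinear to_model"
proof (rule clinearI)
  fix x y :: lattice_fock and a
  obtain F G where x: "x = abs_lattice_fock F" and y: "y = abs_lattice_fock G"
    using lattice_fock_representative by metis
  have "Poly_Mapping.keys (F + G) \<subseteq> Poly_Mapping.keys F \<union> Poly_Mapping.keys G" by (rule Poly_Mapping.keys_add)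
  then show "to_model (x + y) = to_model x + to_model y"
    unfolding x y plus_lattice_fock.abs_eq
    by (simp add: to_model_superset[of "Poly_Mapping.keys F \<union> Poly_Mapping.keys G"] lookup_add
        word_action_simps sum.distrib)
  have "Poly_Mapping.keys (a *\<^sub>c F) \<subseteq> Poly_Mapping.keys F"
    by (auto simp: in_keys_iff lookup_cscale)
  then show "to_model (a *\<^sub>c x) = a *\<^sub>c to_model x"
    unfolding x cscale_lattice_fock.abs_eq
    by (simp add: to_model_superset[of "Poly_Mapping.keys F"] lookup_cscale word_action_simps cs.scale_sum_right)
qed

lemma to_model_ket: "to_model (fock_ket m) = basis_vec (m, {#}, {||})"
  unfolding fock_ket_def fock_class_def
  by (subst to_model_superset[of "{m}"]) (auto simp: in_keys_iff lookup_single when_def)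

lemma to_model_action: "to_model (fock_action x v) = model_action x (to_model v)"
proof -
  obtain F where v: "v = abs_lattice_fock F" by (rule lattice_fock_representative)
  have "Poly_Mapping.keys (Poly_Mapping.map ((\<star>) (word [x])) F) \<subseteq> Poly_Mapping.keys F"
    by (auto simp: in_keys_iff lookup_map_fmul)
  then show ?thesis
    unfolding v fock_action.abs_eq
    by (simp add: to_model_superset[of "Poly_Mapping.keys F"] lookup_map_fmul word_action_fmul
        clinear_sum[OF clinear_model_action])
qed

lemma to_model_creation:
  "to_model (bb n v) = b_op n (to_model v)" "to_model (nn n v) = \<nu>_op n (to_model v)"
proof -
  have s: "smear {..n} (coeff (monom 1 n)) X w = X n w" for X :: "nat \<Rightarrow> fock_model \<Rightarrow> fock_model" and w
  proof -
    have "smear {..n} (coeff (monom 1 n)) X w = (\<Sum>i\<in>{..n}. if i = n then X n w else 0)"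
      unfolding smear_def by (rule sum.cong) auto
    then show ?thesis by simp
  qed
  have d: "degree (monom 1 n :: complex poly) = n" by (simp add: degree_monom_eq)
  show "to_model (bb n v) = b_op n (to_model v)" "to_model (nn n v) = \<nu>_op n (to_model v)"
    using d s unfolding bb_def nn_def to_model_action
    by (simp_all add: model_action_def \<nu>_smear_def[of "monom 1 n"] b_smear_def[of "monom 1 n"])
qed

lemma fock_ket_nonzero: "fock_ket m \<noteq> 0"
proof
  assume "fock_ket m = 0"
  then have "basis_vec (m, {#}, {||}) = (0 :: fock_model)"
    using to_model_ket[of m] clinear_0[OF clinear_to_model] by simp
  then show False by (metis lookup_single_eq lookup_zero zero_neq_one)
qed

section \<open>Recursion over the Fock modules\<close>

text \<open>The direct sum of the Fock modules is free over the creation operators: a linear map may be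
  prescribed on the vectors \<open>|m\<rangle>\<close> together with operators that the \<open>b\<^sub>n\<close> and \<open>\<nu>\<^sub>n\<close> are carried to, provided
  that these satisfy the same (anti)commutation relations.\<close>

locale creation_module =
  fixes \<beta> \<eta> :: "nat \<Rightarrow> 'x::complex_space \<Rightarrow> 'x"
  assumes \<beta>_linear: "clinear (\<beta> n)" and \<eta>_linear: "clinear (\<eta> n)"
    and \<beta>_\<beta>: "\<beta> n (\<beta> k x) = \<beta> k (\<beta> n x)" and \<beta>_\<eta>: "\<beta> n (\<eta> k x) = \<eta> k (\<beta> n x)"
    and \<eta>_\<eta>: "\<eta> n (\<eta> k x) = - \<eta> k (\<eta> n x)"
begin

lemma \<eta>_square: "\<eta> n (\<eta> n x) = 0"
proof -
  have "2 *\<^sub>c \<eta> n (\<eta> n x) = \<eta> n (\<eta> n x) + \<eta> n (\<eta> n x)"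
    using cs.scale_left_distrib[of 1 1] by simp
  also have "\<dots> = 0" using \<eta>_\<eta>[of n n x] by (metis add.right_inverse)
  finally show ?thesis by simp
qed

definition basis_image :: "(int \<Rightarrow> 'x) \<Rightarrow> fock_key \<Rightarrow> 'x" where
  "basis_image x = (\<lambda>(m, E, S). foldr \<eta> (sorted_list_of_set (fset S)) (fold_mset \<beta> (x m) E))"

lemma comp_fun_commute_\<beta>: "comp_fun_commute \<beta>"
  by standard (simp add: fun_eq_iff \<beta>_\<beta>)

lemma basis_image_b: "basis_image x (m, add_mset n E, S) = \<beta> n (basis_image x (m, E, S))"
proof -
  have "foldr \<eta> ns (\<beta> n y) = \<beta> n (foldr \<eta> ns y)" for ns y
    by (induction ns) (simp_all add: \<beta>_\<eta>)
  then show ?thesis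
    by (simp add: basis_image_def comp_fun_commute.fold_mset_add_mset[OF comp_fun_commute_\<beta>])
qed

text \<open>Moving \<open>\<eta> n\<close> to its place costs one sign for each smaller index, and a repeated factor squares to zero.  The
  signs agree with those of the model, which is what makes the recursion equation for \<open>\<nu>\<^sub>n\<close> hold.\<close>

lemma \<eta>_foldr_insort:
  assumes "sorted ns" "distinct ns"
  shows "\<eta> n (foldr \<eta> ns y) =
    (if n \<in> set ns then 0 else (-1) ^ card {i \<in> set ns. i < n} *\<^sub>c foldr \<eta> (insort n ns) y)"
  using assms
proof (induction ns)
  case Nil
  then show ?case by simp
next
  case (Cons k ns)
  consider "n < k" | "n = k" | "k < n" by linarith
  then show ?case
  proof cases
    case 1
    then have n: "n \<notin> set (k # ns)" and e: "{i \<in> set (k # ns). i < n} = {}" using Cons.prems by fastforce+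
    have "insort n (k # ns) = n # k # ns" using 1 by simp
    then show ?thesis by (simp only: n e if_False card.empty power_0 cs.scale_one foldr.simps o_apply)
  next
    case 2
    then show ?thesis by (simp add: \<eta>_square)
  next
    case 3
    have *: "{i. (i = k \<or> i \<in> set ns) \<and> i < n} = insert k {i \<in> set ns. i < n}" using 3 by auto
    have "k \<notin> {i \<in> set ns. i < n}" using Cons.prems by auto
    then have c: "card {i. (i = k \<or> i \<in> set ns) \<and> i < n} = Suc (card {i \<in> set ns. i < n})"
      unfolding * by simp
    have "\<eta> n (foldr \<eta> (k # ns) y) = - \<eta> k (\<eta> n (foldr \<eta> ns y))" using \<eta>_\<eta>[of n k "foldr \<eta> ns y"] by simp
    then show ?thesis
      using Cons 3 by (auto simp: clinear_simps[OF \<eta>_linear] c)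
  qed
qed

lemma basis_image_\<nu>:
  "(if n |\<in>| S then 0 else order_sign n S *\<^sub>c basis_image x (m, E, finsert n S)) = \<eta> n (basis_image x (m, E, S))"
proof (cases "n |\<in>| S")
  case True
  then show ?thesis by (simp add: basis_image_def \<eta>_foldr_insort)
next
  case False
  then have "sorted_list_of_set (fset (finsert n S)) = insort n (sorted_list_of_set (fset S))"
    by (simp add: sorted_list_of_set_insert_remove)
  with False show ?thesis by (simp add: basis_image_def \<eta>_foldr_insort order_sign_def)
qed

definition fock_rec :: "(int \<Rightarrow> 'x) \<Rightarrow> lattice_fock \<Rightarrow> 'x" where
  "fock_rec x v = linear_extension (basis_image x) (to_model v)"

lemma clinear_fock_rec: "clinear (fock_rec x)"
  unfolding fock_rec_def[abs_def] by (rule clinear_comp[OF clinear_linear_extension clinear_to_model])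

lemma fock_rec_ket: "fock_rec x (fock_ket m) = x m"
  by (simp add: fock_rec_def to_model_ket basis_image_def)

lemma fock_rec_bb: "fock_rec x (bb n v) = \<beta> n (fock_rec x v)"
proof -
  have "linear_extension (basis_image x) (b_op n w) = \<beta> n (linear_extension (basis_image x) w)" for w
  proof (induction w rule: basis_induct)
    case (basis k)
    obtain m E S where k: "k = (m, E, S)" by (cases k)
    show ?case by (simp add: k basis_image_b)
  qed (simp_all add: ops_linear clinear_simps[OF clinear_linear_extension] clinear_simps[OF \<beta>_linear])
  then show ?thesis by (simp add: fock_rec_def to_model_creation)
qed

lemma fock_rec_nn: "fock_rec x (nn n v) = \<eta> n (fock_rec x v)"
proof -
  have "linear_extension (basis_image x) (\<nu>_op n w) = \<eta> n (linear_extension (basis_image x) w)" for w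
  proof (induction w rule: basis_induct)
    case (basis k)
    obtain m E S where k: "k = (m, E, S)" by (cases k)
    show ?case using basis_image_\<nu>[of n S x m E]
      by (auto simp: k clinear_simps[OF clinear_linear_extension] split: if_splits)
  qed (simp_all add: ops_linear clinear_simps[OF clinear_linear_extension] clinear_simps[OF \<eta>_linear])
  then show ?thesis by (simp add: fock_rec_def to_model_creation)
qed

end

section \<open>Derivations and products on the direct sum of Fock modules\<close>

text \<open>The derivatives \<open>\<partial>/\<partial>x\<^sub>n = c\<^sub>n\<close> and \<open>\<partial>/\<partial>\<nu>\<^sub>n = \<phi>\<^bsub>n+1\<^esub> / (n+1)\<close>.\<close>

definition cc :: "nat \<Rightarrow> lattice_fock \<Rightarrow> lattice_fock" where "cc n = c_act (fps_X ^ n)"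

definition dd :: "nat \<Rightarrow> lattice_fock \<Rightarrow> lattice_fock" where
  "dd n v = inverse (of_nat (Suc n)) *\<^sub>c \<phi>_act (fps_X ^ Suc n) v"

lemma clinear_cc: "clinear (cc n)" and clinear_dd: "clinear (dd n)"
  unfolding cc_def dd_def[abs_def] by (intro clinear_scale_fun clinear_fock_action)+

lemmas mode_simps = creation_simps clinear_simps[OF clinear_cc] clinear_simps[OF clinear_dd]

lemma of_nat_Suc_nonzero: "(of_nat (Suc n) :: complex) \<noteq> 0"
  by (rule of_nat_neq_0)

lemma cc_bb: "cc i (bb k v) = bb k (cc i v) - (if i = Suc k then of_nat i else 0) *\<^sub>c v"
  by (simp add: cc_def creation_commutators fps_X_power_nth del: power_Suc)

lemma cc_nn: "cc i (nn k v) = nn k (cc i v)"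
  by (simp add: cc_def creation_commutators)

lemma dd_bb: "dd i (bb k v) = bb k (dd i v)"
  by (simp add: dd_def creation_commutators creation_simps)

lemma dd_nn: "dd i (nn k v) = - nn k (dd i v) + (if i = k then v else 0)"
  using of_nat_Suc_nonzero[of k]
  by (auto simp: dd_def creation_commutators creation_simps cs.scale_right_distrib fps_X_power_nth
      cs.scale_right_diff_distrib simp del: of_nat_Suc power_Suc)

lemma cc_cc: "cc i (cc k v) = cc k (cc i v)"
  unfolding cc_def by (rule smeared_commutators(1))

lemma cc_dd: "cc i (dd k v) = dd k (cc i v)"
  by (simp add: cc_def dd_def smeared_commutators(8) fock_action_simps)

lemma dd_dd: "dd i (dd k v) = - dd k (dd i v)"
  by (simp add: dd_def smeared_commutators(5)[of "fps_X ^ Suc i" "fps_X ^ Suc k"] fock_action_simps mult.commute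
      del: power_Suc)

lemma cc_ket: "cc i (fock_ket m) = (if i = 0 then of_int m else 0) *\<^sub>c fock_ket m"
  by (simp add: cc_def smeared_ket)

lemma dd_ket: "dd i (fock_ket m) = 0"
  by (simp add: dd_def smeared_ket)

lemmas annihilate = cc_bb cc_nn dd_bb dd_nn cc_ket dd_ket

lemma \<phi>_0: "\<phi>_act 1 v = 0"
  by (induction v rule: creation_induct) (simp_all add: fock_action_simps smeared_ket creation_commutators creation_simps)

lemma \<phi>_act_Suc: "\<phi>_act (fps_X ^ Suc n) v = of_nat (Suc n) *\<^sub>c dd n v"
  using of_nat_Suc_nonzero[of n] by (simp add: dd_def del: of_nat_Suc power_Suc)

text \<open>A vector is obtained by finitely many creation operators, and each of them fails to commute with a single mode
  only.  Hence an annihilation operator whose low coefficients vanish kills it.\<close>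

lemma smeared_locally_finite:
  "\<exists>N. \<forall>f. (\<forall>n<N. fps_nth f n = 0) \<longrightarrow> c_act f v = 0 \<and> \<phi>_act f v = 0"
proof (induction v rule: creation_induct)
  case (add v w)
  then obtain M N where "\<forall>f. (\<forall>n<M. fps_nth f n = 0) \<longrightarrow> c_act f v = 0 \<and> \<phi>_act f v = 0"
    "\<forall>f. (\<forall>n<N. fps_nth f n = 0) \<longrightarrow> c_act f w = 0 \<and> \<phi>_act f w = 0" by blast
  then show ?case by (intro exI[of _ "max M N"]) (simp add: fock_action_simps)
next
  case (scale a v)
  then obtain N where "\<forall>f. (\<forall>n<N. fps_nth f n = 0) \<longrightarrow> c_act f v = 0 \<and> \<phi>_act f v = 0" by blast
  then show ?case by (intro exI[of _ N]) (simp add: fock_action_simps)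
next
  case (ket m)
  then show ?case by (intro exI[of _ 1]) (simp add: smeared_ket)
next
  case (bb n v)
  then obtain N where "\<forall>f. (\<forall>n<N. fps_nth f n = 0) \<longrightarrow> c_act f v = 0 \<and> \<phi>_act f v = 0" by blast
  then show ?case by (intro exI[of _ "max N (n + 2)"]) (simp add: fock_action_simps creation_simps creation_commutators)
next
  case (nn n v)
  then obtain N where "\<forall>f. (\<forall>n<N. fps_nth f n = 0) \<longrightarrow> c_act f v = 0 \<and> \<phi>_act f v = 0" by blast
  then show ?case by (intro exI[of _ "max N (n + 2)"]) (simp add: fock_action_simps creation_simps creation_commutators)
qed

lemma smeared_as_finite_sum:
  "\<exists>N0. \<forall>N\<ge>N0. \<forall>f. c_act f v = (\<Sum>n<N. fps_nth f n *\<^sub>c cc n v) \<and> \<phi>_act f v = (\<Sum>n<N. fps_nth f n *\<^sub>c \<phi>_act (fps_X ^ n) v)"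
proof -
  obtain N0 where N: "\<And>f. (\<forall>n<N0. fps_nth f n = 0) \<Longrightarrow> c_act f v = 0 \<and> \<phi>_act f v = 0"
    using smeared_locally_finite by blast
  have sums: "c_act (\<Sum>n\<in>I. g n) v = (\<Sum>n\<in>I. c_act (g n) v)" "\<phi>_act (\<Sum>n\<in>I. g n) v = (\<Sum>n\<in>I. \<phi>_act (g n) v)"
    for I :: "nat set" and g
    by (induction I rule: infinite_finite_induct) (simp_all add: smeared_linear)
  show ?thesis
  proof (intro exI[of _ N0] allI impI)
    fix N and f :: "complex fps"
    assume "N0 \<le> N"
    let ?s = "\<Sum>n<N. fps_const (fps_nth f n) * fps_X ^ n"
    have z: "\<forall>n<N0. fps_nth (f - ?s) n = 0"
      using \<open>N0 \<le> N\<close> by (auto simp: fps_sum_nth fps_X_power_nth if_distrib cong: if_cong)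
    have "c_act f v = c_act ?s v + c_act (f - ?s) v" "\<phi>_act f v = \<phi>_act ?s v + \<phi>_act (f - ?s) v"
      using smeared_linear(1)[of ?s "f - ?s" v] smeared_linear(3)[of ?s "f - ?s" v] by simp_all
    then show "c_act f v = (\<Sum>n<N. fps_nth f n *\<^sub>c cc n v) \<and> \<phi>_act f v = (\<Sum>n<N. fps_nth f n *\<^sub>c \<phi>_act (fps_X ^ n) v)"
      using N[OF z] by (simp add: sums smeared_linear cc_def)
  qed
qed

text \<open>Sums over modes are cut off at an index beyond which all derivatives of the vector vanish.  Statements about
  several vectors use a common such index.\<close>

definition ann :: "nat \<Rightarrow> lattice_fock \<Rightarrow> bool" where
  "ann N v \<longleftrightarrow> (\<forall>i\<ge>N. cc i v = 0 \<and> dd i v = 0)"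

lemma ann_mono: "ann M v \<Longrightarrow> M \<le> N \<Longrightarrow> ann N v"
  by (simp add: ann_def)

lemma annD: "ann N v \<Longrightarrow> i \<ge> N \<Longrightarrow> cc i v = 0" "ann N v \<Longrightarrow> i \<ge> N \<Longrightarrow> dd i v = 0"
  by (simp_all add: ann_def)

lemma ann_exists: "\<exists>N. ann N v"
proof -
  obtain N where N: "\<And>f. (\<forall>n<N. fps_nth f n = 0) \<Longrightarrow> c_act f v = 0 \<and> \<phi>_act f v = 0"
    using smeared_locally_finite by blast
  have "cc i v = 0 \<and> dd i v = 0" if "i \<ge> N" for i
    using N[of "fps_X ^ i"] N[of "fps_X ^ Suc i"] that by (simp add: cc_def dd_def fps_X_power_nth del: power_Suc)
  then show ?thesis unfolding ann_def by blast
qed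

lemma ann_common: "finite V \<Longrightarrow> \<exists>N\<ge>M. \<forall>v\<in>V. ann N v"
proof (induction V rule: finite_induct)
  case (insert v V)
  then obtain N N' where "N \<ge> M" "\<forall>v\<in>V. ann N v" "ann N' v" using ann_exists by blast
  then show ?case by (intro exI[of _ "max N N'"]) (auto intro: ann_mono)
qed auto

lemma ann_cc: "ann N v \<Longrightarrow> ann N (cc k v)" and ann_dd: "ann N v \<Longrightarrow> ann N (dd k v)"
  by (auto simp: ann_def cc_cc[of _ k] dd_dd[of _ k] cc_dd mode_simps simp flip: cc_dd[of k])

definition ann_bound :: "lattice_fock \<Rightarrow> nat" where
  "ann_bound v = (LEAST N. ann N v)"

lemma ann_bound: "ann (ann_bound v) v"
  unfolding ann_bound_def by (rule LeastI_ex[OF ann_exists])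

text \<open>The derivation \<open>T = \<Sum> (T x\<^sub>n) \<partial>/\<partial>x\<^sub>n + (T \<nu>\<^sub>n) \<partial>/\<partial>\<nu>\<^sub>n\<close> with \<open>T x\<^sub>n = (n+1) x\<^bsub>n+1\<^esub> = -b\<^sub>n\<close> and
  \<open>T \<nu>\<^sub>n = (n+1) \<nu>\<^bsub>n+1\<^esub>\<close>.\<close>

definition tr :: "lattice_fock \<Rightarrow> lattice_fock" where
  "tr v = (\<Sum>n<ann_bound v. of_nat (Suc n) *\<^sub>c nn (Suc n) (dd n v) - bb n (cc n v))"

lemma tr_eq:
  assumes "ann N v"
  shows "tr v = (\<Sum>n<N. of_nat (Suc n) *\<^sub>c nn (Suc n) (dd n v) - bb n (cc n v))"
  unfolding tr_def
  by (rule sum.mono_neutral_cong)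
    (use annD[OF assms] annD[OF ann_bound[of v]] in \<open>auto simp: not_less mode_simps\<close>)

lemma clinear_tr: "clinear tr"
proof (rule clinearI)
  fix v w
  obtain N where "\<forall>u\<in>{v, w, v + w}. ann N u" using ann_common[of "{v, w, v + w}" 0] by auto
  then show "tr (v + w) = tr v + tr w"
    by (simp add: tr_eq[of N] mode_simps cs.scale_right_distrib sum.distrib algebra_simps sum_subtractf)
next
  fix a v
  obtain N where "\<forall>u\<in>{v, a *\<^sub>c v}. ann N u" using ann_common[of "{v, a *\<^sub>c v}" 0] by auto
  then show "tr (a *\<^sub>c v) = a *\<^sub>c tr v"
    by (simp add: tr_eq[of N] mode_simps cs.scale_sum_right cs.scale_right_diff_distrib mult.commute
        del: of_nat_Suc)
qed

lemmas tr_simps = clinear_simps[OF clinear_tr]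

lemma tr_ket: "tr (fock_ket m) = - (of_int m *\<^sub>c bb 0 (fock_ket m))"
proof -
  have "ann 1 (fock_ket m)" by (simp add: ann_def annihilate)
  then show ?thesis by (simp add: tr_eq[of 1] annihilate mode_simps)
qed

lemma tr_bb: "tr (bb k v) = bb k (tr v) + of_nat (Suc k) *\<^sub>c bb (Suc k) v"
proof -
  obtain N where N: "ann N v" "ann N (bb k v)" "k + 2 \<le> N" using ann_common[of "{v, bb k v}" "k + 2"] by auto
  have "tr (bb k v) = (\<Sum>n<N. bb k (of_nat (Suc n) *\<^sub>c nn (Suc n) (dd n v) - bb n (cc n v)) +
      (if n = Suc k then of_nat (Suc k) *\<^sub>c bb (Suc k) v else 0))"
    unfolding tr_eq[OF N(2)]
    by (rule sum.cong) (auto simp: annihilate mode_simps bb_bb[of _ k] bb_nn simp del: of_nat_Suc)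
  also have "\<dots> = bb k (tr v) + of_nat (Suc k) *\<^sub>c bb (Suc k) v"
    using N(3) by (simp add: tr_eq[OF N(1)] mode_simps sum.distrib del: of_nat_Suc)
  finally show ?thesis .
qed

lemma tr_nn: "tr (nn k v) = nn k (tr v) + of_nat (Suc k) *\<^sub>c nn (Suc k) v"
proof -
  obtain N where N: "ann N v" "ann N (nn k v)" "k + 2 \<le> N" using ann_common[of "{v, nn k v}" "k + 2"] by auto
  have "tr (nn k v) = (\<Sum>n<N. nn k (of_nat (Suc n) *\<^sub>c nn (Suc n) (dd n v) - bb n (cc n v)) +
      (if n = k then of_nat (Suc k) *\<^sub>c nn (Suc k) v else 0))"
    unfolding tr_eq[OF N(2)]
    by (rule sum.cong) (auto simp: annihilate mode_simps nn_nn[of _ k] bb_nn cs.scale_right_distrib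
        simp del: of_nat_Suc)
  also have "\<dots> = nn k (tr v) + of_nat (Suc k) *\<^sub>c nn (Suc k) v"
    using N(3) by (simp add: tr_eq[OF N(1)] mode_simps sum.distrib del: of_nat_Suc)
  finally show ?thesis .
qed

lemma tr_cc: "tr (cc n v) = cc n (tr v) - of_nat n *\<^sub>c cc (n - 1) v"
proof (induction v arbitrary: n rule: creation_induct)
  case (add v w)
  then show ?case by (simp add: mode_simps tr_simps cs.scale_right_distrib)
next
  case (scale a v)
  then show ?case by (simp add: mode_simps tr_simps cs.scale_right_diff_distrib mult.commute)
next
  case (ket m)
  show ?case
    by (cases "n = 0"; cases "n = 1") (auto simp: annihilate tr_simps tr_ket mode_simps mult.commute)
next
  case (bb k v)
  show ?case
    by (cases "n = Suc k"; cases "n = Suc (Suc k)"; cases n)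
      (auto simp: bb annihilate tr_simps tr_bb mode_simps cs.scale_right_diff_distrib
        cs.scale_left_distrib mult.commute algebra_simps)
next
  case (nn k v)
  show ?case by (simp add: nn annihilate tr_simps tr_nn mode_simps algebra_simps mult.commute)
qed

lemma tr_dd: "tr (dd n v) = dd n (tr v) - of_nat n *\<^sub>c dd (n - 1) v"
proof (induction v arbitrary: n rule: creation_induct)
  case (add v w)
  then show ?case by (simp add: mode_simps tr_simps cs.scale_right_distrib)
next
  case (scale a v)
  then show ?case by (simp add: mode_simps tr_simps cs.scale_right_diff_distrib mult.commute)
next
  case (ket m)
  show ?case by (simp add: annihilate tr_simps tr_ket mode_simps)
next
  case (bb k v)
  show ?case by (simp add: bb annihilate tr_simps tr_bb mode_simps algebra_simps mult.commute)
next
  case (nn k v)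
  show ?case
    by (cases "n = k"; cases "n = Suc k"; cases n)
      (auto simp: nn annihilate tr_simps tr_nn mode_simps cs.scale_right_diff_distrib
        cs.scale_left_distrib mult.commute algebra_simps)
qed

text \<open>\<open>T\<^sup>r / r!\<close>, extended by zero to negative \<open>r\<close>: terms such as \<open>z\<^sup>j \<Omega>\<^sub>z\<^sup>m\<close> with \<open>j > m\<close> then vanish without a case
  distinction.\<close>

definition Tp :: "int \<Rightarrow> lattice_fock \<Rightarrow> lattice_fock" where
  "Tp r v = (if r < 0 then 0 else inverse (fact (nat r)) *\<^sub>c (tr ^^ nat r) v)"

lemma clinear_Tp: "clinear (Tp r)"
proof -
  have "clinear (tr ^^ n)" for n
    by (induction n) (simp_all add: clinear_def tr_simps)
  then show ?thesis by (simp add: clinear_def Tp_def cs.scale_right_distrib mult.commute)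
qed

lemmas Tp_simps = clinear_simps[OF clinear_Tp]

lemma Tp_neg [simp]: "r < 0 \<Longrightarrow> Tp r v = 0"
  by (simp add: Tp_def)

lemma Tp_0 [simp]: "Tp 0 v = v"
  by (simp add: Tp_def)

lemma tr_Tp: "tr (Tp r v) = of_int (r + 1) *\<^sub>c Tp (r + 1) v"
proof (cases "r < 0")
  case True
  then show ?thesis by (cases "r = -1") (simp_all add: tr_simps)
next
  case False
  then obtain n where r: "r = int n" by (metis nonneg_int_cases not_less)
  then have "nat (r + 1) = Suc n" by simp
  moreover have "(fact n + fact n * of_nat n :: complex) \<noteq> 0"
    using fact_nonzero[of "Suc n", where 'a = complex] by (simp add: algebra_simps)
  ultimately show ?thesis using False of_nat_Suc_nonzero[of n] unfolding Tp_def
    by (simp add: r tr_simps field_simps)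
qed

lemma Tp_tr: "Tp r (tr v) = of_int (r + 1) *\<^sub>c Tp (r + 1) v"
proof (cases "r < 0")
  case True
  then show ?thesis by (cases "r = -1") simp_all
next
  case False
  have "(tr ^^ n) (tr v) = tr ((tr ^^ n) v)" for n by (induction n) simp_all
  then have "Tp r (tr v) = tr (Tp r v)" using False by (simp add: Tp_def tr_simps)
  then show ?thesis by (simp add: tr_Tp)
qed

lemma Tp_Suc: "of_nat (Suc n) *\<^sub>c Tp (int (Suc n)) v = tr (Tp (int n) v)"
  by (simp add: tr_Tp add.commute)

lemma Tp_eqI: "of_nat (Suc n) *\<^sub>c x = of_nat (Suc n) *\<^sub>c y \<Longrightarrow> x = y"
  using of_nat_Suc_nonzero[of n] by (metis cs.scale_left_imp_eq)

lemma Tp_Tp: "Tp u (Tp (int p) v) = of_nat (nat (u + int p) choose p) *\<^sub>c Tp (u + int p) v"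
proof (induction p arbitrary: u)
  case 0
  then show ?case by simp
next
  case (Suc p)
  let ?w = "u + int (Suc p)"
  have c: "(of_int (u + 1) * of_nat (nat ?w choose p) :: complex) = of_nat (Suc p) * of_nat (nat ?w choose Suc p)"
    if "?w \<ge> 0"
  proof -
    have "of_nat (nat ?w) * (of_nat (nat ?w) gchoose p) =
        of_nat p * (of_nat (nat ?w) gchoose p) + of_nat (Suc p) * (of_nat (nat ?w) gchoose Suc p :: complex)"
      by (rule gbinomial_mult_1)
    moreover have "of_nat (nat ?w) = (of_int (u + 1) + of_nat p :: complex)"
      using that by (simp add: of_nat_nat)
    ultimately show ?thesis by (simp only: binomial_gbinomial distrib_right) simp
  qed
  have "of_nat (Suc p) *\<^sub>c Tp u (Tp (int (Suc p)) v) = Tp u (tr (Tp (int p) v))"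
    by (simp only: Tp_Suc[symmetric] Tp_simps)
  also have "\<dots> = of_int (u + 1) *\<^sub>c Tp (u + 1) (Tp (int p) v)" by (rule Tp_tr)
  also have "\<dots> = (of_int (u + 1) * of_nat (nat ?w choose p)) *\<^sub>c Tp ?w v"
    by (simp add: Suc algebra_simps)
  also have "\<dots> = of_nat (Suc p) *\<^sub>c (of_nat (nat ?w choose Suc p) *\<^sub>c Tp ?w v)"
    using c by (cases "?w \<ge> 0") simp_all
  finally show ?case by (rule Tp_eqI)
qed

text \<open>All non-negative modes of fields satisfy \<open>[T, D\<^sub>n] = -n D\<^bsub>n-1\<^esub>\<close>; moving such a mode past \<open>T\<close> one step at a time,
  the coefficients are collected by \<open>n (n-1 choose k) = (n-k) (n choose k)\<close>.\<close>

lemma mode_Tp: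
  fixes D :: "nat \<Rightarrow> lattice_fock \<Rightarrow> lattice_fock"
  assumes D: "\<And>n. clinear (D n)" "\<And>n v. tr (D n v) = D n (tr v) - of_nat n *\<^sub>c D (n - 1) v"
  shows "D n (Tp r v) = (\<Sum>k\<le>n. of_nat (n choose k) *\<^sub>c Tp (r - int n + int k) (D k v))"
proof (cases "r < 0")
  case True
  then show ?thesis by (simp add: clinear_0[OF D(1)])
next
  case False
  then obtain j where r: "r = int j" by (metis nonneg_int_cases not_less)
  show ?thesis unfolding r
  proof (induction j arbitrary: n)
    case 0
    have "(\<Sum>k\<le>n. of_nat (n choose k) *\<^sub>c Tp (int 0 - int n + int k) (D k v)) = (\<Sum>k\<le>n. if k = n then D n v else 0)"
      by (rule sum.cong) auto
    then show ?case by simp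
  next
    case (Suc j)
    have absorb: "n * (n - 1 choose k) + k * (n choose k) = n * (n choose k)" if "k \<le> n" for k
      using that by (simp only: binomial_absorb_comp[symmetric] add_mult_distrib[symmetric] le_add_diff_inverse2)
    have ext: "of_nat n *\<^sub>c (\<Sum>k\<le>n - 1. of_nat (n - 1 choose k) *\<^sub>c Tp (int j - int (n - 1) + int k) (D k v)) =
        (\<Sum>k\<le>n. of_nat (n * (n - 1 choose k)) *\<^sub>c Tp (int (Suc j) - int n + int k) (D k v))"
      by (cases n) (simp_all add: cs.scale_sum_right algebra_simps binomial_eq_0)
    have "of_nat (Suc j) *\<^sub>c D n (Tp (int (Suc j)) v) = D n (tr (Tp (int j) v))"
      by (simp only: Tp_Suc[symmetric] clinear_simps[OF D(1)])
    also have "\<dots> = tr (D n (Tp (int j) v)) + of_nat n *\<^sub>c D (n - 1) (Tp (int j) v)"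
      by (simp add: D(2))
    also have "tr (D n (Tp (int j) v)) =
        (\<Sum>k\<le>n. (of_nat (n choose k) * of_int (int j - int n + int k + 1)) *\<^sub>c Tp (int (Suc j) - int n + int k) (D k v))"
      by (simp add: Suc.IH tr_simps tr_Tp algebra_simps)
    also have "of_nat n *\<^sub>c D (n - 1) (Tp (int j) v) =
        (\<Sum>k\<le>n. of_nat (n * (n - 1 choose k)) *\<^sub>c Tp (int (Suc j) - int n + int k) (D k v))"
      unfolding Suc.IH ext ..
    also have "(\<Sum>k\<le>n. (of_nat (n choose k) * of_int (int j - int n + int k + 1)) *\<^sub>c Tp (int (Suc j) - int n + int k) (D k v)) +
        (\<Sum>k\<le>n. of_nat (n * (n - 1 choose k)) *\<^sub>c Tp (int (Suc j) - int n + int k) (D k v)) =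
        (\<Sum>k\<le>n. (of_nat (Suc j) * of_nat (n choose k)) *\<^sub>c Tp (int (Suc j) - int n + int k) (D k v))"
      unfolding sum.distrib[symmetric] cs.scale_left_distrib[symmetric]
    proof (intro sum.cong refl arg_cong2[where f = cscale])
      fix k assume "k \<in> {..n}"
      then have "n * (n - 1 choose k) + k * (n choose k) = n * (n choose k)" using absorb by simp
      then have "of_nat (n * (n - 1 choose k)) + of_nat k * of_nat (n choose k) = (of_nat n * of_nat (n choose k) :: complex)"
        by (metis of_nat_add of_nat_mult)
      then show "of_nat (n choose k) * of_int (int j - int n + int k + 1) + of_nat (n * (n - 1 choose k)) =
          (of_nat (Suc j) * of_nat (n choose k) :: complex)"
        by (simp add: algebra_simps)
    qed
    finally show ?case
      unfolding cs.scale_scale[symmetric] cs.scale_sum_right[symmetric] by (rule Tp_eqI)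
  qed
qed

lemmas cc_Tp = mode_Tp[of cc, OF clinear_cc tr_cc]

section \<open>The supercommutative product\<close>

interpretation Fock: creation_module bb nn
  by unfold_locales (fact clinear_bb clinear_nn bb_bb bb_nn nn_nn)+

text \<open>Multiplication by \<open>|m\<rangle>\<close>.\<close>

definition shift :: "int \<Rightarrow> lattice_fock \<Rightarrow> lattice_fock" where
  "shift m = Fock.fock_rec (\<lambda>k. fock_ket (k + m))"

lemma clinear_shift: "clinear (shift m)"
  unfolding shift_def by (rule Fock.clinear_fock_rec)

lemma shift_rec: "shift m (fock_ket k) = fock_ket (k + m)" "shift m (bb n v) = bb n (shift m v)"
  "shift m (nn n v) = nn n (shift m v)"
  by (simp_all add: shift_def Fock.fock_rec_ket Fock.fock_rec_bb Fock.fock_rec_nn)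

text \<open>The supercommutative product for which \<open>b\<^sub>n\<close> and \<open>\<nu>\<^sub>n\<close> act as left multiplications and
  \<open>|m\<rangle> |k\<rangle> = |m + k\<rangle>\<close>.\<close>

definition mul :: "lattice_fock \<Rightarrow> lattice_fock \<Rightarrow> lattice_fock" where
  "mul a v = Fock.fock_rec (\<lambda>m. shift m v) a"

lemma clinear_mul_left: "clinear (\<lambda>a. mul a v)"
  unfolding mul_def by (rule Fock.clinear_fock_rec)

lemmas mul_left_simps = clinear_simps[OF clinear_mul_left]

lemma mul_rec: "mul (fock_ket m) v = shift m v" "mul (bb n a) v = bb n (mul a v)" "mul (nn n a) v = nn n (mul a v)"
  by (simp_all add: mul_def Fock.fock_rec_ket Fock.fock_rec_bb Fock.fock_rec_nn)

lemma clinear_mul_right: "clinear (mul a)"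
proof (rule clinearI)
  show "mul a (v + w) = mul a v + mul a w" for v w
    by (induction a rule: creation_induct)
      (simp_all add: mul_left_simps mul_rec clinear_simps[OF clinear_shift] creation_simps cs.scale_right_distrib algebra_simps)
  show "mul a (c *\<^sub>c v) = c *\<^sub>c mul a v" for c v
    by (induction a rule: creation_induct)
      (simp_all add: mul_left_simps mul_rec clinear_simps[OF clinear_shift] creation_simps cs.scale_right_distrib mult.commute)
qed

lemmas mul_simps = clinear_simps[OF clinear_mul_left] clinear_simps[OF clinear_mul_right]

lemma mul_1_right [simp]: "mul a (fock_ket 0) = a"
  by (induction a rule: creation_induct) (simp_all add: mul_simps mul_rec shift_rec)

lemma mul_1_left [simp]: "mul (fock_ket 0) v = v"
  unfolding mul_rec
  by (induction v rule: creation_induct) (simp_all add: clinear_simps[OF clinear_shift] shift_rec)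

lemma mul_assoc: "mul (mul a b) c = mul a (mul b c)"
proof (induction a rule: creation_induct)
  case (ket m)
  show ?case unfolding mul_rec
  proof (induction b rule: creation_induct)
    case (ket k)
    show ?case unfolding mul_rec shift_rec
      by (induction c rule: creation_induct)
        (simp_all add: clinear_simps[OF clinear_shift] shift_rec mul_rec ac_simps)
  qed (simp_all add: clinear_simps[OF clinear_shift] shift_rec mul_rec mul_simps)
qed (simp_all add: mul_simps mul_rec)

text \<open>Algebra automorphisms that multiply \<open>b\<^sub>n\<close> by \<open>l n\<close> and \<open>\<nu>\<^sub>n\<close> by \<open>k n\<close>.  Parity, cohomological degree and spin
  are read off from the scalings by \<open>(1, -1)\<close>, \<open>(1, 2)\<close> and \<open>(2\<^bsup>n+1\<^esup>, 2\<^bsup>n+1\<^esup>)\<close>.\<close>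

lemma scaled_creation_module: "creation_module (\<lambda>n v. l n *\<^sub>c bb n v) (\<lambda>n v. k n *\<^sub>c nn n v)"
proof
  fix n j x
  show "l n *\<^sub>c bb n (l j *\<^sub>c bb j x) = l j *\<^sub>c bb j (l n *\<^sub>c bb n x)"
    by (simp add: creation_simps bb_bb[of n] mult.commute)
  show "l n *\<^sub>c bb n (k j *\<^sub>c nn j x) = k j *\<^sub>c nn j (l n *\<^sub>c bb n x)"
    by (simp add: creation_simps bb_nn mult.commute)
  show "k n *\<^sub>c nn n (k j *\<^sub>c nn j x) = - (k j *\<^sub>c nn j (k n *\<^sub>c nn n x))"
    by (simp add: creation_simps nn_nn[of n] mult.commute)
qed (intro clinear_scale_fun clinear_bb clinear_nn)+

definition scal :: "(nat \<Rightarrow> complex) \<Rightarrow> (nat \<Rightarrow> complex) \<Rightarrow> lattice_fock \<Rightarrow> lattice_fock" where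
  "scal l k = creation_module.fock_rec (\<lambda>n v. l n *\<^sub>c bb n v) (\<lambda>n v. k n *\<^sub>c nn n v) fock_ket"

lemma clinear_scal: "clinear (scal l k)"
  unfolding scal_def by (rule creation_module.clinear_fock_rec[OF scaled_creation_module])

lemmas scal_simps = clinear_simps[OF clinear_scal]

lemma scal_rec: "scal l k (fock_ket m) = fock_ket m" "scal l k (bb n v) = l n *\<^sub>c bb n (scal l k v)"
  "scal l k (nn n v) = k n *\<^sub>c nn n (scal l k v)"
  unfolding scal_def
  by (simp_all add: creation_module.fock_rec_ket[OF scaled_creation_module]
      creation_module.fock_rec_bb[OF scaled_creation_module] creation_module.fock_rec_nn[OF scaled_creation_module])

lemma scal_mul: "scal l k (mul a v) = mul (scal l k a) (scal l k v)"
proof (induction a rule: creation_induct)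
  case (ket m)
  show ?case unfolding mul_rec scal_rec
    by (induction v rule: creation_induct)
      (simp_all add: clinear_simps[OF clinear_shift] shift_rec scal_simps scal_rec)
qed (simp_all add: mul_simps mul_rec scal_rec scal_simps)

lemma scal_tr:
  assumes "\<And>n. l (Suc n) = t * l n" "\<And>n. k (Suc n) = t * k n" "l 0 = t"
  shows "scal l k (tr v) = t *\<^sub>c tr (scal l k v)"
proof (induction v rule: creation_induct)
  case (add v w)
  then show ?case by (simp add: tr_simps scal_simps cs.scale_right_distrib)
next
  case (scale a v)
  then show ?case by (simp add: tr_simps scal_simps mult.commute)
qed (simp_all add: tr_ket tr_bb tr_nn tr_simps scal_simps scal_rec creation_simps assms mult.commute
    cs.scale_right_distrib del: of_nat_Suc)

lemma scal_cc:
  assumes "\<And>n. l n * l' (Suc n) = 1" "l' 0 = 1"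
  shows "scal l k (cc n v) = l' n *\<^sub>c cc n (scal l k v)"
proof (induction v arbitrary: n rule: creation_induct)
  case (add v w)
  then show ?case by (simp add: mode_simps scal_simps cs.scale_right_distrib)
next
  case (scale a v)
  then show ?case by (simp add: mode_simps scal_simps mult.commute)
next
  case (bb j v)
  show ?case
    by (cases "n = Suc j") (use assms(1)[of j] in \<open>simp_all add: annihilate bb mode_simps scal_simps scal_rec
      cs.scale_right_diff_distrib mult.commute mult.left_commute del: of_nat_Suc\<close>)
qed (simp_all add: annihilate mode_simps scal_simps scal_rec assms mult.commute)

lemma scal_dd:
  assumes "\<And>n. k n * k' n = 1"
  shows "scal l k (dd n v) = k' n *\<^sub>c dd n (scal l k v)"
proof (induction v arbitrary: n rule: creation_induct)
  case (add v w)
  then show ?case by (simp add: mode_simps scal_simps cs.scale_right_distrib)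
next
  case (scale a v)
  then show ?case by (simp add: mode_simps scal_simps mult.commute)
next
  case (nn j v)
  show ?case
    by (cases "n = j") (use assms[of j] in \<open>simp_all add: annihilate nn mode_simps scal_simps scal_rec
      cs.scale_right_distrib cs.scale_right_diff_distrib mult.commute mult.left_commute\<close>)
qed (simp_all add: annihilate mode_simps scal_simps scal_rec mult.commute)

definition par :: "lattice_fock \<Rightarrow> lattice_fock" where
  "par = scal (\<lambda>_. 1) (\<lambda>_. -1)"

lemma clinear_par: "clinear par"
  unfolding par_def by (rule clinear_scal)

lemmas par_simps = clinear_simps[OF clinear_par]

lemma par_rec: "par (fock_ket m) = fock_ket m" "par (bb n v) = bb n (par v)" "par (nn n v) = - nn n (par v)"
  by (simp_all add: par_def scal_rec)

lemma par_tr: "par (tr v) = tr (par v)"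
  unfolding par_def using scal_tr[of "\<lambda>_. 1" 1 "\<lambda>_. -1" v] by simp

lemma par_cc: "par (cc n v) = cc n (par v)"
  unfolding par_def using scal_cc[of "\<lambda>_. 1" "\<lambda>_. 1" "\<lambda>_. -1" n v] by simp

lemma par_dd: "par (dd n v) = - dd n (par v)"
  unfolding par_def using scal_dd[of "\<lambda>_. -1" "\<lambda>_. -1" "\<lambda>_. 1" n v] by simp

lemma par_Tp: "par (Tp r v) = Tp r (par v)"
proof -
  have "par ((tr ^^ n) v) = (tr ^^ n) (par v)" for n by (induction n) (simp_all add: par_tr)
  then show ?thesis by (simp add: Tp_def par_simps)
qed

text \<open>Only the parity of a degree enters the signs, so the algebra is developed for vectors of definite parity.\<close>

definition has_parity :: "int \<Rightarrow> lattice_fock \<Rightarrow> bool" where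
  "has_parity r v \<longleftrightarrow> par v = ksign r *\<^sub>c v"

lemma ksign_square [simp]: "ksign r * ksign r = 1"
  by (simp add: ksign_def)

lemma has_parity_cc: "has_parity r v \<Longrightarrow> has_parity r (cc n v)"
  and has_parity_dd: "has_parity r v \<Longrightarrow> has_parity (r - 1) (dd n v)"
  and has_parity_Tp: "has_parity r v \<Longrightarrow> has_parity r (Tp j v)"
  and has_parity_par: "has_parity r v \<Longrightarrow> has_parity r (par v)"
  by (simp_all add: has_parity_def par_cc par_dd par_Tp mode_simps Tp_simps par_simps
      mult.commute) (simp add: ksign_def)

lemma mul_bb: "mul a (bb n v) = bb n (mul a v)"
  by (induction a rule: creation_induct) (simp_all add: mul_simps mul_rec shift_rec creation_simps bb_bb[of n] bb_nn)

lemma mul_nn: "mul a (nn n v) = nn n (mul (par a) v)"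
  by (induction a rule: creation_induct)
    (simp_all add: mul_simps mul_rec shift_rec creation_simps nn_nn[of _ n] bb_nn par_simps par_rec)

lemma mul_ket: "mul v (fock_ket m) = shift m v"
  by (induction v rule: creation_induct)
    (simp_all add: mul_simps mul_rec shift_rec clinear_simps[OF clinear_shift] add.commute)

text \<open>For fixed \<open>v\<close> both sides satisfy the same recursion in \<open>a\<close>: \<open>\<nu>\<^sub>n\<close> passes \<open>v\<close> with the sign of the parity of \<open>v\<close>.\<close>

lemma mul_commute_aux:
  assumes "has_parity s v"
  shows "mul a v = (if even s then mul v a else mul v (par a))"
proof (induction a rule: creation_induct)
  case (nn n a)
  then show ?case using assms
    by (simp add: mul_rec mul_nn par_rec mul_simps creation_simps has_parity_def ksign_def split: if_splits)
qed (simp_all add: mul_simps mul_rec mul_ket mul_bb par_simps par_rec)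

lemma mul_commute:
  assumes "has_parity r a" "has_parity s v"
  shows "mul a v = ksign (r * s) *\<^sub>c mul v a"
  using mul_commute_aux[OF assms(2), of a] assms(1)
  by (auto simp: has_parity_def mul_simps ksign_def)

lemma mul_left_commute:
  assumes "has_parity r a" "has_parity s b"
  shows "mul a (mul b v) = ksign (r * s) *\<^sub>c mul b (mul a v)"
  using arg_cong[OF mul_commute[OF assms], of "\<lambda>x. mul x v"] by (simp add: mul_assoc mul_simps)

lemma tr_shift: "tr (shift m v) = mul (tr (fock_ket m)) v + shift m (tr v)"
proof (induction v rule: creation_induct)
  case (ket k)
  show ?case by (simp add: tr_ket mul_simps mul_rec shift_rec clinear_simps[OF clinear_shift]
    algebra_simps flip: cs.scale_left_distrib)
qed (simp_all add: tr_ket mul_simps mul_rec shift_rec clinear_simps[OF clinear_shift] tr_simps tr_bb tr_nn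
  creation_simps cs.scale_right_distrib cs.scale_right_diff_distrib bb_bb[of _ 0] bb_nn mult.commute)

lemma tr_mul: "tr (mul a v) = mul (tr a) v + mul a (tr v)"
proof (induction a rule: creation_induct)
  case (ket m)
  show ?case by (simp add: mul_rec tr_shift)
qed (simp_all add: mul_simps mul_rec tr_simps tr_bb tr_nn creation_simps cs.scale_right_distrib)

lemma cc_mul: "cc i (mul a v) = mul (cc i a) v + mul a (cc i v)"
proof (induction a rule: creation_induct)
  case (ket m)
  show ?case unfolding mul_rec
    by (induction v rule: creation_induct)
      (auto simp: mul_simps mul_rec shift_rec clinear_simps[OF clinear_shift] annihilate mode_simps
        cs.scale_right_distrib cs.scale_right_diff_distrib cs.scale_left_distrib mult.commute)
qed (auto simp: mul_simps mul_rec annihilate mode_simps cs.scale_right_distrib)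

lemma dd_mul: "dd i (mul a v) = mul (dd i a) v + mul (par a) (dd i v)"
proof (induction a rule: creation_induct)
  case (ket m)
  show ?case unfolding mul_rec par_rec
    by (induction v rule: creation_induct)
      (auto simp: mul_simps mul_rec shift_rec clinear_simps[OF clinear_shift] annihilate mode_simps)
qed (auto simp: mul_simps mul_rec annihilate mode_simps cs.scale_right_distrib par_simps par_rec)

text \<open>Integration by parts.  The sum times \<open>r = (r - p) + p\<close> splits into the same sum of lower order for \<open>T f\<close> and
  minus \<open>T\<close> of the sum of lower order for \<open>f\<close>; the Leibniz rule for \<open>T (f \<cdot> T\<^bsup>(r-1)\<^esup> g)\<close> then leaves one term.\<close>

lemma Tp_integration_by_parts:
  "(\<Sum>p\<le>r. (-1) ^ p *\<^sub>c Tp (int p) (mul (Tp (int (r - p)) f) g)) = (-1) ^ r *\<^sub>c mul f (Tp (int r) g)"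
proof (induction r arbitrary: f)
  case 0
  then show ?case by simp
next
  case (Suc r)
  let ?S = "\<Sum>p\<le>Suc r. (-1) ^ p *\<^sub>c Tp (int p) (mul (Tp (int (Suc r - p)) f) g)"
  let ?A = "\<Sum>p\<le>Suc r. (-1) ^ p *\<^sub>c (of_nat (Suc r - p) *\<^sub>c Tp (int p) (mul (Tp (int (Suc r - p)) f) g))"
  let ?B = "\<Sum>p\<le>Suc r. (-1) ^ p *\<^sub>c (of_nat p *\<^sub>c Tp (int p) (mul (Tp (int (Suc r - p)) f) g))"
  have "of_nat (Suc r) *\<^sub>c ?S = ?A + ?B"
    unfolding cs.scale_sum_right sum.distrib[symmetric]
  proof (rule sum.cong)
    fix p assume "p \<in> {..Suc r}"
    then have "(of_nat (Suc r) :: complex) = of_nat (Suc r - p) + of_nat p" by (simp add: of_nat_diff)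
    then show "of_nat (Suc r) *\<^sub>c ((-1) ^ p *\<^sub>c Tp (int p) (mul (Tp (int (Suc r - p)) f) g)) =
      (-1) ^ p *\<^sub>c (of_nat (Suc r - p) *\<^sub>c Tp (int p) (mul (Tp (int (Suc r - p)) f) g)) +
      (-1) ^ p *\<^sub>c (of_nat p *\<^sub>c Tp (int p) (mul (Tp (int (Suc r - p)) f) g))"
      by (simp only: cs.scale_left_distrib cs.scale_right_distrib cs.scale_left_commute)
  qed simp
  also have "?A = (\<Sum>p\<le>r. (-1) ^ p *\<^sub>c Tp (int p) (mul (Tp (int (r - p)) (tr f)) g))"
  proof -
    have *: "of_nat (Suc r - p) *\<^sub>c Tp (int p) (mul (Tp (int (Suc r - p)) f) g) =
        Tp (int p) (mul (Tp (int (r - p)) (tr f)) g)" if "p \<le> r" for p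
    proof -
      have "Tp (int (r - p)) (tr f) = of_nat (Suc r - p) *\<^sub>c Tp (int (Suc r - p)) f"
        using that by (simp add: Tp_tr Suc_diff_le add.commute)
      then show ?thesis by (simp only: mul_simps Tp_simps)
    qed
    have "?A = (\<Sum>p\<le>r. (-1) ^ p *\<^sub>c (of_nat (Suc r - p) *\<^sub>c Tp (int p) (mul (Tp (int (Suc r - p)) f) g)))"
      by (simp only: sum.atMost_Suc diff_self_eq_0 of_nat_0 cs.scale_zero_left cs.scale_zero_right add_0_right)
    also have "\<dots> = (\<Sum>p\<le>r. (-1) ^ p *\<^sub>c Tp (int p) (mul (Tp (int (r - p)) (tr f)) g))"
      by (rule sum.cong) (simp_all only: atMost_iff *)
    finally show ?thesis .
  qed
  also have "\<dots> = (-1) ^ r *\<^sub>c mul (tr f) (Tp (int r) g)" by (rule Suc)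
  also have "?B = - tr (\<Sum>p\<le>r. (-1) ^ p *\<^sub>c Tp (int p) (mul (Tp (int (r - p)) f) g))"
    unfolding sum.atMost_Suc_shift
    by (simp add: tr_simps tr_Tp add.commute sum_negf[symmetric])
  also have "\<dots> = - ((-1) ^ r *\<^sub>c tr (mul f (Tp (int r) g)))"
    by (simp only: Suc tr_simps)
  also have "tr (mul f (Tp (int r) g)) = mul (tr f) (Tp (int r) g) + of_nat (Suc r) *\<^sub>c mul f (Tp (int (Suc r)) g)"
    by (simp add: tr_mul tr_Tp mul_simps add.commute)
  finally have "of_nat (Suc r) *\<^sub>c ?S = of_nat (Suc r) *\<^sub>c ((-1) ^ Suc r *\<^sub>c mul f (Tp (int (Suc r)) g))"
    by (simp add: cs.scale_right_distrib mult.commute del: of_nat_Suc)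
  then show ?case by (rule Tp_eqI)
qed

section \<open>The brackets\<close>

text \<open>The singular part of the field of \<open>a\<close> is the sum over \<open>i\<close> of \<open>(\<partial>a/\<partial>x\<^sub>i)(z)\<close> times \<open>\<partial>\<^sub>z\<^sup>i/i!\<close> of the singular part
  \<open>\<Sum> \<Omega>\<^sub>z\<^sup>m \<partial>/\<partial>\<nu>\<^sub>m\<close> of \<open>x(z)\<close>, and of \<open>(\<partial>a/\<partial>\<nu>\<^sub>i)(z)\<close> times \<open>\<partial>\<^sub>z\<^sup>i/i!\<close> of the singular part \<open>\<Sum> \<Omega>\<^sub>z\<^sup>m \<partial>/\<partial>x\<^sub>m\<close> of
  \<open>\<nu>(z)\<close>.  As \<open>\<partial>\<^sub>z\<^sup>i/i! \<Omega>\<^sub>z\<^sup>m = (-1)\<^sup>i (m+i choose i) \<Omega>\<^sub>z\<^bsup>m+i\<^esup>\<close> and \<open>z\<^sup>j \<Omega>\<^sub>z\<^sup>m = \<Omega>\<^sub>z\<^bsup>m-j\<^esup>\<close>, the coefficient of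
  \<open>\<Omega>\<^sub>z\<^sup>n\<close> is the operator \<open>br n a\<close> below.  The parity automorphism is the sign of moving \<open>\<Omega>\<close> past \<open>\<partial>a/\<partial>x\<^sub>i\<close>; for
  \<open>\<partial>a/\<partial>\<nu>\<^sub>i\<close> that sign turns the right derivative into the left one.\<close>

definition bcoef :: "nat \<Rightarrow> nat \<Rightarrow> complex" where
  "bcoef m i = (-1) ^ i * of_nat (m + i choose i)"

definition brt :: "int \<Rightarrow> nat \<Rightarrow> nat \<Rightarrow> lattice_fock \<Rightarrow> lattice_fock \<Rightarrow> lattice_fock" where
  "brt r i m a v = mul (Tp r (cc i (par a))) (dd m v) + mul (Tp r (dd i a)) (cc m v)"

definition br :: "int \<Rightarrow> lattice_fock \<Rightarrow> lattice_fock \<Rightarrow> lattice_fock" where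
  "br n a v = (\<Sum>i<ann_bound a. \<Sum>m<ann_bound v. bcoef m i *\<^sub>c brt (int m + int i - n) i m a v)"

lemma brt_ann:
  "ann N a \<Longrightarrow> i \<ge> N \<Longrightarrow> brt r i m a v = 0" "ann N v \<Longrightarrow> m \<ge> N \<Longrightarrow> brt r i m a v = 0"
  by (simp_all add: brt_def annD par_cc[symmetric] par_simps Tp_simps mul_simps)

lemma brt_linear_left: "clinear (\<lambda>a. brt r i m a v)" and brt_linear_right: "clinear (brt r i m a)"
  by (auto simp: clinear_def brt_def mode_simps par_simps Tp_simps mul_simps cs.scale_right_distrib)

lemma br_eq:
  assumes "ann N a" "ann M v"
  shows "br n a v = (\<Sum>i<N. \<Sum>m<M. bcoef m i *\<^sub>c brt (int m + int i - n) i m a v)"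
proof -
  have inner: "(\<Sum>m<ann_bound v. bcoef m i *\<^sub>c brt (int m + int i - n) i m a v) =
      (\<Sum>m<M. bcoef m i *\<^sub>c brt (int m + int i - n) i m a v)" for i
    by (rule sum.mono_neutral_cong) (auto simp: not_less brt_ann(2)[OF assms(2)] brt_ann(2)[OF ann_bound])
  show ?thesis
    unfolding br_def inner
    by (rule sum.mono_neutral_cong) (auto simp: not_less brt_ann(1)[OF assms(1)] brt_ann(1)[OF ann_bound])
qed

lemma clinear_br_left: "clinear (\<lambda>a. br n a v)"
proof (rule clinearI)
  fix a b
  obtain N where N: "\<forall>u\<in>{a, b, a + b, v}. ann N u" using ann_common[of "{a, b, a + b, v}" 0] by auto
  then show "br n (a + b) v = br n a v + br n b v"
    by (simp add: br_eq[of N _ N] clinear_simps[OF brt_linear_left] cs.scale_right_distrib sum.distrib)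
next
  fix c a
  obtain N where N: "\<forall>u\<in>{a, c *\<^sub>c a, v}. ann N u" using ann_common[of "{a, c *\<^sub>c a, v}" 0] by auto
  then show "br n (c *\<^sub>c a) v = c *\<^sub>c br n a v"
    by (simp add: br_eq[of N _ N] clinear_simps[OF brt_linear_left] cs.scale_sum_right mult.commute)
qed

lemma clinear_br_right: "clinear (br n a)"
proof (rule clinearI)
  fix v w
  obtain N where N: "\<forall>u\<in>{a, v, w, v + w}. ann N u" using ann_common[of "{a, v, w, v + w}" 0] by auto
  then show "br n a (v + w) = br n a v + br n a w"
    by (simp add: br_eq[of N _ N] clinear_simps[OF brt_linear_right] cs.scale_right_distrib sum.distrib)
next
  fix c v
  obtain N where N: "\<forall>u\<in>{a, v, c *\<^sub>c v}. ann N u" using ann_common[of "{a, v, c *\<^sub>c v}" 0] by auto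
  then show "br n a (c *\<^sub>c v) = c *\<^sub>c br n a v"
    by (simp add: br_eq[of N _ N] clinear_simps[OF brt_linear_right] cs.scale_sum_right mult.commute)
qed

lemmas br_simps = clinear_simps[OF clinear_br_left] clinear_simps[OF clinear_br_right]

lemma br_high:
  assumes "ann N a" "ann N v" "n \<ge> 2 * int N"
  shows "br n a v = 0"
  unfolding br_eq[OF assms(1,2)]
proof (intro sum.neutral ballI)
  fix i m assume "i \<in> {..<N}" "m \<in> {..<N}"
  then have "int m + int i - n < 0" using assms(3) by simp
  then show "bcoef m i *\<^sub>c brt (int m + int i - n) i m a v = 0" by (simp add: brt_def mul_simps)
qed

lemma tr_brt: "tr (brt r i m a v) =
    of_int (r + 1) *\<^sub>c brt (r + 1) i m a v + brt r i m a (tr v) - of_nat m *\<^sub>c brt r i (m - 1) a v"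
  by (simp add: brt_def tr_simps tr_mul tr_Tp tr_cc tr_dd mul_simps cs.scale_right_distrib algebra_simps)

text \<open>\<open>T\<close> raises the order of the left factor and lowers the index of the derivative; after an index shift the two
  contributions combine by \<open>(m+1) (m+1+i choose i) = (m+1+i) (m+i choose i)\<close>.\<close>

lemma tr_br: "tr (br n a v) = br n a (tr v) - of_int n *\<^sub>c br (n - 1) a v"
proof -
  obtain N where "\<forall>u\<in>{a, v, tr v}. ann N u" using ann_common[of "{a, v, tr v}" 0] by auto
  then have N: "ann N a" "ann N v" "ann (Suc N) v" "ann (Suc N) (tr v)" by (auto intro: ann_mono)
  have absorb: "of_nat (Suc m) * bcoef (Suc m) i = of_nat (Suc m + i) * bcoef m i" for m i
  proof -
    have "Suc m * (Suc m + i choose i) = (Suc m + i) * (m + i choose i)"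
      using binomial_absorb_comp[of "Suc m + i" i] by simp
    then have "of_nat (Suc m) * of_nat (Suc m + i choose i) = (of_nat (Suc m + i) * of_nat (m + i choose i) :: complex)"
      by (metis of_nat_mult)
    then show ?thesis by (simp only: bcoef_def mult.left_commute[of _ "(- 1) ^ i"])
  qed
  have inner: "(\<Sum>m<Suc N. bcoef m i *\<^sub>c (of_int (int m + int i - n + 1) *\<^sub>c brt (int m + int i - n + 1) i m a v -
        of_nat m *\<^sub>c brt (int m + int i - n) i (m - 1) a v)) =
      (\<Sum>m<N. (- of_int n * bcoef m i) *\<^sub>c brt (int m + int i - (n - 1)) i m a v)" for i
  proof -
    have 1: "(\<Sum>m<Suc N. bcoef m i *\<^sub>c (of_int (int m + int i - n + 1) *\<^sub>c brt (int m + int i - n + 1) i m a v)) =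
        (\<Sum>m<N. (of_int (int m + int i - n + 1) * bcoef m i) *\<^sub>c brt (int m + int i - n + 1) i m a v)"
      by (simp add: brt_ann(2)[OF N(2)] mult.commute)
    have 2: "(\<Sum>m<Suc N. bcoef m i *\<^sub>c (of_nat m *\<^sub>c brt (int m + int i - n) i (m - 1) a v)) =
        (\<Sum>m<N. (of_nat (Suc m) * bcoef (Suc m) i) *\<^sub>c brt (int m + int i - n + 1) i m a v)"
      unfolding sum.lessThan_Suc_shift by (simp add: algebra_simps)
    show ?thesis
      unfolding cs.scale_right_diff_distrib sum_subtractf 1 2 absorb
      unfolding sum_subtractf[symmetric] cs.scale_left_diff_distrib[symmetric]
      by (rule sum.cong) (simp_all add: algebra_simps)
  qed
  have "tr (br n a v) - br n a (tr v) =
      (\<Sum>i<N. \<Sum>m<Suc N. bcoef m i *\<^sub>c (of_int (int m + int i - n + 1) *\<^sub>c brt (int m + int i - n + 1) i m a v -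
        of_nat m *\<^sub>c brt (int m + int i - n) i (m - 1) a v))"
    unfolding br_eq[OF N(1,3)] br_eq[OF N(1,4)] tr_simps tr_brt sum_subtractf[symmetric]
      cs.scale_right_diff_distrib[symmetric]
    by (intro sum.cong refl arg_cong2[where f = cscale]) simp
  also have "\<dots> = - (of_int n *\<^sub>c br (n - 1) a v)"
    unfolding inner br_eq[OF N(1,2)] cs.scale_sum_right by (simp add: sum_negf)
  finally show ?thesis by (simp add: algebra_simps)
qed

lemma br_Tp: "br (int n) a (Tp r v) = (\<Sum>k\<le>n. of_nat (n choose k) *\<^sub>c Tp (r - int n + int k) (br (int k) a v))"
proof (rule mode_Tp[of "\<lambda>n. br (int n) a"])
  show "tr (br (int n) a v) = br (int n) a (tr v) - of_nat n *\<^sub>c br (int (n - 1)) a v" for n v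
    by (cases n) (simp_all add: tr_br)
qed (rule clinear_br_right)

text \<open>Brackets are combinations of the derivations \<open>\<partial>/\<partial>x\<^sub>m\<close> and \<open>\<partial>/\<partial>\<nu>\<^sub>m\<close> with coefficients from the algebra, so
  they satisfy the Leibniz rule, with parity one less than that of \<open>a\<close>.\<close>

lemma br_mul:
  assumes a: "has_parity r a" and f: "has_parity s f"
  shows "br n a (mul f v) = mul (br n a f) v + ksign ((r - 1) * s) *\<^sub>c mul f (br n a v)"
proof -
  obtain N where N: "ann N a" "ann N f" "ann N v" "ann N (mul f v)"
    using ann_common[of "{a, f, v, mul f v}" 0] by auto
  have "brt q i m a (mul f v) = mul (brt q i m a f) v + ksign ((r - 1) * s) *\<^sub>c mul f (brt q i m a v)" for q i m
  proof -
    have "has_parity r (Tp q (cc i (par a)))" "has_parity (r - 1) (Tp q (dd i a))"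
      by (intro has_parity_Tp has_parity_cc has_parity_dd has_parity_par a)+
    note comm = mul_left_commute[OF this(1) f] mul_left_commute[OF this(2) f]
    have "par f = ksign s *\<^sub>c f" using f by (simp add: has_parity_def)
    moreover have "ksign (r * s) * ksign s = ksign ((r - 1) * s)"
      by (simp add: ksign_def)
    ultimately show ?thesis
      by (simp add: brt_def cc_mul dd_mul mul_simps mul_assoc comm cs.scale_right_distrib mult.commute)
  qed
  then show ?thesis
    by (simp add: br_eq[OF N(1,2)] br_eq[OF N(1,3)] br_eq[OF N(1,4)] mul_simps cs.scale_right_distrib sum.distrib
        cs.scale_sum_right mult.commute)
qed

lemma integration_by_parts_long:
  assumes "int P > R"
  shows "(\<Sum>p<P. (-1) ^ p *\<^sub>c Tp (int p) (mul (Tp (R - int p) f) g)) = (-1) ^ nat R *\<^sub>c mul f (Tp R g)"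
proof (cases "R < 0")
  case True
  then show ?thesis by (simp add: mul_simps Tp_simps)
next
  case False
  then obtain r where R: "R = int r" by (metis nonneg_int_cases not_less)
  have "(\<Sum>p<P. (-1) ^ p *\<^sub>c Tp (int p) (mul (Tp (R - int p) f) g)) =
      (\<Sum>p\<le>r. (-1) ^ p *\<^sub>c Tp (int p) (mul (Tp (int (r - p)) f) g))"
    by (rule sum.mono_neutral_cong_right) (use assms in \<open>auto simp: R mul_simps Tp_simps of_nat_diff\<close>)
  then show ?thesis unfolding Tp_integration_by_parts by (simp only: R nat_int)
qed

text \<open>Skew symmetry.  Either bracket pairs a derivative of \<open>a\<close> with the dual derivative of \<open>b\<close>; they differ in
  which of the two factors carries the powers of \<open>T\<close>, and integration by parts moves these across.\<close>

lemma br_skew: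
  assumes a: "has_parity r a" and b: "has_parity s b" and N: "ann N a" "ann N b" "P \<ge> 2 * N"
  shows "br (int n) b a = ksign (r * s) *\<^sub>c (\<Sum>p<P. (-1) ^ (n + p) *\<^sub>c Tp (int p) (br (int (n + p)) a b))"
proof -
  have each: "(\<Sum>p<P. ((-1) ^ (n + p) * bcoef m i) *\<^sub>c Tp (int p) (brt (int m + int i - int (n + p)) i m a b)) =
      (ksign (r * s) * bcoef i m) *\<^sub>c brt (int i + int m - int n) m i b a"
    if "i < N" "m < N" for i m
  proof -
    define R where "R = int m + int i - int n"
    have R: "int P > R" using that N(3) by (simp add: R_def)
    have "(\<Sum>p<P. ((-1) ^ (n + p) * bcoef m i) *\<^sub>c Tp (int p) (brt (int m + int i - int (n + p)) i m a b)) =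
        ((-1) ^ n * bcoef m i) *\<^sub>c
          ((\<Sum>p<P. (-1) ^ p *\<^sub>c Tp (int p) (mul (Tp (R - int p) (cc i (par a))) (dd m b))) +
           (\<Sum>p<P. (-1) ^ p *\<^sub>c Tp (int p) (mul (Tp (R - int p) (dd i a)) (cc m b))))"
      unfolding sum.distrib[symmetric] cs.scale_sum_right
      by (rule sum.cong) (simp_all add: brt_def Tp_simps cs.scale_right_distrib power_add R_def algebra_simps)
    also have "\<dots> = ((-1) ^ n * bcoef m i * (-1) ^ nat R) *\<^sub>c
        (mul (cc i (par a)) (Tp R (dd m b)) + mul (dd i a) (Tp R (cc m b)))"
      by (simp add: integration_by_parts_long[OF R] cs.scale_right_distrib)
    also have "\<dots> = bcoef i m *\<^sub>c (mul (cc i (par a)) (Tp R (dd m b)) + mul (dd i a) (Tp R (cc m b)))"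
    proof (cases "R < 0")
      case False
      then have "nat R + n = m + i" by (simp add: R_def)
      then have "(-1 :: complex) ^ n * (-1) ^ nat R = (-1) ^ (m + i)" by (metis add.commute power_add)
      then have "(-1) ^ n * bcoef m i * (-1) ^ nat R = (-1) ^ (m + i) * bcoef m i" by (simp add: mult.commute mult.left_commute)
      also have "\<dots> = bcoef i m"
      proof -
        have "(-1 :: complex) ^ (m + i) * (-1) ^ i = (-1) ^ m"
          by (simp add: power_add mult.assoc flip: power_mult_distrib)
        moreover have "i + m choose m = m + i choose i"
          using binomial_symmetric[of i "m + i"] by (simp add: add.commute)
        ultimately show ?thesis by (simp only: bcoef_def mult.assoc[symmetric])
      qed
      finally show ?thesis by simp
    qed (simp add: mul_simps)
    also have "mul (cc i (par a)) (Tp R (dd m b)) = ksign (r * s) *\<^sub>c mul (Tp R (dd m b)) (cc i a)"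
    proof -
      have "par a = ksign r *\<^sub>c a" using a by (simp add: has_parity_def)
      then have "mul (cc i (par a)) (Tp R (dd m b)) = ksign r *\<^sub>c mul (cc i a) (Tp R (dd m b))"
        by (simp add: mode_simps mul_simps)
      also have "mul (cc i a) (Tp R (dd m b)) = ksign (r * (s - 1)) *\<^sub>c mul (Tp R (dd m b)) (cc i a)"
        by (intro mul_commute has_parity_cc has_parity_dd has_parity_Tp a b)
      finally show ?thesis by (simp add: ksign_def split: if_splits)
    qed
    also have "mul (dd i a) (Tp R (cc m b)) = ksign (r * s) *\<^sub>c mul (Tp R (cc m (par b))) (dd i a)"
    proof -
      have "par b = ksign s *\<^sub>c b" using b by (simp add: has_parity_def)
      then have "mul (Tp R (cc m (par b))) (dd i a) = ksign s *\<^sub>c mul (Tp R (cc m b)) (dd i a)"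
        by (simp add: mode_simps mul_simps Tp_simps)
      moreover have "mul (dd i a) (Tp R (cc m b)) = ksign ((r - 1) * s) *\<^sub>c mul (Tp R (cc m b)) (dd i a)"
        by (intro mul_commute has_parity_cc has_parity_dd has_parity_Tp a b)
      ultimately show ?thesis by (simp add: ksign_def split: if_splits)
    qed
    finally show ?thesis
      by (simp add: brt_def R_def cs.scale_right_distrib add.commute mult.commute)
  qed
  have "(\<Sum>p<P. (-1) ^ (n + p) *\<^sub>c Tp (int p) (br (int (n + p)) a b)) =
      (\<Sum>i<N. \<Sum>m<N. \<Sum>p<P. ((-1) ^ (n + p) * bcoef m i) *\<^sub>c Tp (int p) (brt (int m + int i - int (n + p)) i m a b))"
    unfolding br_eq[OF N(1,2)] Tp_simps cs.scale_sum_right cs.scale_scale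
    by (subst sum.swap, rule sum.cong[OF refl], subst sum.swap) simp
  also have "\<dots> = (\<Sum>i<N. \<Sum>m<N. (ksign (r * s) * bcoef i m) *\<^sub>c brt (int i + int m - int n) m i b a)"
    by (intro sum.cong refl each) simp_all
  also have "\<dots> = ksign (r * s) *\<^sub>c br (int n) b a"
    unfolding br_eq[OF N(2,1)] cs.scale_sum_right cs.scale_scale by (rule sum.swap)
  finally show ?thesis by simp
qed

text \<open>The brackets of \<open>b\<close> with \<open>T\<^sup>j a / j!\<close> in terms of those of \<open>a\<close> with \<open>b\<close>: after skew symmetry, the coefficients
  sum up by the Vandermonde identity.  They are those of the second expansion of \<open>\<Omega>\<^bsub>z-w\<^esub>\<^sup>k\<close>.\<close>

lemma br_Tp_skew:
  assumes a: "has_parity r a" and b: "has_parity s b" and N: "ann N a" "ann N b" "K \<ge> 2 * N"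
  shows "br (int n) b (Tp (int j) a) = ksign (r * s) *\<^sub>c
    (\<Sum>k<K. ((-1) ^ k * of_nat (k + j choose k)) *\<^sub>c Tp (int k + int j - int n) (br (int k) a b))"
proof -
  define J where "J k = nat (int j - int n + int k)" for k
  define g where "g i k = (of_nat (n choose i) * ((-1) ^ k * of_nat (J k choose (k - i)))) *\<^sub>c
      Tp (int k + int j - int n) (br (int k) a b)" for i k :: nat
  have g0: "g i k = 0" if "k \<ge> K" for i k
  proof -
    have "br (int k) a b = 0" using that N(3) by (intro br_high[OF N(1,2)]) simp
    then show ?thesis by (simp add: g_def Tp_simps)
  qed
  have "br (int n) b (Tp (int j) a) =
      (\<Sum>i\<le>n. of_nat (n choose i) *\<^sub>c Tp (int j - int n + int i) (ksign (r * s) *\<^sub>c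
        (\<Sum>p<K. (-1) ^ (i + p) *\<^sub>c Tp (int p) (br (int (i + p)) a b))))"
    unfolding br_Tp br_skew[OF a b N] ..
  also have "\<dots> = ksign (r * s) *\<^sub>c (\<Sum>i\<le>n. \<Sum>p<K. g i (i + p))"
    unfolding Tp_simps Tp_Tp cs.scale_sum_right cs.scale_scale
    by (intro sum.cong refl) (simp add: g_def J_def algebra_simps)
  also have "(\<Sum>i\<le>n. \<Sum>p<K. g i (i + p)) = (\<Sum>i\<le>n. \<Sum>k<K. if i \<le> k then g i k else 0)"
  proof (rule sum.cong[OF refl])
    fix i
    have "(\<Sum>p<K. g i (i + p)) = (\<Sum>k\<in>{i..<i + K}. g i k)"
      by (rule sum.reindex_bij_witness[of _ "\<lambda>k. k - i" "\<lambda>p. i + p"]) auto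
    also have "\<dots> = (\<Sum>k<K. if i \<le> k then g i k else 0)"
      by (rule sum.mono_neutral_cong) (auto simp: g0)
    finally show "(\<Sum>p<K. g i (i + p)) = (\<Sum>k<K. if i \<le> k then g i k else 0)" .
  qed
  also have "\<dots> = (\<Sum>k<K. \<Sum>i\<le>n. if i \<le> k then g i k else 0)" by (rule sum.swap)
  also have "\<dots> = (\<Sum>k<K. ((-1) ^ k * of_nat (k + j choose k)) *\<^sub>c Tp (int k + int j - int n) (br (int k) a b))"
  proof (rule sum.cong[OF refl])
    fix k
    let ?x = "Tp (int k + int j - int n) (br (int k) a b)"
    have "(\<Sum>i\<le>n. if i \<le> k then g i k else 0) = (\<Sum>i\<le>k. g i k)"
      by (rule sum.mono_neutral_cong) (auto simp: g_def binomial_eq_0)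
    also have "\<dots> = ((-1) ^ k * of_nat (\<Sum>i\<le>k. (n choose i) * (J k choose (k - i)))) *\<^sub>c ?x"
      unfolding g_def cs.scale_sum_left[symmetric] of_nat_sum sum_distrib_left
      by (intro arg_cong2[where f = cscale] sum.cong refl) simp
    also have "\<dots> = ((-1) ^ k * of_nat (k + j choose k)) *\<^sub>c ?x"
    proof (cases "int k + int j - int n < 0")
      case False
      then have "n + J k = k + j" by (simp add: J_def)
      then show ?thesis by (simp add: vandermonde)
    qed simp
    finally show "(\<Sum>i\<le>n. if i \<le> k then g i k else 0) = ((-1) ^ k * of_nat (k + j choose k)) *\<^sub>c ?x" .
  qed
  finally show ?thesis .
qed

text \<open>The commutator of two brackets.  The terms of second order cancel, and what remains is a sum of
  two expressions of the form \<open>\<Sum>\<^sub>k (m choose k) G\<^sub>k(m + n - k)\<close>, one of them with \<open>m\<close> and \<open>n\<close> exchanged.\<close>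

definition br_first_order ::
    "lattice_fock \<Rightarrow> lattice_fock \<Rightarrow> nat \<Rightarrow> nat \<Rightarrow> lattice_fock \<Rightarrow> nat \<Rightarrow> int \<Rightarrow> lattice_fock" where
  "br_first_order a b N M v k l = (\<Sum>j<N. \<Sum>q<M. bcoef q j *\<^sub>c
     (mul (Tp (int q + int j - l) (br (int k) a (cc j (par b)))) (dd q v) +
      mul (Tp (int q + int j - l) (br (int k) a (dd j b))) (cc q v)))"

lemma ann_par: "ann N v \<Longrightarrow> ann N (par v)"
  using par_cc[of _ v] par_dd[of _ v] by (auto simp: ann_def par_simps simp flip: par_cc)
    (metis par_dd neg_equal_0_iff_equal clinear_0[OF clinear_par])

lemma br_br_split:
  assumes a: "has_parity r a" and b: "has_parity s b" and N: "ann N a" "ann N b" "ann M v" and K: "K \<ge> 2 * N"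
  shows "br (int m) a (br (int n) b v) =
    (\<Sum>k<K. of_nat (m choose k) *\<^sub>c br_first_order a b N M v k (int m + int n - int k)) +
    (\<Sum>j<N. \<Sum>q<M. bcoef q j *\<^sub>c
      (ksign ((r - 1) * s) *\<^sub>c mul (Tp (int q + int j - int n) (cc j (par b))) (br (int m) a (dd q v)) +
       ksign ((r - 1) * (s - 1)) *\<^sub>c mul (Tp (int q + int j - int n) (dd j b)) (br (int m) a (cc q v))))"
proof -
  have T: "br (int m) a (Tp u y) = (\<Sum>k<K. of_nat (m choose k) *\<^sub>c Tp (u - int m + int k) (br (int k) a y))"
    if "ann N y" for u y
  proof -
    have "br (int k) a y = 0" if "k \<ge> K" for k
      using that K by (intro br_high[OF N(1) \<open>ann N y\<close>]) simp
    then show ?thesis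
      unfolding br_Tp by (intro sum.mono_neutral_cong) (auto simp: binomial_eq_0 Tp_simps)
  qed
  have "br (int m) a (br (int n) b v) = (\<Sum>j<N. \<Sum>q<M. bcoef q j *\<^sub>c
      ((mul (br (int m) a (Tp (int q + int j - int n) (cc j (par b)))) (dd q v) +
        mul (br (int m) a (Tp (int q + int j - int n) (dd j b))) (cc q v)) +
       (ksign ((r - 1) * s) *\<^sub>c mul (Tp (int q + int j - int n) (cc j (par b))) (br (int m) a (dd q v)) +
        ksign ((r - 1) * (s - 1)) *\<^sub>c mul (Tp (int q + int j - int n) (dd j b)) (br (int m) a (cc q v)))))"
  proof -
    have 1: "has_parity s (Tp u (cc j (par b)))" and 2: "has_parity (s - 1) (Tp u (dd j b))" for u j
      by (intro has_parity_Tp has_parity_cc has_parity_dd has_parity_par b)+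
    show ?thesis
      unfolding br_eq[OF N(2,3), of "int n"] br_simps brt_def br_mul[OF a 1] br_mul[OF a 2]
      by (intro sum.cong refl arg_cong2[where f = cscale]) (simp only: ac_simps)
  qed
  also have "\<dots> = (\<Sum>j<N. \<Sum>q<M. bcoef q j *\<^sub>c
      (mul (br (int m) a (Tp (int q + int j - int n) (cc j (par b)))) (dd q v) +
        mul (br (int m) a (Tp (int q + int j - int n) (dd j b))) (cc q v))) + (\<Sum>j<N. \<Sum>q<M. bcoef q j *\<^sub>c
       (ksign ((r - 1) * s) *\<^sub>c mul (Tp (int q + int j - int n) (cc j (par b))) (br (int m) a (dd q v)) +
        ksign ((r - 1) * (s - 1)) *\<^sub>c mul (Tp (int q + int j - int n) (dd j b)) (br (int m) a (cc q v))))"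
    by (subst cs.scale_right_distrib) (simp only: sum.distrib)
  also have "(\<Sum>j<N. \<Sum>q<M. bcoef q j *\<^sub>c
      (mul (br (int m) a (Tp (int q + int j - int n) (cc j (par b)))) (dd q v) +
        mul (br (int m) a (Tp (int q + int j - int n) (dd j b))) (cc q v))) =
      (\<Sum>j<N. \<Sum>q<M. \<Sum>k<K. of_nat (m choose k) *\<^sub>c (bcoef q j *\<^sub>c
       (mul (Tp (int q + int j - (int m + int n - int k)) (br (int k) a (cc j (par b)))) (dd q v) +
        mul (Tp (int q + int j - (int m + int n - int k)) (br (int k) a (dd j b))) (cc q v))))"
    unfolding T[OF ann_cc[OF ann_par[OF N(2)]]] T[OF ann_dd[OF N(2)]] mul_simps sum.distrib[symmetric]
      cs.scale_sum_right
    by (intro sum.cong refl) (simp add: cs.scale_right_distrib algebra_simps)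
  also have "\<dots> = (\<Sum>k<K. of_nat (m choose k) *\<^sub>c br_first_order a b N M v k (int m + int n - int k))"
    unfolding br_first_order_def cs.scale_sum_right
    by (subst sum.swap, subst (2) sum.swap, subst sum.swap, rule sum.cong[OF refl], rule sum.swap)
  finally show ?thesis .
qed

text \<open>Terms in which both brackets differentiate \<open>v\<close> are symmetric in the two brackets: the coefficients and the
  derivatives supercommute separately.\<close>

lemma br_second_order:
  assumes a: "has_parity r a" and b: "has_parity s b" and N: "ann N a" "ann N b" "ann M v"
  shows "(\<Sum>j<N. \<Sum>q<M. bcoef q j *\<^sub>c
      (ksign ((r - 1) * s) *\<^sub>c mul (Tp (int q + int j - n) (cc j (par b))) (br m a (dd q v)) +
       ksign ((r - 1) * (s - 1)) *\<^sub>c mul (Tp (int q + int j - n) (dd j b)) (br m a (cc q v)))) =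
    ksign ((r - 1) * (s - 1)) *\<^sub>c (\<Sum>i<N. \<Sum>p<M. bcoef p i *\<^sub>c
      (ksign ((s - 1) * r) *\<^sub>c mul (Tp (int p + int i - m) (cc i (par a))) (br n b (dd p v)) +
       ksign ((s - 1) * (r - 1)) *\<^sub>c mul (Tp (int p + int i - m) (dd i a)) (br n b (cc p v))))"
    (is "?L = ?R")
proof -
  let ?l = "\<lambda>j q i p. (bcoef q j * bcoef p i) *\<^sub>c
      (ksign ((r - 1) * s) *\<^sub>c mul (Tp (int q + int j - n) (cc j (par b))) (brt (int p + int i - m) i p a (dd q v)) +
       ksign ((r - 1) * (s - 1)) *\<^sub>c mul (Tp (int q + int j - n) (dd j b)) (brt (int p + int i - m) i p a (cc q v)))"
  let ?r = "\<lambda>i p j q. (bcoef p i * bcoef q j) *\<^sub>c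
      (ksign ((s - 1) * r) *\<^sub>c mul (Tp (int p + int i - m) (cc i (par a))) (brt (int q + int j - n) j q b (dd p v)) +
       ksign ((s - 1) * (r - 1)) *\<^sub>c mul (Tp (int p + int i - m) (dd i a)) (brt (int q + int j - n) j q b (cc p v)))"
  have pointwise: "?l j q i p = ksign ((r - 1) * (s - 1)) *\<^sub>c ?r i p j q" for j q i p
  proof -
    define A A' B B' where AB: "A = Tp (int p + int i - m) (cc i a)" "A' = Tp (int p + int i - m) (dd i a)"
      "B = Tp (int q + int j - n) (cc j b)" "B' = Tp (int q + int j - n) (dd j b)"
    have pa: "par a = ksign r *\<^sub>c a" "par b = ksign s *\<^sub>c b" using a b by (simp_all add: has_parity_def)
    have hp: "has_parity r A" "has_parity (r - 1) A'" "has_parity s B" "has_parity (s - 1) B'"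
      unfolding AB by (intro has_parity_Tp has_parity_cc has_parity_dd a b)+
    note comm = mul_left_commute[OF hp(3) hp(1)] mul_left_commute[OF hp(3) hp(2)]
      mul_left_commute[OF hp(4) hp(1)] mul_left_commute[OF hp(4) hp(2)]
    show ?thesis
      unfolding brt_def pa mode_simps Tp_simps mul_simps AB[symmetric] comm cc_cc[of q p] dd_dd[of q p] cc_dd
      by (simp add: ksign_def cs.scale_right_distrib algebra_simps mul_simps)
  qed
  have "?L = (\<Sum>j<N. \<Sum>q<M. \<Sum>i<N. \<Sum>p<M. ?l j q i p)"
    unfolding br_eq[OF N(1) ann_dd[OF N(3)]] br_eq[OF N(1) ann_cc[OF N(3)]] mul_simps cs.scale_sum_right
      sum.distrib[symmetric]
    by (intro sum.cong refl) (simp add: cs.scale_right_distrib mult.commute mult.left_commute)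
  also have "\<dots> = (\<Sum>x\<in>{..<N} \<times> {..<M}. \<Sum>y\<in>{..<N} \<times> {..<M}. ?l (fst x) (snd x) (fst y) (snd y))"
    by (simp add: sum.cartesian_product')
  also have "\<dots> = (\<Sum>y\<in>{..<N} \<times> {..<M}. \<Sum>x\<in>{..<N} \<times> {..<M}. ?l (fst x) (snd x) (fst y) (snd y))"
    by (rule sum.swap)
  also have "\<dots> = (\<Sum>i<N. \<Sum>p<M. \<Sum>j<N. \<Sum>q<M. ?l j q i p)"
    by (simp add: sum.cartesian_product')
  also have "\<dots> = (\<Sum>i<N. \<Sum>p<M. \<Sum>j<N. \<Sum>q<M. ksign ((r - 1) * (s - 1)) *\<^sub>c ?r i p j q)"
    unfolding pointwise ..
  also have "\<dots> = ?R"
    unfolding br_eq[OF N(2) ann_dd[OF N(3)]] br_eq[OF N(2) ann_cc[OF N(3)]] mul_simps cs.scale_sum_right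
      sum.distrib[symmetric]
    by (intro sum.cong refl) (simp add: cs.scale_right_distrib mult.commute mult.left_commute)
  finally show ?thesis .
qed

lemma br_commutator:
  assumes a: "has_parity r a" and b: "has_parity s b" and N: "ann N a" "ann N b" "ann M v" and K: "K \<ge> 2 * N"
  shows "br (int m) a (br (int n) b v) - ksign ((r - 1) * (s - 1)) *\<^sub>c br (int n) b (br (int m) a v) =
    (\<Sum>k<K. of_nat (m choose k) *\<^sub>c br_first_order a b N M v k (int m + int n - int k)) +
    (\<Sum>k<K. of_nat (n choose k) *\<^sub>c (- ksign ((r - 1) * (s - 1)) *\<^sub>c br_first_order b a N M v k (int m + int n - int k)))"
  unfolding br_br_split[OF a b N K] br_br_split[OF b a N(2,1,3) K] br_second_order[OF a b N]
  by (simp add: cs.scale_right_distrib cs.scale_sum_right sum_negf mult.commute add.commute)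

section \<open>A criterion for mutual locality\<close>

subsection \<open>Finite differences\<close>

text \<open>Multiplication by \<open>z - w\<close> on the coefficients of \<open>\<Omega>\<^sub>z\<^sup>m \<Omega>\<^sub>w\<^sup>n\<close>.\<close>

definition shift_diff :: "(nat \<Rightarrow> nat \<Rightarrow> 'v::complex_space) \<Rightarrow> nat \<Rightarrow> nat \<Rightarrow> 'v" where
  "shift_diff F = (\<lambda>m n. F (Suc m) n - F m (Suc n))"

lemma shift_diff_add: "(shift_diff ^^ K) (\<lambda>m n. F m n + G m n) = (\<lambda>m n. (shift_diff ^^ K) F m n + (shift_diff ^^ K) G m n)"
proof (induction K arbitrary: F G)
  case (Suc K)
  have "shift_diff (\<lambda>m n. F m n + G m n) = (\<lambda>m n. shift_diff F m n + shift_diff G m n)"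
    by (simp add: shift_diff_def fun_eq_iff)
  then show ?case by (simp only: funpow_Suc_right o_apply Suc)
qed simp

text \<open>\<open>m + n\<close> is constant along the difference, and \<open>(m+1 choose k) - (m choose k) = (m choose k-1)\<close>.\<close>

lemma shift_diff_first:
  "(shift_diff ^^ K) (\<lambda>m n. \<Sum>k<K. of_nat (m choose k) *\<^sub>c G k (int m + int n - int k)) = (\<lambda>m n. 0)"
proof (induction K arbitrary: G)
  case 0
  show ?case by simp
next
  case (Suc K)
  have "shift_diff (\<lambda>m n. \<Sum>k<Suc K. of_nat (m choose k) *\<^sub>c G k (int m + int n - int k)) =
      (\<lambda>m n. \<Sum>k<K. of_nat (m choose k) *\<^sub>c G (Suc k) (int m + int n - int k))"
    unfolding shift_diff_def sum.lessThan_Suc_shift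
    by (simp add: fun_eq_iff sum_subtractf[symmetric] cs.scale_left_distrib algebra_simps)
  then show ?case
    using Suc[of "\<lambda>k. G (Suc k)"] by (simp only: funpow_Suc_right o_apply)
qed

lemma shift_diff_second:
  "(shift_diff ^^ K) (\<lambda>m n. \<Sum>k<K. of_nat (n choose k) *\<^sub>c G k (int m + int n - int k)) = (\<lambda>m n. 0)"
proof (induction K arbitrary: G)
  case 0
  show ?case by simp
next
  case (Suc K)
  have "shift_diff (\<lambda>m n. \<Sum>k<Suc K. of_nat (n choose k) *\<^sub>c G k (int m + int n - int k)) =
      (\<lambda>m n. \<Sum>k<K. of_nat (n choose k) *\<^sub>c (- G (Suc k) (int m + int n - int k)))"
    unfolding shift_diff_def sum.lessThan_Suc_shift
    by (simp add: fun_eq_iff sum_subtractf[symmetric] sum_negf[symmetric] cs.scale_left_distrib algebra_simps)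
  then show ?case
    using Suc[of "\<lambda>k l. - G (Suc k) l"] by (simp only: funpow_Suc_right o_apply)
qed

text \<open>Newton's forward difference formula along the lines of constant \<open>m + n\<close>.\<close>

lemma newton_expansion:
  "F m n = (\<Sum>k\<le>m. of_nat (m choose k) *\<^sub>c (shift_diff ^^ k) F 0 (n + m - k))"
proof (induction m arbitrary: F n)
  case 0
  then show ?case by simp
next
  case (Suc m)
  let ?D = "\<lambda>k. (shift_diff ^^ k) F 0 (n + Suc m - k)"
  have "F (Suc m) n = shift_diff F m n + F m (Suc n)" by (simp add: shift_diff_def)
  also have "\<dots> = (\<Sum>k\<le>m. of_nat (m choose k) *\<^sub>c ?D (Suc k)) + (\<Sum>k\<le>m. of_nat (m choose k) *\<^sub>c ?D k)"
    unfolding Suc[of "shift_diff F"] Suc[of F]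
    by (simp only: funpow_Suc_right o_apply add_Suc add_Suc_right diff_Suc_Suc)
  also have "(\<Sum>k\<le>m. of_nat (m choose k) *\<^sub>c ?D k) = (\<Sum>k\<le>Suc m. of_nat (m choose k) *\<^sub>c ?D k)"
    by (simp add: binomial_eq_0)
  also have "\<dots> = ?D 0 + (\<Sum>k\<le>m. of_nat (m choose Suc k) *\<^sub>c ?D (Suc k))"
    by (simp only: sum.atMost_Suc_shift binomial_n_0 of_nat_1 cs.scale_one)
  also have "(\<Sum>k\<le>m. of_nat (m choose k) *\<^sub>c ?D (Suc k)) + (?D 0 + (\<Sum>k\<le>m. of_nat (m choose Suc k) *\<^sub>c ?D (Suc k))) =
      ?D 0 + (\<Sum>k\<le>m. of_nat (Suc m choose Suc k) *\<^sub>c ?D (Suc k))"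
    by (simp add: cs.scale_left_distrib sum.distrib)
  also have "\<dots> = (\<Sum>k\<le>Suc m. of_nat (Suc m choose k) *\<^sub>c ?D k)"
    by (simp only: sum.atMost_Suc_shift binomial_n_0 of_nat_1 cs.scale_one)
  finally show ?case .
qed

lemma newton_expansion_bounded:
  assumes "(shift_diff ^^ K) F = (\<lambda>m n. 0)"
  shows "F m n = (\<Sum>k<K. of_nat (m choose k) *\<^sub>c (shift_diff ^^ k) F 0 (n + m - k))"
proof -
  have "shift_diff (\<lambda>m n. 0 :: 'a) = (\<lambda>m n. 0)" by (simp add: shift_diff_def)
  then have z: "(shift_diff ^^ j) (\<lambda>m n. 0 :: 'a) = (\<lambda>m n. 0)" for j by (induction j) simp_all
  have "(shift_diff ^^ k) F = (\<lambda>m n. 0)" if "k \<ge> K" for k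
  proof -
    have "(shift_diff ^^ (k - K + K)) F = (shift_diff ^^ (k - K)) ((shift_diff ^^ K) F)"
      by (simp only: funpow_add o_apply)
    then show ?thesis using that by (simp add: assms z)
  qed
  then show ?thesis
    by (subst newton_expansion, intro sum.mono_neutral_cong) (auto simp: binomial_eq_0)
qed

lemma shift_diff_in_subspace:
  assumes "cs.subspace W" "\<And>m n. F m n \<in> W"
  shows "(shift_diff ^^ k) F m n \<in> W"
  by (induction k arbitrary: m n) (use assms in \<open>auto simp: shift_diff_def cs.subspace_diff\<close>)

lemma shift_diff_vanish:
  assumes "\<And>m n. m \<le> M \<Longrightarrow> n \<ge> B \<Longrightarrow> F m n = 0" "m + k \<le> M" "n \<ge> B"
  shows "(shift_diff ^^ k) F m n = 0"
  using assms(2,3) by (induction k arbitrary: m n) (simp_all add: shift_diff_def assms(1))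

subsection \<open>Expansions of monomials\<close>

lemma Sum_any_single:
  assumes "\<And>x. x \<noteq> a \<Longrightarrow> g x = 0"
  shows "Sum_any g = g a"
proof -
  have "{x. g x \<noteq> 0} \<subseteq> {a}" using assms by auto
  then show ?thesis using Sum_any.expand_superset[of "{a}" g] by simp
qed

lemma series2_mult_single:
  assumes "\<And>m n m' n'. basis_prod m m' = Some k \<Longrightarrow> basis_prod n n' = Some l \<Longrightarrow> a m n * b m' n' \<noteq> 0 \<Longrightarrow>
      m = M \<and> n = N \<and> m' = M' \<and> n' = N'"
  shows "series2_mult a b k l = (if basis_prod M M' = Some k \<and> basis_prod N N' = Some l
    then (if N \<ge> 0 \<and> M' \<ge> 0 then -1 else 1) * a M N * b M' N' else 0)"
proof -
  let ?g = "\<lambda>(m, n, m', n'). if basis_prod m m' = Some k \<and> basis_prod n n' = Some l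
      then (if n \<ge> 0 \<and> m' \<ge> 0 then -1 else 1) * a m n * b m' n' else 0"
  have z: "?g x = 0" if "x \<noteq> (M, N, M', N')" for x
  proof -
    obtain m n m' n' where x: "x = (m, n, m', n')" by (cases x)
    show ?thesis
    proof (rule ccontr)
      assume "?g x \<noteq> 0"
      then have "basis_prod m m' = Some k" "basis_prod n n' = Some l" "a m n * b m' n' \<noteq> 0"
        by (simp_all add: x split: if_splits)
      from assms[OF this] that show False by (simp add: x)
    qed
  qed
  have "series2_mult a b k l = Sum_any ?g" by (simp only: series2_mult_def)
  also have "\<dots> = ?g (M, N, M', N')" by (rule Sum_any_single) (rule z)
  finally show ?thesis by (simp only: prod.case)
qed

lemma mult_omega_w:
  assumes "e = omega_zw \<or> e = omega_wz"
  shows "series2_mult a (e (Om Pw N)) k l = (if 0 \<le> l \<and> l \<le> int N then a k (l - int N - 1) else 0)"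
proof -
  have b: "e (Om Pw N) = (\<lambda>p q. if p = -1 \<and> q = int N then 1 else 0)"
    using assms by (auto simp: omega_zw_def omega_wz_def)
  show ?thesis
    unfolding b
    by (subst series2_mult_single[where M = k and N = "l - int N - 1" and M' = "-1" and N' = "int N"])
      (auto simp: basis_prod_def split: if_splits)
qed

lemma mult_omega_z:
  assumes "e = omega_zw \<or> e = omega_wz"
  shows "series2_mult a (e (Om Pz N)) k l =
    (if 0 \<le> k \<and> k \<le> int N then (if l \<ge> 0 then -1 else 1) * a (k - int N - 1) l else 0)"
proof -
  have b: "e (Om Pz N) = (\<lambda>p q. if p = int N \<and> q = -1 then 1 else 0)"
    using assms by (auto simp: omega_zw_def omega_wz_def)
  show ?thesis
    unfolding b
    by (subst series2_mult_single[where M = "k - int N - 1" and N = l and M' = "int N" and N' = "-1"])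
      (auto simp: basis_prod_def split: if_splits)
qed

lemma mult_omega_diff_zw:
  assumes "\<forall>m n. m \<noteq> -1 \<or> n \<ge> 0 \<longrightarrow> a m n = 0"
  shows "series2_mult a (omega_zw (Om Pzw N)) k l =
    (if k \<ge> int N \<and> l + k - int N < 0 then of_nat (nat k choose N) * a (-1) (l + k - int N) else 0)"
proof -
  have b: "omega_zw (Om Pzw N) p q = (if p \<ge> int N \<and> q = int N - p - 1 then of_nat (nat p choose N) else 0)" for p q
  proof (cases "p \<ge> int N \<and> q = int N - p - 1")
    case True
    then have "q = - int (nat p - N) - 1" "p = int (N + (nat p - N))" by auto
    then have ex: "\<exists>n. q = - int n - 1 \<and> p = int (N + n)" by blast
    have "nat (- q - 1) = nat p - N" "N \<le> nat p" using True by auto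
    then have "nat p choose nat (- q - 1) = nat p choose N" by (simp add: binomial_symmetric[of N])
    with ex True show ?thesis by (simp add: omega_zw_def)
  next
    case False
    then have "\<not> (\<exists>n. q = - int n - 1 \<and> p = int (N + n))" by auto
    with False show ?thesis by (auto simp: omega_zw_def)
  qed
  show ?thesis
  proof (subst series2_mult_single[where M = "-1" and N = "l + k - int N" and M' = k and N' = "int N - k - 1"])
    fix m n m' n'
    assume *: "basis_prod m m' = Some k" "basis_prod n n' = Some l" "a m n * omega_zw (Om Pzw N) m' n' \<noteq> 0"
    then have "m = -1" "n < 0" "m' \<ge> int N" "n' = int N - m' - 1"
      using assms by (auto simp: b not_less[symmetric] split: if_splits)
    then show "m = -1 \<and> n = l + k - int N \<and> m' = k \<and> n' = int N - k - 1"
      using *(1,2) by (auto simp: basis_prod_def split: if_splits)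
  qed (use assms in \<open>auto simp: b basis_prod_def split: if_splits\<close>)
qed

lemma mult_omega_diff_wz:
  assumes "\<forall>m n. m \<noteq> -1 \<or> n \<ge> 0 \<longrightarrow> a m n = 0"
  shows "series2_mult a (omega_wz (Om Pzw N)) k l =
    (if k < 0 \<and> l \<ge> 0 \<and> l + k - int N < 0 then (-1) ^ N * of_nat (nat (int N - k - 1) choose N) * a (-1) (l + k - int N) else 0)"
proof -
  have b: "omega_wz (Om Pzw N) p q =
      (if p < 0 \<and> q = int N - p - 1 then (-1) ^ N * of_nat (nat q choose N) else 0)" for p q
  proof (cases "p < 0 \<and> q = int N - p - 1")
    case True
    then have "p = - int (nat (- p - 1)) - 1" "q = int (N + nat (- p - 1))" by auto
    then have ex: "\<exists>n. p = - int n - 1 \<and> q = int (N + n)" by blast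
    have "nat (- p - 1) = nat q - N" "N \<le> nat q" using True by auto
    then have "nat q choose nat (- p - 1) = nat q choose N" by (simp add: binomial_symmetric[of N])
    with ex True show ?thesis by (simp add: omega_wz_def)
  next
    case False
    then have "\<not> (\<exists>n. p = - int n - 1 \<and> q = int (N + n))" by auto
    with False show ?thesis by (auto simp: omega_wz_def)
  qed
  show ?thesis
  proof (subst series2_mult_single[where M = "-1" and N = "l + k - int N" and M' = k and N' = "int N - k - 1"])
    fix m n m' n'
    assume *: "basis_prod m m' = Some k" "basis_prod n n' = Some l" "a m n * omega_wz (Om Pzw N) m' n' \<noteq> 0"
    then have "m = -1" "n < 0" "m' < 0" "n' = int N - m' - 1"
      using assms by (auto simp: b not_less[symmetric] split: if_splits)
    then show "m = -1 \<and> n = l + k - int N \<and> m' = k \<and> n' = int N - k - 1"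
      using *(1,2) by (auto simp: basis_prod_def split: if_splits)
  qed (use assms in \<open>auto simp: b basis_prod_def split: if_splits\<close>)
qed

definition fps2 :: "(nat \<Rightarrow> nat \<Rightarrow> complex) \<Rightarrow> complex fps fps" where
  "fps2 c = Abs_fps (\<lambda>j. Abs_fps (\<lambda>i. c i j))"

lemma series2_of_fps2: "series2_of_fps (fps2 c) m n = (if m < 0 \<and> n < 0 then c (nat (- m - 1)) (nat (- n - 1)) else 0)"
  by (simp add: series2_of_fps_def fps2_def)

definition word_expand :: "(omega \<Rightarrow> series2) \<Rightarrow> omega list \<Rightarrow> complex fps fps \<Rightarrow> series2" where
  "word_expand e u f = foldl (\<lambda>s g. series2_mult s (e g)) (series2_of_fps f) u"

lemma word_expand_0: "word_expand e u 0 k l = 0"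
proof -
  have "series2_mult (\<lambda>_ _. 0) b = (\<lambda>_ _. 0)" for b
    by (simp add: series2_mult_def fun_eq_iff case_prod_unfold cong: if_cong)
  then have "foldl (\<lambda>s g. series2_mult s (e g)) (\<lambda>_ _. 0) u = (\<lambda>_ _. 0)"
    by (induction u) simp_all
  moreover have "series2_of_fps 0 = (\<lambda>_ _. 0)" by (simp add: series2_of_fps_def fun_eq_iff)
  ultimately show ?thesis by (simp add: word_expand_def)
qed

lemma expand_sum_words:
  assumes "finite U"
  shows "expand e (\<Sum>u\<in>U. Poly_Mapping.single u (co u)) k l = (\<Sum>u\<in>U. word_expand e u (co u) k l)"
proof -
  let ?p = "\<Sum>u\<in>U. Poly_Mapping.single u (co u)"
  have lk: "Poly_Mapping.lookup ?p u = (if u \<in> U then co u else 0)" for u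
    using assms by (simp add: lookup_sum lookup_single when_def)
  have "expand e ?p k l = (\<Sum>u\<in>Poly_Mapping.keys ?p. word_expand e u (Poly_Mapping.lookup ?p u) k l)"
    by (simp add: expand_def word_expand_def)
  also have "\<dots> = (\<Sum>u\<in>U. word_expand e u (co u) k l)"
    by (rule sum.mono_neutral_cong_left)
      (use assms lk in \<open>auto simp: in_keys_iff word_expand_0 split: if_splits\<close>)
  finally show ?thesis .
qed

text \<open>The words and coefficients of an element of \<open>\<K>\<^bsub>z,w,z-w\<^esub>\<close> with normally ordered part given by \<open>f\<close> (no \<open>\<Omega>\<close>),
  \<open>h\<close>, \<open>g\<close> and \<open>c\<close> (with \<open>\<Omega>\<^sub>w\<close>, \<open>\<Omega>\<^sub>z\<close> and both), and with polar part
  \<open>\<Sum>\<^sub>k \<Omega>\<^bsub>z-w\<^esub>\<^sup>k (\<Sum>\<^sub>j w\<^sup>j \<rho> k j + \<Sum>\<^sub>l \<Omega>\<^sub>w\<^sup>l d k l)\<close>.  No word occurs twice, so an expansion of the element is the sum of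
  the expansions of its words.\<close>

definition local_words :: "nat \<Rightarrow> nat \<Rightarrow> omega list set" where
  "local_words N B = {[]} \<union> (\<lambda>n. [Om Pw n]) ` {..<B} \<union> (\<lambda>m. [Om Pz m]) ` {..<B} \<union>
     (\<lambda>(m, n). [Om Pz m, Om Pw n]) ` ({..<B} \<times> {..<B}) \<union> (\<lambda>k. [Om Pzw k]) ` {..<N} \<union>
     (\<lambda>(k, l). [Om Pzw k, Om Pw l]) ` ({..<N} \<times> {..<B})"

lemma sum_local_words:
  "(\<Sum>u\<in>local_words N B. G u) = G [] + (\<Sum>n<B. G [Om Pw n]) + (\<Sum>m<B. G [Om Pz m]) +
     (\<Sum>m<B. \<Sum>n<B. G [Om Pz m, Om Pw n]) + (\<Sum>k<N. G [Om Pzw k]) + (\<Sum>k<N. \<Sum>l<B. G [Om Pzw k, Om Pw l])"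
  for G :: "omega list \<Rightarrow> 'b::comm_monoid_add"
proof -
  have img: "(\<Sum>u\<in>(\<lambda>(m, n). [g m, g' n]) ` (I \<times> J). G u) = (\<Sum>m\<in>I. \<Sum>n\<in>J. G [g m, g' n])"
    if "inj g" "inj g'" for g g' :: "nat \<Rightarrow> omega" and I J
  proof -
    have "inj_on (\<lambda>(m, n). [g m, g' n]) (I \<times> J)" using that by (auto simp: inj_on_def inj_def)
    then show ?thesis by (simp add: sum.reindex sum.cartesian_product o_def case_prod_unfold)
  qed
  have inj: "inj (Om x)" for x by (simp add: inj_def)
  show ?thesis
    unfolding local_words_def
    by (subst sum.union_disjoint, simp, simp, force)+
      (simp add: sum.reindex inj_on_def img[OF inj inj])
qed

definition local_coef ::
    "(nat \<Rightarrow> nat \<Rightarrow> complex) \<Rightarrow> (nat \<Rightarrow> nat \<Rightarrow> complex) \<Rightarrow> (nat \<Rightarrow> nat \<Rightarrow> complex) \<Rightarrow> (nat \<Rightarrow> nat \<Rightarrow> complex) \<Rightarrow>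
     (nat \<Rightarrow> nat \<Rightarrow> complex) \<Rightarrow> (nat \<Rightarrow> nat \<Rightarrow> complex) \<Rightarrow> omega list \<Rightarrow> complex fps fps" where
  "local_coef f h g c \<rho> d u = (case u of
      [] \<Rightarrow> fps2 f
    | [Om x n] \<Rightarrow> (case x of Pz \<Rightarrow> fps2 (\<lambda>i j. if i = 0 then g n j else 0)
        | Pw \<Rightarrow> fps2 (\<lambda>i j. if j = 0 then h n i else 0) | Pzw \<Rightarrow> fps2 (\<lambda>i j. if i = 0 then \<rho> n j else 0))
    | Om x m # Om y n # _ \<Rightarrow> fps2 (\<lambda>i j. if i = 0 \<and> j = 0 then (if x = Pz then c m n else d m n) else 0))"

lemma word_expand_local:
  assumes e: "e = omega_zw \<or> e = omega_wz"
  shows "word_expand e [] (local_coef f h g c \<rho> d []) k l =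
      (if k < 0 \<and> l < 0 then f (nat (- k - 1)) (nat (- l - 1)) else 0)"
    "word_expand e [Om Pw n] (local_coef f h g c \<rho> d [Om Pw n]) k l =
      (if k < 0 \<and> l = int n then h n (nat (- k - 1)) else 0)"
    "word_expand e [Om Pz m] (local_coef f h g c \<rho> d [Om Pz m]) k l =
      (if k = int m \<and> l < 0 then g m (nat (- l - 1)) else 0)"
    "word_expand e [Om Pz m, Om Pw n] (local_coef f h g c \<rho> d [Om Pz m, Om Pw n]) k l =
      (if k = int m \<and> l = int n then c m n else 0)"
  by (auto simp: word_expand_def local_coef_def mult_omega_w[OF e] mult_omega_z[OF e] series2_of_fps2)

lemma word_expand_local_zw:
  "word_expand omega_zw [Om Pzw n] (local_coef f h g c \<rho> d [Om Pzw n]) k l =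
    (if k \<ge> int n \<and> l + k - int n < 0 then of_nat (nat k choose n) * \<rho> n (nat (int n - k - l - 1)) else 0)"
  "word_expand omega_zw [Om Pzw n, Om Pw j] (local_coef f h g c \<rho> d [Om Pzw n, Om Pw j]) k l =
    (if k \<ge> int n \<and> l \<ge> 0 \<and> k + l = int n + int j then of_nat (nat k choose n) * d n j else 0)"
proof -
  have 1: "\<forall>m q. m \<noteq> -1 \<or> q \<ge> 0 \<longrightarrow> series2_of_fps (fps2 (\<lambda>i j. if i = 0 then \<rho> n j else 0)) m q = 0"
    by (auto simp: series2_of_fps2)
  have 2: "\<forall>m q. m \<noteq> -1 \<or> q \<ge> 0 \<longrightarrow> series2_of_fps (fps2 (\<lambda>i j'. if i = 0 \<and> j' = 0 then d n j else 0)) m q = 0"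
    by (auto simp: series2_of_fps2)
  have 3: "local_coef f h g c \<rho> d [Om Pzw n, Om Pw j] = fps2 (\<lambda>i j'. if i = 0 \<and> j' = 0 then d n j else 0)"
    by (simp add: local_coef_def)
  show "word_expand omega_zw [Om Pzw n] (local_coef f h g c \<rho> d [Om Pzw n]) k l =
    (if k \<ge> int n \<and> l + k - int n < 0 then of_nat (nat k choose n) * \<rho> n (nat (int n - k - l - 1)) else 0)"
    unfolding word_expand_def local_coef_def list.case omega.case pt.case foldl.simps mult_omega_diff_zw[OF 1]
    by (simp add: series2_of_fps2 algebra_simps)
  show "word_expand omega_zw [Om Pzw n, Om Pw j] (local_coef f h g c \<rho> d [Om Pzw n, Om Pw j]) k l =
    (if k \<ge> int n \<and> l \<ge> 0 \<and> k + l = int n + int j then of_nat (nat k choose n) * d n j else 0)"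
    unfolding word_expand_def 3 foldl.simps
      mult_omega_w[OF disjI1[OF refl]] mult_omega_diff_zw[OF 2]
    by (auto simp: series2_of_fps2)
qed

lemma word_expand_local_wz:
  "word_expand omega_wz [Om Pzw n] (local_coef f h g c \<rho> d [Om Pzw n]) k l =
    (if k < 0 \<and> l \<ge> 0 \<and> l + k - int n < 0
     then (-1) ^ n * of_nat (nat (int n - k - 1) choose n) * \<rho> n (nat (int n - k - l - 1)) else 0)"
  "word_expand omega_wz [Om Pzw n, Om Pw j] (local_coef f h g c \<rho> d [Om Pzw n, Om Pw j]) k l = 0"
proof -
  have 1: "\<forall>m q. m \<noteq> -1 \<or> q \<ge> 0 \<longrightarrow> series2_of_fps (fps2 (\<lambda>i j. if i = 0 then \<rho> n j else 0)) m q = 0"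
    by (auto simp: series2_of_fps2)
  have 2: "\<forall>m q. m \<noteq> -1 \<or> q \<ge> 0 \<longrightarrow> series2_of_fps (fps2 (\<lambda>i j'. if i = 0 \<and> j' = 0 then d n j else 0)) m q = 0"
    by (auto simp: series2_of_fps2)
  have 3: "local_coef f h g c \<rho> d [Om Pzw n, Om Pw j] = fps2 (\<lambda>i j'. if i = 0 \<and> j' = 0 then d n j else 0)"
    by (simp add: local_coef_def)
  show "word_expand omega_wz [Om Pzw n] (local_coef f h g c \<rho> d [Om Pzw n]) k l =
    (if k < 0 \<and> l \<ge> 0 \<and> l + k - int n < 0
     then (-1) ^ n * of_nat (nat (int n - k - 1) choose n) * \<rho> n (nat (int n - k - l - 1)) else 0)"
    unfolding word_expand_def local_coef_def list.case omega.case pt.case foldl.simps mult_omega_diff_wz[OF 1]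
    by (simp add: series2_of_fps2 algebra_simps)
  show "word_expand omega_wz [Om Pzw n, Om Pw j] (local_coef f h g c \<rho> d [Om Pzw n, Om Pw j]) k l = 0"
    unfolding word_expand_def 3 foldl.simps
      mult_omega_w[OF disjI2[OF refl]] mult_omega_diff_wz[OF 2]
    by simp
qed

lemma linear_on_sum:
  assumes "linear_on W \<phi>" "cs.subspace W" "\<And>i. i \<in> I \<Longrightarrow> x i \<in> W"
  shows "\<phi> (\<Sum>i\<in>I. a i *\<^sub>c x i) = (\<Sum>i\<in>I. a i *\<^sub>c \<phi> (x i))"
  using assms(3)
proof (induction I rule: infinite_finite_induct)
  case (insert i I)
  have "(\<Sum>i\<in>I. a i *\<^sub>c x i) \<in> W"
    using insert assms(2) by (intro cs.subspace_sum cs.subspace_scale) auto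
  then show ?case using insert assms(1,2) by (simp add: linear_on_def cs.subspace_scale)
next
  case empty
  have "\<phi> (0 *\<^sub>c 0) = 0 *\<^sub>c \<phi> 0" using assms(1,2) cs.subspace_0 unfolding linear_on_def by blast
  then show ?case by simp
next
  case (infinite I)
  have "\<phi> (0 *\<^sub>c 0) = 0 *\<^sub>c \<phi> 0" using assms(1,2) cs.subspace_0 unfolding linear_on_def by blast
  with infinite show ?case by simp
qed

text \<open>The polar part has coefficients \<open>u k l\<close> at \<open>\<Omega>\<^bsub>z-w\<^esub>\<^sup>k w\<^sup>l\<close>.  The first expansion shows them in the coefficients of
  \<open>\<Omega>\<^sub>z\<^sup>m w\<^sup>j\<close> (\<open>left\<close>), the second one in those of \<open>z\<^sup>i \<Omega>\<^sub>w\<^sup>n\<close> (\<open>right\<close>), so these two commutators must match.  The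
  terms \<open>\<Omega>\<^bsub>z-w\<^esub>\<^sup>k \<Omega>\<^sub>w\<^sup>l\<close> vanish in the second expansion; they can absorb any commutator of non-negative modes that
  is annihilated by \<open>(z - w)\<^sup>N\<close>, with coefficients given by Newton's formula.\<close>

theorem mutually_local_criterion:
  fixes A B :: "int \<Rightarrow> 'v::complex_space \<Rightarrow> 'v"
  assumes W: "cs.subspace W" and A: "raviolo_field W A" and B: "raviolo_field W B"
    and u: "\<And>k l v. v \<in> W \<Longrightarrow> u k l v \<in> W"
    and creation: "\<And>i j v. v \<in> W \<Longrightarrow> A (- int i - 1) (B (- int j - 1) v) =
        ksign (r * s) *\<^sub>c B (- int j - 1) (A (- int i - 1) v)"
    and left: "\<And>m j v. v \<in> W \<Longrightarrow> A (int m) (B (- int j - 1) v) =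
        ksign ((r - 1) * s) *\<^sub>c B (- int j - 1) (A (int m) v) +
        (\<Sum>k<N. of_nat (m choose k) *\<^sub>c u k (int k + int j - int m) v)"
    and right: "\<And>n i v. v \<in> W \<Longrightarrow> B (int n) (A (- int i - 1) v) =
        ksign (r * (s - 1)) *\<^sub>c A (- int i - 1) (B (int n) v) +
        ksign (r * s) *\<^sub>c (\<Sum>k<N. ((-1) ^ k * of_nat (k + i choose k)) *\<^sub>c u k (int k + int i - int n) v)"
    and u_neg: "\<And>k l v. v \<in> W \<Longrightarrow> l < 0 \<Longrightarrow> u k l v = 0"
    and annihilation: "\<And>v. v \<in> W \<Longrightarrow> (shift_diff ^^ N) (\<lambda>m n. A (int m) (B (int n) v) -
        ksign ((r - 1) * (s - 1)) *\<^sub>c B (int n) (A (int m) v)) = (\<lambda>m n. 0)"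
  shows "mutually_local W r A s B"
  unfolding mutually_local_def
proof (intro exI[of _ N] ballI allI impI)
  fix v and \<phi> :: "'v \<Rightarrow> complex"
  assume v: "v \<in> W" and \<phi>: "linear_on W \<phi>"
  have AW: "A m x \<in> W" and BW: "B m x \<in> W" if "x \<in> W" for m x
    using A B that unfolding raviolo_field_def endo_on_def by blast+
  have \<phi>_add: "\<phi> (x + y) = \<phi> x + \<phi> y" and \<phi>_scale: "\<phi> (a *\<^sub>c x) = a * \<phi> x" if "x \<in> W" "y \<in> W" for x y a
    using \<phi> that by (simp_all add: linear_on_def cscale_complex_def)
  note Wc = cs.subspace_scale[OF W] cs.subspace_sum[OF W] cs.subspace_add[OF W] cs.subspace_diff[OF W]
  have \<phi>_0: "\<phi> 0 = 0" using \<phi>_scale[OF v v, of 0] by simp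
  have lin0: "A m 0 = 0" "B m 0 = 0" for m
  proof -
    have "A m (0 *\<^sub>c v) = 0 *\<^sub>c A m v" "B m (0 *\<^sub>c v) = 0 *\<^sub>c B m v"
      using A B v unfolding raviolo_field_def endo_on_def linear_on_def by blast+
    then show "A m 0 = 0" "B m 0 = 0" by simp_all
  qed
  define F where "F m n = A (int m) (B (int n) v) - ksign ((r - 1) * (s - 1)) *\<^sub>c B (int n) (A (int m) v)" for m n
  have FW: "F m n \<in> W" for m n unfolding F_def by (intro Wc AW BW v)
  define D where "D k l = (shift_diff ^^ k) F 0 l" for k l
  have DW: "D k l \<in> W" for k l unfolding D_def by (rule shift_diff_in_subspace[OF W FW])
  have F: "F m n = (\<Sum>k<N. of_nat (m choose k) *\<^sub>c D k (n + m - k))" for m n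
    unfolding D_def by (rule newton_expansion_bounded) (use annihilation[OF v] in \<open>simp add: F_def\<close>)
  \<comment> \<open>All coefficients that occur vanish from \<open>M\<close> on.\<close>
  have "\<exists>M. \<forall>n\<ge>M. A (int n) v = 0 \<and> B (int n) v = 0 \<and> (\<forall>m. B (int n) (A (int m) v) = 0)"
  proof -
    obtain M1 M2 where M: "\<And>m. m \<ge> M1 \<Longrightarrow> A m v = 0" "\<And>m. m \<ge> M2 \<Longrightarrow> B m v = 0"
      using A B v unfolding raviolo_field_def by meson
    have "\<forall>m. \<exists>L. \<forall>n\<ge>L. B n (A (int m) v) = 0"
      using B AW[OF v] unfolding raviolo_field_def by blast
    then obtain L where L: "\<And>m n. n \<ge> L m \<Longrightarrow> B n (A (int m) v) = 0" by metis
    have "\<exists>K. \<forall>m<nat M1. nat (L m) \<le> K"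
      using finite_nat_set_iff_bounded_le[of "(\<lambda>m. nat (L m)) ` {..<nat M1}"] by auto
    then obtain K where K: "\<And>m. m < nat M1 \<Longrightarrow> nat (L m) \<le> K" by blast
    show ?thesis
    proof (intro exI[of _ "max K (max (nat M1) (nat M2))"] allI impI conjI)
      fix n m assume n: "max K (max (nat M1) (nat M2)) \<le> n"
      show "A (int n) v = 0" "B (int n) v = 0" using n M by auto
      show "B (int n) (A (int m) v) = 0"
      proof (cases "m < nat M1")
        case True
        have "K \<le> n" using n by simp
        then show ?thesis using K[OF True] by (intro L) linarith
      qed (simp add: M lin0)
    qed
  qed
  then obtain M where M: "\<And>n. n \<ge> M \<Longrightarrow> A (int n) v = 0" "\<And>n. n \<ge> M \<Longrightarrow> B (int n) v = 0"
    "\<And>n m. n \<ge> M \<Longrightarrow> B (int n) (A (int m) v) = 0" by blast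
  have D0: "D k l = 0" if "l \<ge> M" for k l
    unfolding D_def by (rule shift_diff_vanish[of k M]) (use that in \<open>auto simp: F_def M lin0\<close>)
  \<comment> \<open>The normally ordered product: creation modes of \<open>A\<close> stand on the left of \<open>B\<close>, its annihilation modes on the
    right.  The signs are those of \<^const>\<open>matrix_AB\<close> and of the exchange of \<open>A\<close> and \<open>B\<close>.\<close>
  define f where "f i j = \<phi> (A (- int i - 1) (B (- int j - 1) v))" for i j
  define h where "h n i = ksign r * \<phi> (A (- int i - 1) (B (int n) v))" for n i
  define g where "g m j = ksign ((r - 1) * s) * \<phi> (B (- int j - 1) (A (int m) v))" for m j
  define c where "c m n = ksign ((r - 1) * s) * \<phi> (B (int n) (A (int m) v))" for m n
  define \<rho> where "\<rho> k j = \<phi> (u k (int j) v)" for k j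
  define d where "d k l = ksign (r - 1) * \<phi> (D k l)" for k l
  let ?co = "local_coef f h g c \<rho> d"
  define p where "p = (\<Sum>w\<in>local_words N M. Poly_Mapping.single w (?co w))"
  have fin: "finite (local_words N M)" by (simp add: local_words_def)
  have neg: "\<exists>i. k = - int i - 1 \<and> nat (- k - 1) = i" if "k < 0" for k :: int
    using that by (intro exI[of _ "nat (- k - 1)"]) simp
  have nneg: "\<exists>i. k = int i" if "\<not> k < 0" for k :: int
    using that by (metis nonneg_int_cases not_less)
  have delta: "(\<Sum>n<M. if x = int n then y n else 0) = (if 0 \<le> x \<and> x < int M then y (nat x) else 0)" for x :: int and y :: "nat \<Rightarrow> complex"
  proof (cases "0 \<le> x")
    case True
    then obtain i where "x = int i" by (metis nonneg_int_cases)
    then show ?thesis by simp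
  qed (auto intro!: sum.neutral)
  \<comment> \<open>In each quadrant only the normally ordered term with the matching \<open>\<Omega>\<close>'s and one kind of polar term
    contribute.\<close>
  have zw: "expand omega_zw p = matrix_AB \<phi> r A B v"
  proof (intro ext)
    fix k l :: int
    have e: "expand omega_zw p k l = (if k < 0 \<and> l < 0 then f (nat (- k - 1)) (nat (- l - 1)) else 0) +
        (\<Sum>n<M. if k < 0 \<and> l = int n then h n (nat (- k - 1)) else 0) +
        (\<Sum>m<M. if k = int m \<and> l < 0 then g m (nat (- l - 1)) else 0) +
        (\<Sum>m<M. \<Sum>n<M. if k = int m \<and> l = int n then c m n else 0) +
        (\<Sum>n<N. if k \<ge> int n \<and> l + k - int n < 0 then of_nat (nat k choose n) * \<rho> n (nat (int n - k - l - 1)) else 0) +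
        (\<Sum>n<N. \<Sum>j<M. if k \<ge> int n \<and> l \<ge> 0 \<and> k + l = int n + int j then of_nat (nat k choose n) * d n j else 0)"
      unfolding p_def expand_sum_words[OF fin]
      unfolding sum_local_words word_expand_local[OF disjI1[OF refl]] word_expand_local_zw by (rule refl)
    show "expand omega_zw p k l = matrix_AB \<phi> r A B v k l"
    proof (cases "k < 0"; cases "l < 0")
      assume kl: "k < 0" "l < 0"
      then show ?thesis using neg[OF kl(1)] neg[OF kl(2)]
        unfolding e by (auto simp: matrix_AB_def f_def)
    next
      assume kl: "k < 0" "\<not> l < 0"
      obtain i n where i: "k = - int i - 1" "nat (- k - 1) = i" and n: "l = int n" using neg[OF kl(1)] nneg[OF kl(2)] by blast
      have "h n i = 0" if "n \<ge> M" using that by (simp add: h_def M lin0 \<phi>_0)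
      then show ?thesis using kl
        unfolding e by (auto simp: delta matrix_AB_def h_def i n)
    next
      assume kl: "\<not> k < 0" "l < 0"
      obtain m j where j: "l = - int j - 1" "nat (- l - 1) = j" and m: "k = int m" using neg[OF kl(2)] nneg[OF kl(1)] by blast
      have "g m j = 0" if "m \<ge> M" using that by (simp add: g_def M lin0 \<phi>_0)
      then have 1: "(\<Sum>m'<M. if k = int m' \<and> l < 0 then g m' (nat (- l - 1)) else 0) = g m j"
        using kl by (auto simp: j m)
      have "(if k \<ge> int n \<and> l + k - int n < 0 then of_nat (nat k choose n) * \<rho> n (nat (int n - k - l - 1)) else 0) =
          of_nat (m choose n) * \<phi> (u n (int n + int j - int m) v)" for n
      proof (cases "n \<le> m")
        case True
        then show ?thesis
          using u_neg[OF v, of "int n + int j - int m" n]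
          by (auto simp: m j \<rho>_def \<phi>_0 algebra_simps)
      qed (simp add: m binomial_eq_0)
      then have 2: "(\<Sum>n<N. if k \<ge> int n \<and> l + k - int n < 0 then of_nat (nat k choose n) * \<rho> n (nat (int n - k - l - 1)) else 0) =
          (\<Sum>n<N. of_nat (m choose n) * \<phi> (u n (int n + int j - int m) v))" by simp
      have "matrix_AB \<phi> r A B v k l = \<phi> (A (int m) (B (- int j - 1) v))"
        by (simp add: matrix_AB_def m j)
      also have "\<dots> = g m j + (\<Sum>n<N. of_nat (m choose n) * \<phi> (u n (int n + int j - int m) v))"
        unfolding left[OF v] g_def
        by (subst \<phi>_add, intro Wc AW BW u v, intro Wc u v, subst \<phi>_scale[OF _ v], intro AW BW v,
            subst linear_on_sum[OF \<phi> W], rule u, rule v) (simp add: cscale_complex_def)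
      finally show ?thesis
        unfolding e 2 1 using kl by (simp add: delta)
    next
      assume kl: "\<not> k < 0" "\<not> l < 0"
      obtain m n where m: "k = int m" and n: "l = int n" using nneg[OF kl(1)] nneg[OF kl(2)] by blast
      have "c m n = 0" if "m \<ge> M \<or> n \<ge> M" using that by (auto simp: c_def M lin0 \<phi>_0)
      then have 1: "(\<Sum>m'<M. \<Sum>n'<M. if k = int m' \<and> l = int n' then c m' n' else 0) = c m n"
      proof -
        have "(\<Sum>m'<M. \<Sum>n'<M. if k = int m' \<and> l = int n' then c m' n' else 0) =
            (\<Sum>m'<M. if m' = m then (\<Sum>n'<M. if n' = n then c m n else 0) else 0)"
          by (intro sum.cong refl) (auto simp: m n intro!: sum.neutral sum.cong)
        with \<open>m \<ge> M \<or> n \<ge> M \<Longrightarrow> c m n = 0\<close> show ?thesis by auto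
      qed
      have "(\<Sum>j<M. if k \<ge> int n' \<and> l \<ge> 0 \<and> k + l = int n' + int j then of_nat (nat k choose n') * d n' j else 0) =
          of_nat (m choose n') * d n' (n + m - n')" for n'
      proof (cases "n' \<le> m")
        case True
        have "(\<Sum>j<M. if k \<ge> int n' \<and> l \<ge> 0 \<and> k + l = int n' + int j then of_nat (nat k choose n') * d n' j else 0) =
            (\<Sum>j<M. if j = n + m - n' then of_nat (m choose n') * d n' (n + m - n') else 0)"
          using True by (intro sum.cong refl) (auto simp: m n)
        moreover have "d n' (n + m - n') = 0" if "n + m - n' \<ge> M" using that by (simp add: d_def D0 \<phi>_0)
        ultimately show ?thesis by auto
      qed (auto simp: m binomial_eq_0 intro!: sum.neutral)
      then have 2: "(\<Sum>n'<N. \<Sum>j<M. if k \<ge> int n' \<and> l \<ge> 0 \<and> k + l = int n' + int j then of_nat (nat k choose n') * d n' j else 0) =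
          (\<Sum>n'<N. of_nat (m choose n') * d n' (n + m - n'))" by simp
      have "matrix_AB \<phi> r A B v k l = ksign (r - 1) * \<phi> (ksign ((r - 1) * (s - 1)) *\<^sub>c B (int n) (A (int m) v) + F m n)"
        by (simp add: matrix_AB_def m n F_def)
      also have "\<dots> = ksign (r - 1) * ksign ((r - 1) * (s - 1)) * \<phi> (B (int n) (A (int m) v)) + ksign (r - 1) * \<phi> (F m n)"
        by (subst \<phi>_add, intro Wc AW BW v, rule FW, subst \<phi>_scale[OF _ v], intro AW BW v) (simp add: algebra_simps)
      also have "ksign (r - 1) * ksign ((r - 1) * (s - 1)) * \<phi> (B (int n) (A (int m) v)) = c m n"
        by (simp add: c_def ksign_def)
      also have "ksign (r - 1) * \<phi> (F m n) = (\<Sum>n'<N. of_nat (m choose n') * d n' (n + m - n'))"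
        unfolding F by (subst linear_on_sum[OF \<phi> W], rule DW)
          (simp add: d_def cscale_complex_def sum_distrib_left mult.left_commute)
      finally show ?thesis
        unfolding e 1 2 using kl by (auto simp: intro!: sum.neutral)
    qed
  qed
  have wz: "expand omega_wz p = matrix_BA \<phi> r s A B v"
  proof (intro ext)
    fix k l :: int
    have e: "expand omega_wz p k l = (if k < 0 \<and> l < 0 then f (nat (- k - 1)) (nat (- l - 1)) else 0) +
        (\<Sum>n<M. if k < 0 \<and> l = int n then h n (nat (- k - 1)) else 0) +
        (\<Sum>m<M. if k = int m \<and> l < 0 then g m (nat (- l - 1)) else 0) +
        (\<Sum>m<M. \<Sum>n<M. if k = int m \<and> l = int n then c m n else 0) +
        (\<Sum>n<N. if k < 0 \<and> l \<ge> 0 \<and> l + k - int n < 0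
          then (-1) ^ n * of_nat (nat (int n - k - 1) choose n) * \<rho> n (nat (int n - k - l - 1)) else 0) +
        (\<Sum>n<N. \<Sum>j<M. 0)"
      unfolding p_def expand_sum_words[OF fin]
      unfolding sum_local_words word_expand_local[OF disjI2[OF refl]] word_expand_local_wz by (rule refl)
    show "expand omega_wz p k l = matrix_BA \<phi> r s A B v k l"
    proof (cases "k < 0"; cases "l < 0")
      assume kl: "k < 0" "l < 0"
      obtain i j where i: "k = - int i - 1" "nat (- k - 1) = i" and j: "l = - int j - 1" "nat (- l - 1) = j"
        using neg[OF kl(1)] neg[OF kl(2)] by blast
      have "f i j = ksign (r * s) * \<phi> (B (- int j - 1) (A (- int i - 1) v))"
        unfolding f_def creation[OF v] by (rule \<phi>_scale[OF _ v]) (intro AW BW v)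
      then show ?thesis using kl unfolding e by (simp add: matrix_BA_def i j)
    next
      assume kl: "\<not> k < 0" "l < 0"
      obtain m j where j: "l = - int j - 1" "nat (- l - 1) = j" and m: "k = int m" using neg[OF kl(2)] nneg[OF kl(1)] by blast
      have "g m j = 0" if "m \<ge> M" using that by (simp add: g_def M lin0 \<phi>_0)
      then have 1: "(\<Sum>m'<M. if k = int m' \<and> l < 0 then g m' (nat (- l - 1)) else 0) = g m j"
        using kl by (auto simp: j m)
      have "ksign (r * s) * ksign s = ksign ((r - 1) * s)" by (simp add: ksign_def)
      then show ?thesis using kl unfolding e 1 by (simp add: delta matrix_BA_def m j(1) g_def)
    next
      assume kl: "\<not> k < 0" "\<not> l < 0"
      obtain m n where m: "k = int m" and n: "l = int n" using nneg[OF kl(1)] nneg[OF kl(2)] by blast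
      have c0: "c m n = 0" if "m \<ge> M \<or> n \<ge> M" using that by (auto simp: c_def M lin0 \<phi>_0)
      have 1: "(\<Sum>m'<M. \<Sum>n'<M. if k = int m' \<and> l = int n' then c m' n' else 0) = c m n"
      proof -
        have "(\<Sum>m'<M. \<Sum>n'<M. if k = int m' \<and> l = int n' then c m' n' else 0) =
            (\<Sum>m'<M. if m' = m then (\<Sum>n'<M. if n' = n then c m n else 0) else 0)"
          by (intro sum.cong refl) (auto simp: m n intro!: sum.neutral sum.cong)
        with c0 show ?thesis by auto
      qed
      have "ksign (r * s) * (- ksign (s - 1)) = ksign ((r - 1) * s)" by (simp add: ksign_def)
      then show ?thesis using kl unfolding e 1 by (simp add: matrix_BA_def m n c_def)
    next
      assume kl: "k < 0" "\<not> l < 0"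
      obtain i n where i: "k = - int i - 1" "nat (- k - 1) = i" and n: "l = int n" using neg[OF kl(1)] nneg[OF kl(2)] by blast
      have "h n i = 0" if "n \<ge> M" using that by (simp add: h_def M lin0 \<phi>_0)
      then have 1: "(\<Sum>n'<M. if k < 0 \<and> l = int n' then h n' (nat (- k - 1)) else 0) = h n i"
        using kl by (auto simp: delta i n)
      have "(if k < 0 \<and> l \<ge> 0 \<and> l + k - int n' < 0
            then (-1) ^ n' * of_nat (nat (int n' - k - 1) choose n') * \<rho> n' (nat (int n' - k - l - 1)) else 0) =
          ((-1) ^ n' * of_nat (n' + i choose n')) * \<phi> (u n' (int n' + int i - int n) v)" for n'
      proof -
        have "nat (int n' - k - 1) = n' + i" by (simp add: i(1))
        then show ?thesis
          using u_neg[OF v, of "int n' + int i - int n" n'] kl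
          by (auto simp: n i(1) \<rho>_def \<phi>_0 algebra_simps)
      qed
      then have 2: "(\<Sum>n'<N. if k < 0 \<and> l \<ge> 0 \<and> l + k - int n' < 0
            then (-1) ^ n' * of_nat (nat (int n' - k - 1) choose n') * \<rho> n' (nat (int n' - k - l - 1)) else 0) =
          (\<Sum>n'<N. ((-1) ^ n' * of_nat (n' + i choose n')) * \<phi> (u n' (int n' + int i - int n) v))" by simp
      let ?S = "\<Sum>k<N. ((-1) ^ k * of_nat (k + i choose k)) *\<^sub>c u k (int k + int i - int n) v"
      have "matrix_BA \<phi> r s A B v k l = ksign (r * s) * \<phi> (B (int n) (A (- int i - 1) v))"
        by (simp add: matrix_BA_def i(1) n)
      also have "\<dots> = ksign (r * s) * (ksign (r * (s - 1)) * \<phi> (A (- int i - 1) (B (int n) v)) + ksign (r * s) * \<phi> ?S)"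
        unfolding right[OF v]
        by (subst \<phi>_add, intro Wc AW BW v, intro Wc u v, subst \<phi>_scale[OF _ v], intro AW BW v,
            subst \<phi>_scale[OF _ v], intro Wc u v) simp
      also have "\<dots> = (ksign (r * s) * ksign (r * (s - 1))) * \<phi> (A (- int i - 1) (B (int n) v)) + \<phi> ?S"
        by (simp add: distrib_left flip: mult.assoc)
      also have "ksign (r * s) * ksign (r * (s - 1)) = ksign r" by (simp add: ksign_def)
      also have "\<phi> ?S = (\<Sum>n'<N. ((-1) ^ n' * of_nat (n' + i choose n')) * \<phi> (u n' (int n' + int i - int n) v))"
        by (subst linear_on_sum[OF \<phi> W], rule u, rule v) (simp add: cscale_complex_def)
      finally show ?thesis
        unfolding e 1 2 using kl by (simp add: h_def)
    qed
  qed
  let ?X = "{q. q - p \<in> kzw_ideal}"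
  have pX: "p \<in> ?X" by (simp add: kzw_ideal.zero)
  have keys_ok: "\<forall>w\<in>Poly_Mapping.keys p. \<forall>k. Om Pzw k \<in> set w \<longrightarrow> k < N"
  proof -
    have "Poly_Mapping.lookup p w = (if w \<in> local_words N M then ?co w else 0)" for w
      using fin by (simp add: p_def lookup_sum lookup_single when_def)
    then have "Poly_Mapping.keys p \<subseteq> local_words N M" by (auto simp: in_keys_iff split: if_splits)
    then show ?thesis by (force simp: local_words_def)
  qed
  show "\<exists>X\<in>kzw. pole_order_le N X \<and> (\<exists>p\<in>X. expand omega_zw p = matrix_AB \<phi> r A B v) \<and>
      (\<exists>q\<in>X. expand omega_wz q = matrix_BA \<phi> r s A B v)"
  proof (rule bexI[of _ ?X], intro conjI)
    show "?X \<in> kzw" unfolding kzw_def by blast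
    show "pole_order_le N ?X" unfolding pole_order_le_def using pX keys_ok by blast
    show "\<exists>p\<in>?X. expand omega_zw p = matrix_AB \<phi> r A B v" using pX zw by blast
    show "\<exists>q\<in>?X. expand omega_wz q = matrix_BA \<phi> r s A B v" using pX wz by blast
  qed
qed

section \<open>Gradings of the direct sum of Fock modules\<close>

lemma c_action_central: "cc 0 (fock_action x v) = fock_action x (cc 0 v)"
proof -
  obtain f p g q k where x: "x = Heis f p g q k" by (cases x)
  have "pairing 1 q = 0" by (simp add: pairing_def)
  then show ?thesis
    by (simp add: x cc_def fock_action_split[of f p g q k] fock_action_simps smeared_commutators(1)[of 1 f]
        smeared_commutators(3)[of 1 q] smeared_commutators(7)[of 1 p] smeared_commutators(8)[of 1 g])
qed

text \<open>The common form of the gradings by degree and by spin.\<close>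

definition word_grading :: "(int \<Rightarrow> heis set) \<Rightarrow> int \<Rightarrow> lattice_fock set" where
  "word_grading H n = cs.span {foldr fock_action xs (fock_ket m) | m xs ds.
     list_all2 (\<lambda>x d. x \<in> H d) xs ds \<and> sum_list ds = n}"

lemma fock_degree_words: "fock_degree = word_grading heis_degree" and fock_spin_words: "fock_spin = word_grading heis_spin"
  by (simp_all add: fun_eq_iff fock_degree_def fock_spin_def word_grading_def)

lemma subspace_word_grading: "cs.subspace (word_grading H n)"
  by (simp add: word_grading_def)

lemma word_grading_induct [consumes 1, case_names zero add word]:
  assumes "v \<in> word_grading H n" and "P 0" "\<And>a v w. P v \<Longrightarrow> P w \<Longrightarrow> P (a *\<^sub>c v + w)"
    and "\<And>m xs ds. list_all2 (\<lambda>x d. x \<in> H d) xs ds \<Longrightarrow> sum_list ds = n \<Longrightarrow> P (foldr fock_action xs (fock_ket m))"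
  shows "P v"
  using assms(1) unfolding word_grading_def
  by (induction rule: cs.span_induct_alt) (use assms(2-) in blast)+

lemma word_grading_action:
  assumes x: "x \<in> H d" and v: "v \<in> word_grading H n"
  shows "fock_action x v \<in> word_grading H (n + d)"
  using v
proof (induction rule: word_grading_induct)
  case (word m xs ds)
  then have "fock_action x (foldr fock_action xs (fock_ket m)) = foldr fock_action (x # xs) (fock_ket m)"
    "list_all2 (\<lambda>x d. x \<in> H d) (x # xs) (d # ds)" "sum_list (d # ds) = n + d" using x by simp_all
  then show ?case unfolding word_grading_def by (intro cs.span_base) blast
qed (simp_all add: fock_action_simps subspace_word_grading cs.subspace_0 cs.subspace_add cs.subspace_scale)

lemma word_grading_ket: "fock_ket m \<in> word_grading H 0"
proof -
  have "fock_ket m = foldr fock_action [] (fock_ket m)" "list_all2 (\<lambda>x d. x \<in> H d) [] []" "sum_list [] = (0::int)"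
    by simp_all
  then show ?thesis unfolding word_grading_def by (intro cs.span_base CollectI) blast
qed

lemma word_grading_eigen:
  assumes g: "clinear g" "\<And>m. g (fock_ket m) = fock_ket m" and t: "t \<noteq> 0"
    and act: "\<And>x d v. x \<in> H d \<Longrightarrow> g (fock_action x v) = t powi d *\<^sub>c fock_action x (g v)"
    and v: "v \<in> word_grading H n"
  shows "g v = t powi n *\<^sub>c v"
  using v
proof (induction rule: word_grading_induct)
  case (word m xs ds)
  from word(1) have "g (foldr fock_action xs (fock_ket m)) = t powi (sum_list ds) *\<^sub>c foldr fock_action xs (fock_ket m)"
    by (induction rule: list_all2_induct) (simp_all add: g act fock_action_simps power_int_add t)
  then show ?case by (simp add: word(2))
qed (simp_all add: clinear_simps[OF g(1)] cs.scale_right_distrib mult.commute)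

lemmas subspace_fock_degree = subspace_word_grading[of heis_degree, folded fock_degree_words]
lemmas subspace_fock_spin = subspace_word_grading[of heis_spin, folded fock_spin_words]
lemmas fock_action_degree = word_grading_action[of _ heis_degree, folded fock_degree_words]
lemmas fock_action_spin = word_grading_action[of _ heis_spin, folded fock_spin_words]
lemmas fock_ket_degree = word_grading_ket[of _ heis_degree, folded fock_degree_words]
lemmas fock_ket_spin = word_grading_ket[of _ heis_spin, folded fock_spin_words]

lemma creation_degree: "v \<in> fock_degree n \<Longrightarrow> bb k v \<in> fock_degree n" "v \<in> fock_degree n \<Longrightarrow> nn k v \<in> fock_degree (n + 1)"
  using fock_action_degree[of "Heis 0 0 0 (monom 1 k) 0" 0 v n] fock_action_degree[of "Heis 0 (monom 1 k) 0 0 0" 1 v n]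
  by (simp_all add: bb_def nn_def heis_degree_def)

lemma creation_spin: "v \<in> fock_spin n \<Longrightarrow> bb k v \<in> fock_spin (n + int (Suc k))"
  "v \<in> fock_spin n \<Longrightarrow> nn k v \<in> fock_spin (n + int (Suc k))"
  using fock_action_spin[of "Heis 0 0 0 (monom 1 k) 0" "int (Suc k)" v n]
    fock_action_spin[of "Heis 0 (monom 1 k) 0 0 0" "int (Suc k)" v n]
  by (auto simp: bb_def nn_def heis_spin_def)

lemma scal_smeared_degree:
  assumes "t \<noteq> 0"
  defines "g \<equiv> scal (\<lambda>_. 1) (\<lambda>_. t)"
  shows "g (c_act f v) = c_act f (g v)" "g (\<phi>_act f v) = inverse t *\<^sub>c \<phi>_act f (g v)"
    "g (b_act p v) = b_act p (g v)" "g (\<nu>_act p v) = t *\<^sub>c \<nu>_act p (g v)"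
proof -
  obtain N1 N2 where "\<forall>N\<ge>N1. \<forall>f. c_act f v = (\<Sum>n<N. fps_nth f n *\<^sub>c cc n v) \<and> \<phi>_act f v = (\<Sum>n<N. fps_nth f n *\<^sub>c \<phi>_act (fps_X ^ n) v)"
    "\<forall>N\<ge>N2. \<forall>f. c_act f (g v) = (\<Sum>n<N. fps_nth f n *\<^sub>c cc n (g v)) \<and>
      \<phi>_act f (g v) = (\<Sum>n<N. fps_nth f n *\<^sub>c \<phi>_act (fps_X ^ n) (g v))"
    using smeared_as_finite_sum[of v] smeared_as_finite_sum[of "g v"] by blast
  then obtain N where N: "\<And>f. c_act f v = (\<Sum>n<N. fps_nth f n *\<^sub>c cc n v)" "\<And>f. \<phi>_act f v = (\<Sum>n<N. fps_nth f n *\<^sub>c \<phi>_act (fps_X ^ n) v)"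
    "\<And>f. c_act f (g v) = (\<Sum>n<N. fps_nth f n *\<^sub>c cc n (g v))" "\<And>f. \<phi>_act f (g v) = (\<Sum>n<N. fps_nth f n *\<^sub>c \<phi>_act (fps_X ^ n) (g v))"
    by (meson max.cobounded1 max.cobounded2)
  have cc: "g (cc n v) = cc n (g v)" for n
    unfolding g_def using scal_cc[of "\<lambda>_. 1" "\<lambda>_. 1" "\<lambda>_. t" n v] by simp
  have dd: "g (dd n v) = inverse t *\<^sub>c dd n (g v)" for n
    unfolding g_def using scal_dd[of "\<lambda>_. t" "\<lambda>_. inverse t" "\<lambda>_. 1" n v] assms(1) by simp
  have \<phi>: "g (\<phi>_act (fps_X ^ n) v) = inverse t *\<^sub>c \<phi>_act (fps_X ^ n) (g v)" for n
  proof (cases n)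
    case 0
    then show ?thesis by (simp add: \<phi>_0 g_def scal_simps)
  next
    case (Suc k)
    show ?thesis unfolding Suc \<phi>_act_Suc using dd[of k] by (simp add: g_def scal_simps mult.commute)
  qed
  show "g (c_act f v) = c_act f (g v)"
    unfolding N(1)[of f] N(3)[of f] by (simp add: g_def scal_simps cc[unfolded g_def])
  show "g (\<phi>_act f v) = inverse t *\<^sub>c \<phi>_act f (g v)"
    unfolding N(2)[of f] N(4)[of f] by (simp add: g_def scal_simps \<phi>[unfolded g_def] cs.scale_sum_right mult.commute)
  show "g (b_act p v) = b_act p (g v)" "g (\<nu>_act p v) = t *\<^sub>c \<nu>_act p (g v)"
    unfolding b_act_sum[of p] \<nu>_act_sum[of p] by (simp_all add: g_def scal_simps scal_rec cs.scale_sum_right mult.commute)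
qed

lemma scal_degree_action:
  assumes "t \<noteq> 0" "x \<in> heis_degree d"
  shows "scal (\<lambda>_. 1) (\<lambda>_. t) (fock_action x v) = t powi d *\<^sub>c fock_action x (scal (\<lambda>_. 1) (\<lambda>_. t) v)"
proof -
  obtain f p g q k where x: "x = Heis f p g q k" by (cases x)
  consider "d = 0" "p = 0" "g = 0" | "d = 1" "f = 0" "q = 0" "k = 0" "g = 0" | "d = -1" "f = 0" "q = 0" "k = 0" "p = 0"
    | "f = 0" "q = 0" "k = 0" "p = 0" "g = 0"
    using assms(2) by (auto simp: x heis_degree_def)
  then show ?thesis
    by cases (simp_all add: x fock_action_split[of f p g q k] fock_action_split[of f 0 0 q k]
      scal_smeared_degree[OF assms(1)] scal_simps)
qed

lemma scal_degree_eigen: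
  assumes "t \<noteq> 0" "v \<in> fock_degree n"
  shows "scal (\<lambda>_. 1) (\<lambda>_. t) v = t powi n *\<^sub>c v"
  by (rule word_grading_eigen[where H = heis_degree])
    (use assms in \<open>simp_all add: clinear_scal scal_rec scal_degree_action fock_degree_words\<close>)

abbreviation deg_op :: "lattice_fock \<Rightarrow> lattice_fock" where "deg_op \<equiv> scal (\<lambda>_. 1) (\<lambda>_. 2)"
abbreviation spin_op :: "lattice_fock \<Rightarrow> lattice_fock" where "spin_op \<equiv> scal (\<lambda>n. 2 * 2 ^ n) (\<lambda>n. 2 * 2 ^ n)"

lemma has_parity_degree: "v \<in> fock_degree r \<Longrightarrow> has_parity r v"
  using scal_degree_eigen[of "-1" v r] by (simp add: has_parity_def par_def ksign_def power_int_minus_left)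

lemma spin_op_cc: "spin_op (cc n v) = 2 powi (- int n) *\<^sub>c cc n (spin_op v)"
  using scal_cc[of "\<lambda>n. 2 * 2 ^ n" "\<lambda>n. inverse (2 ^ n)" "\<lambda>n. 2 * 2 ^ n" n v]
  by (simp add: power_int_minus)

lemma spin_op_dd: "spin_op (dd n v) = 2 powi (- int (Suc n)) *\<^sub>c dd n (spin_op v)"
  using scal_dd[of "\<lambda>n. 2 * 2 ^ n" "\<lambda>n. inverse (2 ^ Suc n)" "\<lambda>n. 2 * 2 ^ n" n v]
  by (simp add: power_int_minus del: of_nat_Suc)

lemma spin_op_\<phi>: "spin_op (\<phi>_act (fps_X ^ n) v) = 2 powi (- int n) *\<^sub>c \<phi>_act (fps_X ^ n) (spin_op v)"
proof (cases n)
  case 0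
  then show ?thesis by (simp add: \<phi>_0 scal_simps)
next
  case (Suc k)
  show ?thesis unfolding Suc \<phi>_act_Suc by (simp add: scal_simps spin_op_dd mult.commute del: of_nat_Suc power_Suc)
qed

lemma fps_single: "(\<And>m. m \<noteq> n \<Longrightarrow> fps_nth f m = 0) \<Longrightarrow> f = fps_const (fps_nth f n) * fps_X ^ n"
  by (rule fps_ext) (auto simp: fps_X_power_nth)

lemma poly_single: "(\<And>m. m \<noteq> n \<Longrightarrow> coeff p m = 0) \<Longrightarrow> p = smult (coeff p n) (monom 1 n)" for p :: "complex poly"
  by (rule poly_eqI) auto

lemma spin_op_action:
  assumes "x \<in> heis_spin s"
  shows "spin_op (fock_action x v) = 2 powi s *\<^sub>c fock_action x (spin_op v)"
proof -
  obtain f p g q k where x: "x = Heis f p g q k" by (cases x)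
  note h = assms[unfolded x heis_spin_def, simplified]
  show ?thesis
  proof (cases "s \<le> 0")
    case True
    then obtain n where s: "s = - int n" by (metis nonpos_int_cases)
    have fg: "f = fps_const (fps_nth f n) * fps_X ^ n" "g = fps_const (fps_nth g n) * fps_X ^ n"
      by (rule fps_single; use h in \<open>auto simp: s\<close>)+
    have pq: "p = 0" "q = 0" using h by (auto simp: s intro!: poly_eqI)
    have act: "fock_action x w = fps_nth f n *\<^sub>c cc n w + fps_nth g n *\<^sub>c \<phi>_act (fps_X ^ n) w + k *\<^sub>c w" for w
      unfolding x fock_action_split[of f p g q k]
      by (subst fg(1), subst fg(2)) (simp add: pq smeared_linear cc_def)
    have "k = 0 \<or> s = 0" using h by auto
    then show ?thesis
      unfolding act by (auto simp: scal_simps spin_op_cc spin_op_\<phi> \<phi>_0 s cs.scale_right_distrib mult.commute)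
  next
    case False
    then obtain n where s: "s = int (Suc n)" by (metis int_nat_eq linorder_not_le nat_0_iff not0_implies_Suc order_less_imp_le)
    have fg: "f = 0" "g = 0" "k = 0" using h by (auto simp: s intro!: fps_ext)
    have pq: "p = smult (coeff p n) (monom 1 n)" "q = smult (coeff q n) (monom 1 n)"
      by (rule poly_single; use h in \<open>auto simp: s\<close>)+
    have act: "fock_action x w = coeff p n *\<^sub>c nn n w + coeff q n *\<^sub>c bb n w" for w
      unfolding x fock_action_split[of f p g q k]
      by (subst pq(1), subst pq(2)) (simp add: fg smeared_linear bb_def nn_def del: smult_monom)
    have "(2::complex) powi s = 2 ^ Suc n" by (simp only: s power_int_of_nat)
    then show ?thesis
      unfolding act by (simp add: scal_simps scal_rec cs.scale_right_distrib mult.commute)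
  qed
qed

lemma spin_op_eigen:
  assumes "v \<in> fock_spin n"
  shows "spin_op v = 2 powi n *\<^sub>c v"
  by (rule word_grading_eigen[where H = heis_spin])
    (use assms in \<open>simp_all add: clinear_scal scal_rec spin_op_action fock_spin_words\<close>)

text \<open>Creation operators shift the weight, so the decomposable vectors are closed under all steps of
  \<open>creation_induct\<close>.\<close>

lemma creation_decomposition:
  assumes sub: "\<And>n. cs.subspace (G n)" and ket: "\<And>m. fock_ket m \<in> G (w m)"
    and bb: "\<And>k n v. v \<in> G n \<Longrightarrow> bb k v \<in> G (n + wb k)" and nn: "\<And>k n v. v \<in> G n \<Longrightarrow> nn k v \<in> G (n + wn k)"
  shows "\<exists>g :: int \<Rightarrow> lattice_fock. (\<forall>n. g n \<in> G n) \<and> finite {n. g n \<noteq> 0} \<and> v = (\<Sum>n | g n \<noteq> 0. g n)"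
proof -
  define P where "P v \<longleftrightarrow> (\<exists>(g :: int \<Rightarrow> lattice_fock) A. (\<forall>n. g n \<in> G n) \<and> finite A \<and> (\<forall>n. n \<notin> A \<longrightarrow> g n = 0) \<and> v = (\<Sum>n\<in>A. g n))" for v
  note s0 = cs.subspace_0[OF sub]
  have lin: "P (f v)" if P: "P v" and f: "clinear f" "\<And>n v. v \<in> G n \<Longrightarrow> f v \<in> G (n + j)" for f v j
  proof -
    obtain g A where g: "\<forall>n. g n \<in> G n" "finite A" "\<forall>n. n \<notin> A \<longrightarrow> g n = 0" "v = (\<Sum>n\<in>A. g n)"
      using P unfolding P_def by blast
    have "f v = (\<Sum>n\<in>(\<lambda>n. n + j) ` A. f (g (n - j)))"
      by (simp add: g(4) clinear_sum[OF f(1)] sum.reindex)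
    moreover have "f (g (n - j)) \<in> G n" for n using f(2)[of "g (n - j)" "n - j"] g(1) by simp
    moreover have "f (g (n - j)) = 0" if "n \<notin> (\<lambda>n. n + j) ` A" for n
      using that g(3) by (metis clinear_0 f(1) diff_add_cancel image_eqI)
    ultimately show ?thesis unfolding P_def using g(2) by (intro exI[of _ "\<lambda>n. f (g (n - j))"] exI[of _ "(\<lambda>n. n + j) ` A"]) simp
  qed
  have "P v"
  proof (induction v rule: creation_induct)
    case (add v v')
    obtain g A where g: "\<forall>n. g n \<in> G n" "finite A" "\<forall>n. n \<notin> A \<longrightarrow> g n = 0" "v = (\<Sum>n\<in>A. g n)"
      using add(1) unfolding P_def by blast
    obtain g' A' where g': "\<forall>n. g' n \<in> G n" "finite A'" "\<forall>n. n \<notin> A' \<longrightarrow> g' n = 0" "v' = (\<Sum>n\<in>A'. g' n)"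
      using add(2) unfolding P_def by blast
    have "v = (\<Sum>n\<in>A \<union> A'. g n)" unfolding g(4) by (rule sum.mono_neutral_left) (use g g' in auto)
    moreover have "v' = (\<Sum>n\<in>A \<union> A'. g' n)" unfolding g'(4) by (rule sum.mono_neutral_left) (use g g' in auto)
    ultimately have "v + v' = (\<Sum>n\<in>A \<union> A'. g n + g' n)" by (simp add: sum.distrib)
    moreover have "\<forall>n. g n + g' n \<in> G n" using g(1) g'(1) cs.subspace_add[OF sub] by blast
    ultimately show ?case
      unfolding P_def using g(2,3) g'(2,3)
      by (intro exI[of _ "\<lambda>n. g n + g' n"] exI[of _ "A \<union> A'"] conjI) (assumption | simp)+
  next
    case (scale a v)
    have sc: "a *\<^sub>c v \<in> G (n + 0)" if "v \<in> G n" for n v using that cs.subspace_scale[OF sub] by simp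
    show ?case by (rule lin[OF scale _ sc]) (rule clinear_scale_fun[OF clinear_id])
  next
    case (ket m)
    have "\<forall>n. (if n = w m then fock_ket m else 0) \<in> G n" using assms(2) s0 by simp
    then show ?case unfolding P_def by (intro exI[of _ "\<lambda>n. if n = w m then fock_ket m else 0"] exI[of _ "{w m}"]) simp
  next
    case (bb k v)
    then show ?case by (rule lin[OF _ clinear_bb assms(3)])
  next
    case (nn k v)
    then show ?case by (rule lin[OF _ clinear_nn assms(4)])
  qed
  then obtain g A where g: "\<forall>n. g n \<in> G n" "finite A" "\<forall>n. n \<notin> A \<longrightarrow> g n = 0" "v = (\<Sum>n\<in>A. g n)"
    unfolding P_def by blast
  have "{n. g n \<noteq> 0} \<subseteq> A" using g(3) by auto
  then have "finite {n. g n \<noteq> 0}" using g(2) by (rule finite_subset)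
  moreover have "v = (\<Sum>n | g n \<noteq> 0. g n)" using sum_nonzero_support[OF g(2), of g] g(3,4) by simp
  ultimately show ?thesis using g(1) by blast
qed

lemma fock_degree_grading: "grading_on UNIV fock_degree" and fock_degree_eq: "fock_degree n = {v. deg_op v = 2 powi n *\<^sub>c v}"
proof -
  have ex: "\<exists>g. (\<forall>n. g n \<in> fock_degree n) \<and> finite {n. g n \<noteq> 0} \<and> v = (\<Sum>n | g n \<noteq> 0. g n)" for v
    by (rule creation_decomposition[where w = "\<lambda>_. 0" and wb = "\<lambda>_. 0" and wn = "\<lambda>_. 1"])
      (simp_all add: subspace_fock_degree fock_ket_degree creation_degree)
  show "grading_on UNIV fock_degree" "fock_degree n = {v. deg_op v = 2 powi n *\<^sub>c v}"
    by (rule grading_by_eigenvalues[OF clinear_scal subspace_fock_degree scal_degree_eigen ex]; simp)+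
qed

lemma fock_spin_decomposition:
  "\<exists>g. (\<forall>n. g n \<in> fock_spin n) \<and> finite {n. g n \<noteq> 0} \<and> v = (\<Sum>n | g n \<noteq> 0. g n)"
  by (rule creation_decomposition[where w = "\<lambda>_. 0" and wb = "\<lambda>k. int (Suc k)" and wn = "\<lambda>k. int (Suc k)"])
    (simp_all add: subspace_fock_spin fock_ket_spin creation_spin del: of_nat_Suc)

lemma fock_spin_grading: "grading_on UNIV fock_spin" and fock_spin_eq: "fock_spin n = {v. spin_op v = 2 powi n *\<^sub>c v}"
  by (rule grading_by_eigenvalues[OF clinear_scal subspace_fock_spin spin_op_eigen fock_spin_decomposition]; simp)+

text \<open>The components of a vector in the subspaces \<open>G m\<close> are eigenvectors of \<open>c\<^sub>0\<close> for different eigenvalues; if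
  \<open>c\<^sub>0\<close> kills the vector, only the component in \<open>G 0\<close> survives.\<close>

lemma charge_zero:
  assumes sub: "\<And>n. cs.subspace (G n)" and eig: "\<And>n v. v \<in> G n \<Longrightarrow> cc 0 v = of_int n *\<^sub>c v"
    and ket: "\<And>m. fock_ket m \<in> G m"
    and bb: "\<And>k n v. v \<in> G n \<Longrightarrow> bb k v \<in> G n" and nn: "\<And>k n v. v \<in> G n \<Longrightarrow> nn k v \<in> G n"
    and v: "cc 0 v = 0"
  shows "v \<in> G 0"
proof -
  have "\<exists>g :: int \<Rightarrow> lattice_fock. (\<forall>n. g n \<in> G n) \<and> finite {n. g n \<noteq> 0} \<and> v = (\<Sum>n | g n \<noteq> 0. g n)"
    by (rule creation_decomposition[where w = "\<lambda>m. m" and wb = "\<lambda>_. 0" and wn = "\<lambda>_. 0"])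
      (simp_all add: sub ket bb nn)
  then obtain g where g: "\<forall>n. g n \<in> G n" "finite {n. g n \<noteq> 0}" "v = (\<Sum>n | g n \<noteq> 0. g n)" by blast
  have e: "cc 0 (g n) = of_int n *\<^sub>c g n" for n using g(1) eig by blast
  have s: "(\<Sum>n | g n \<noteq> 0. of_int n *\<^sub>c g n) = 0"
    using v by (simp add: g(3) clinear_sum[OF clinear_cc] e)
  have "of_int n *\<^sub>c g n = 0" if "n \<in> {n. g n \<noteq> 0}" for n
    by (rule eigenvectors_sum_zero[OF clinear_cc[of 0] g(2), of of_int "\<lambda>n. of_int n *\<^sub>c g n" n])
      (use that s in \<open>auto simp: inj_on_def clinear_simps[OF clinear_cc] e\<close>)
  then have "{n. g n \<noteq> 0} \<subseteq> {0}" by auto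
  then have "v = (\<Sum>n\<in>{0}. g n)" unfolding g(3) by (intro sum.mono_neutral_left) auto
  then show ?thesis using g(1) by simp
qed

lemma fock_action_class: "fock_action x (fock_class m t) = fock_class m (word [x] \<star> t)"
  unfolding fock_class_def fock_action.abs_eq
  by (rule arg_cong[where f = abs_lattice_fock], rule poly_mapping_eqI) (simp add: lookup_map_fmul lookup_single when_def)

lemma subspace_fock: "cs.subspace (fock m)"
  unfolding fock_def cs.subspace_def
  using clinear_add[OF clinear_fock_class, symmetric] clinear_scale[OF clinear_fock_class, symmetric]
    clinear_0[OF clinear_fock_class, symmetric, of m]
  by (metis (no_types, opaque_lifting) rangeE rangeI)

lemma cc_0_fock: "v \<in> fock m \<Longrightarrow> cc 0 v = of_int m *\<^sub>c v"
proof -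
  have "cc 0 (fock_class m t) = of_int m *\<^sub>c fock_class m t" for t
  proof (induction t rule: poly_mapping_additive_induct)
    case (single u a)
    have "cc 0 (foldr fock_action u (fock_ket m)) = of_int m *\<^sub>c foldr fock_action u (fock_ket m)"
      by (induction u) (simp_all add: cc_ket c_action_central fock_action_simps)
    then show ?case by (simp add: fock_class_single clinear_simps[OF clinear_cc] mult.commute)
  qed (simp add: clinear_simps[OF clinear_cc] clinear_simps[OF clinear_fock_class] cs.scale_right_distrib)
  then show "v \<in> fock m \<Longrightarrow> cc 0 v = of_int m *\<^sub>c v" unfolding fock_def by blast
qed

lemma fock_0_eq: "fock 0 = {v. cc 0 v = 0}"
proof
  show "fock 0 \<subseteq> {v. cc 0 v = 0}" using cc_0_fock[of _ 0] by auto
  have ket: "fock_ket m \<in> fock m" for m by (simp add: fock_ket_def fock_def)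
  have act: "fock_action x v \<in> fock m" if "v \<in> fock m" for x v m
    using that by (auto simp: fock_def fock_action_class)
  show "{v. cc 0 v = 0} \<subseteq> fock 0"
    using charge_zero[OF subspace_fock cc_0_fock ket] act by (auto simp: bb_def nn_def)
qed

text \<open>The multiples of \<open>S\<close> by the vectors \<open>|m\<rangle>\<close> contain all creation monomials, and those with \<open>m \<noteq> 0\<close> have nonzero
  charge.\<close>

lemma fock_0_created:
  assumes sub: "cs.subspace S" and ket: "fock_ket 0 \<in> S"
    and bb: "\<And>k v. v \<in> S \<Longrightarrow> bb k v \<in> S" and nn: "\<And>k v. v \<in> S \<Longrightarrow> nn k v \<in> S" and S: "S \<subseteq> fock 0"
  shows "fock 0 \<subseteq> S"
proof
  fix v assume "v \<in> fock 0"
  then have v: "cc 0 v = 0" by (simp add: fock_0_eq)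
  note sh = clinear_simps[OF clinear_shift]
  have cs: "cc 0 (shift m v) = shift m (cc 0 v) + of_int m *\<^sub>c shift m v" for m v
    using cc_mul[of 0 "fock_ket m" v] by (simp add: mul_rec cc_ket mul_simps)
  have "v \<in> shift 0 ` S"
  proof (rule charge_zero[where G = "\<lambda>m. shift m ` S"])
    show "cs.subspace (shift m ` S)" for m
      unfolding cs.subspace_def
    proof (intro conjI ballI allI)
      show "0 \<in> shift m ` S" using cs.subspace_0[OF sub] by (metis sh(3) imageI)
      fix x assume "x \<in> shift m ` S"
      then obtain x' where x: "x = shift m x'" "x' \<in> S" by blast
      show "c *\<^sub>c x \<in> shift m ` S" for c
        unfolding x(1) sh(2)[symmetric] using cs.subspace_scale[OF sub x(2)] by blast
      fix y assume "y \<in> shift m ` S"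
      then obtain y' where y: "y = shift m y'" "y' \<in> S" by blast
      show "x + y \<in> shift m ` S"
        unfolding x(1) y(1) sh(1)[symmetric] using cs.subspace_add[OF sub x(2) y(2)] by blast
    qed
    show "fock_ket m \<in> shift m ` S" for m using ket shift_rec(1)[of m 0] by (metis add_0 imageI)
    show "bb k v \<in> shift n ` S" if "v \<in> shift n ` S" for k n v
      using that bb by (auto simp flip: shift_rec)
    show "nn k v \<in> shift n ` S" if "v \<in> shift n ` S" for k n v
      using that nn by (auto simp flip: shift_rec)
    show "cc 0 v = of_int n *\<^sub>c v" if v: "v \<in> shift n ` S" for n v
    proof -
      obtain u where u: "v = shift n u" "u \<in> S" using v by blast
      then have "cc 0 u = 0" using S by (auto simp: fock_0_eq)
      then show ?thesis by (simp add: u(1) cs sh)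
    qed
  qed (rule v)
  moreover have "shift 0 w = w" for w using mul_1_left[of w] by (simp add: mul_rec)
  ultimately show "v \<in> S" by auto
qed

section \<open>The modes\<close>

definition md :: "lattice_fock \<Rightarrow> int \<Rightarrow> lattice_fock \<Rightarrow> lattice_fock" where
  "md a m v = (if m < 0 then mul (Tp (- m - 1) a) v else br m a v)"

lemma md_neg [simp]: "md a (- int j - 1) v = mul (Tp (int j) a) v" and md_nonneg [simp]: "md a (int m) v = br (int m) a v"
  by (simp_all add: md_def)

lemma md_cases:
  obtains j where "m = - int j - 1" | j where "m = int j"
proof (cases "m < 0")
  case True
  then show ?thesis using that(1)[of "nat (- m - 1)"] by simp
next
  case False
  then show ?thesis using that(2)[of "nat m"] by simp
qed

lemma clinear_md: "clinear (\<lambda>a. md a m v)" "clinear (md a m)"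
  by (auto simp: clinear_def md_def mul_simps Tp_simps br_simps)

lemma tr_md: "tr (md a m v) - md a m (tr v) = of_int (- m) *\<^sub>c md a (m - 1) v"
proof (cases m rule: md_cases)
  case (1 j)
  have "md a (m - 1) v = mul (Tp (int j + 1) a) v" by (simp add: md_def 1 add.commute)
  then show ?thesis by (simp add: 1 tr_mul tr_Tp mul_simps)
next
  case (2 j)
  show ?thesis by (cases j) (simp_all add: 2 tr_br md_def cs.scale_left_diff_distrib cs.scale_left_distrib)
qed

lemma scal_Tp:
  assumes "\<And>v. scal l k (tr v) = t *\<^sub>c tr (scal l k v)"
  shows "scal l k (Tp r w) = (if r < 0 then 0 else t ^ nat r *\<^sub>c Tp r (scal l k w))"
proof -
  have "scal l k ((tr ^^ j) w) = t ^ j *\<^sub>c (tr ^^ j) (scal l k w)" for j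
    by (induction j) (simp_all add: assms tr_simps mult.commute)
  then show ?thesis by (simp add: Tp_def scal_simps mult.commute)
qed

text \<open>A scaling automorphism is compatible with the brackets when the factors of \<open>T\<^bsup>(m+i-n)\<^esup>\<close>, \<open>\<partial>/\<partial>x\<^sub>i\<close> and
  \<open>\<partial>/\<partial>\<nu>\<^sub>m\<close> multiply to a constant \<open>\<kappa>\<close>.  This determines degree and spin of the modes.\<close>

lemma br_scal:
  assumes tr: "\<And>v. scal l k (tr v) = t *\<^sub>c tr (scal l k v)"
    and cc: "\<And>i v. scal l k (cc i v) = x i *\<^sub>c cc i (scal l k v)"
    and dd: "\<And>i v. scal l k (dd i v) = y i *\<^sub>c dd i (scal l k v)"
    and nz: "\<And>i. x i \<noteq> 0" "\<And>i. y i \<noteq> 0" and \<kappa>: "\<And>i m. int m + int i \<ge> n \<Longrightarrow> t ^ nat (int m + int i - n) * (x i * y m) = \<kappa>"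
  shows "scal l k (br n a v) = \<kappa> *\<^sub>c br n (scal l k a) (scal l k v)"
proof -
  let ?g = "scal l k"
  have par: "?g (par w) = par (?g w)" for w
    by (induction w rule: creation_induct) (simp_all add: scal_simps par_simps par_rec scal_rec)
  note Tp = scal_Tp[of l k t, OF tr]
  have ann: "ann N (?g w)" if "ann N w" for N w
  proof -
    have "x i *\<^sub>c cc i (?g w) = 0" "y i *\<^sub>c dd i (?g w) = 0" if "i \<ge> N" for i
      using \<open>ann N w\<close> that by (simp_all add: annD scal_simps flip: cc dd)
    then show ?thesis using nz by (simp add: ann_def)
  qed
  obtain N where N: "ann N a" "ann N v" using ann_common[of "{a, v}" 0] by auto
  have "?g (brt (int m + int i - n) i m a v) = \<kappa> *\<^sub>c brt (int m + int i - n) i m (?g a) (?g v)" for i m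
  proof (cases "int m + int i \<ge> n")
    case True
    let ?r = "int m + int i - n"
    have 1: "t ^ nat ?r * (x i * y m) = \<kappa>" by (rule \<kappa>[OF True])
    have 2: "t ^ nat ?r * (y i * x m) = \<kappa>" using \<kappa>[of i m] True by (simp add: ac_simps)
    have "?g (mul (Tp ?r (cc i (par a))) (dd m v)) = (t ^ nat ?r * (x i * y m)) *\<^sub>c mul (Tp ?r (cc i (par (?g a)))) (dd m (?g v))"
      using True by (simp add: scal_mul Tp cc dd par mul_simps Tp_simps ac_simps)
    moreover have "?g (mul (Tp ?r (dd i a)) (cc m v)) = (t ^ nat ?r * (y i * x m)) *\<^sub>c mul (Tp ?r (dd i (?g a))) (cc m (?g v))"
      using True by (simp add: scal_mul Tp cc dd mul_simps Tp_simps ac_simps)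
    ultimately show ?thesis unfolding 1 2 by (simp add: brt_def scal_simps cs.scale_right_distrib)
  qed (simp add: brt_def mul_simps scal_simps)
  then show ?thesis
    by (simp add: br_eq[OF N] br_eq[OF ann[OF N(1)] ann[OF N(2)]] scal_simps cs.scale_sum_right mult.commute)
qed

lemma deg_op_tr: "deg_op (tr v) = 1 *\<^sub>c tr (deg_op v)"
  by (rule scal_tr) simp_all

lemma spin_op_tr: "spin_op (tr v) = 2 *\<^sub>c tr (spin_op v)"
  by (rule scal_tr) simp_all

lemma deg_op_br: "deg_op (br n a v) = inverse 2 *\<^sub>c br n (deg_op a) (deg_op v)"
proof (rule br_scal[where t = 1 and x = "\<lambda>_. 1" and y = "\<lambda>_. inverse 2"])
  show "deg_op (cc i w) = 1 *\<^sub>c cc i (deg_op w)" for i w by (rule scal_cc) simp_all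
  show "deg_op (dd i w) = inverse 2 *\<^sub>c dd i (deg_op w)" for i w by (rule scal_dd) simp
qed (simp_all add: deg_op_tr)

lemma powi_2_add: "(2::complex) powi a * 2 powi b = 2 powi (a + b)"
  by (simp add: power_int_add)

lemma powi_2_nat: "(2::complex) ^ j = 2 powi int j"
  by simp

lemma spin_op_br: "spin_op (br n a v) = 2 powi (- n - 1) *\<^sub>c br n (spin_op a) (spin_op v)"
proof (rule br_scal[where t = 2 and x = "\<lambda>i. 2 powi (- int i)" and y = "\<lambda>i. 2 powi (- int (Suc i))"])
  fix i m :: nat
  assume "int m + int i \<ge> n"
  then have "int (nat (int m + int i - n)) + (- int i + - int (Suc m)) = - n - 1" by simp
  then show "2 ^ nat (int m + int i - n) * (2 powi (- int i) * 2 powi (- int (Suc m))) = (2 :: complex) powi (- n - 1)"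
    unfolding powi_2_nat powi_2_add by (rule arg_cong)
qed (rule spin_op_tr spin_op_cc spin_op_dd | simp)+

lemma md_degree:
  assumes "a \<in> fock_degree r" "v \<in> fock_degree n"
  shows "md a m v \<in> fock_degree (n + (if m < 0 then r else r - 1))"
proof -
  have e: "deg_op a = 2 powi r *\<^sub>c a" "deg_op v = 2 powi n *\<^sub>c v" using assms by (simp_all add: fock_degree_eq)
  show ?thesis
  proof (cases m rule: md_cases)
    case (1 j)
    have "deg_op (mul (Tp (int j) a) v) = (2 powi r * 2 powi n) *\<^sub>c mul (Tp (int j) a) v"
      by (simp add: scal_mul scal_Tp[of _ _ 1, OF deg_op_tr] e mul_simps Tp_simps mult.commute)
    then show ?thesis by (simp add: 1 fock_degree_eq powi_2_add add.commute)
  next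
    case (2 j)
    have "deg_op (br (int j) a v) = (inverse 2 * (2 powi r * 2 powi n)) *\<^sub>c br (int j) a v"
      by (simp add: deg_op_br e br_simps mult.commute)
    moreover have "inverse 2 * (2 powi r * 2 powi n) = (2 :: complex) powi (n + (r - 1))"
      by (simp add: power_int_add power_int_diff field_simps)
    ultimately show ?thesis by (simp add: 2 fock_degree_eq)
  qed
qed

lemma md_spin:
  assumes "a \<in> fock_spin s" "v \<in> fock_spin t"
  shows "md a m v \<in> fock_spin (t + (s - m - 1))"
proof -
  have e: "spin_op a = 2 powi s *\<^sub>c a" "spin_op v = 2 powi t *\<^sub>c v" using assms by (simp_all add: fock_spin_eq)
  show ?thesis
  proof (cases m rule: md_cases)
    case (1 j)
    have "spin_op (mul (Tp (int j) a) v) = (2 ^ j * (2 powi s * 2 powi t)) *\<^sub>c mul (Tp (int j) a) v"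
      by (simp add: scal_mul scal_Tp[of _ _ 2, OF spin_op_tr] e mul_simps Tp_simps ac_simps)
    then show ?thesis unfolding powi_2_nat powi_2_add by (simp add: 1 fock_spin_eq ac_simps)
  next
    case (2 j)
    have "spin_op (br (int j) a v) = (2 powi (- int j - 1) * (2 powi s * 2 powi t)) *\<^sub>c br (int j) a v"
      by (simp add: spin_op_br e br_simps ac_simps)
    then show ?thesis unfolding powi_2_add by (simp add: 2 fock_spin_eq algebra_simps)
  qed
qed

lemma tr_degree: "v \<in> fock_degree n \<Longrightarrow> tr v \<in> fock_degree n"
  by (simp add: fock_degree_eq deg_op_tr tr_simps)

lemma tr_spin: "v \<in> fock_spin n \<Longrightarrow> tr v \<in> fock_spin (n + 1)"
  by (simp add: fock_spin_eq spin_op_tr tr_simps power_int_add mult.commute)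

text \<open>The whole space and \<open>Fock\<^sub>0\<close> are treated together as subspaces with this property.\<close>

definition mode_closed :: "lattice_fock set \<Rightarrow> bool" where
  "mode_closed W \<longleftrightarrow> cs.subspace W \<and> fock_ket 0 \<in> W \<and> tr ` W \<subseteq> W \<and> (\<forall>a\<in>W. \<forall>v\<in>W. \<forall>m. md a m v \<in> W)"

lemma raviolo_field_md:
  assumes "mode_closed W" "a \<in> W"
  shows "raviolo_field W (md a)"
  unfolding raviolo_field_def endo_on_def
proof (intro conjI allI ballI)
  show "linear_on W (md a m)" for m by (rule clinear_linear_on[OF clinear_md(2)])
  show "md a m ` W \<subseteq> W" for m using assms unfolding mode_closed_def by blast
  fix v
  obtain N where N: "ann N a" "ann N v" using ann_common[of "{a, v}" 0] by auto
  have "md a m v = 0" if "m \<ge> 2 * int N" for m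
    using br_high[OF N that] that by (simp add: md_def)
  then show "\<exists>N. \<forall>m\<ge>N. md a m v = 0" by blast
qed

text \<open>The polar part is \<open>\<Sum>\<^sub>k \<Omega>\<^bsub>z-w\<^esub>\<^sup>k Y(a\<^bsub>(k)\<^esub> b, w)\<close>, as far as its regular coefficients are concerned.  The bound \<open>K\<close>
  on the pole order depends on \<open>a\<close> and \<open>b\<close> only.\<close>

lemma md_mutually_local:
  assumes W: "mode_closed W" and a: "a \<in> W" "a \<in> fock_degree r" and b: "b \<in> W" "b \<in> fock_degree s"
  shows "mutually_local W r (md a) s (md b)"
proof -
  obtain N where N: "ann N a" "ann N b" using ann_common[of "{a, b}" 0] by auto
  define K where "K = 2 * N"
  have pa: "has_parity r a" and pb: "has_parity s b" using a b has_parity_degree by blast+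
  have high: "br (int k) a b = 0" if "k \<ge> K" for k
    using that by (intro br_high[OF N]) (simp add: K_def)
  show ?thesis
  proof (rule mutually_local_criterion[where N = K and u = "\<lambda>k l v. mul (Tp l (br (int k) a b)) v"])
    show "cs.subspace W" using W by (simp add: mode_closed_def)
    show "raviolo_field W (md a)" "raviolo_field W (md b)" by (rule raviolo_field_md[OF W]; fact)+
  next
    fix k l v assume v: "v \<in> W"
    show "mul (Tp l (br (int k) a b)) v \<in> W"
    proof (cases "l < 0")
      case True
      then show ?thesis using W by (simp add: mul_simps mode_closed_def cs.subspace_0)
    next
      case False
      have "md a (int k) b \<in> W" using W a b unfolding mode_closed_def by blast
      then have "md (md a (int k) b) (- l - 1) v \<in> W" using W v unfolding mode_closed_def by blast
      moreover have "md (md a (int k) b) (- l - 1) v = mul (Tp l (br (int k) a b)) v"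
        using False by (simp add: md_def)
      ultimately show ?thesis by simp
    qed
  next
    fix i j v
    show "md a (- int i - 1) (md b (- int j - 1) v) = ksign (r * s) *\<^sub>c md b (- int j - 1) (md a (- int i - 1) v)"
      unfolding md_neg by (rule mul_left_commute[OF has_parity_Tp[OF pa] has_parity_Tp[OF pb]])
  next
    fix m j v
    have "br (int m) a (Tp (int j) b) = (\<Sum>k<K. of_nat (m choose k) *\<^sub>c Tp (int k + int j - int m) (br (int k) a b))"
      unfolding br_Tp
      by (rule sum.mono_neutral_cong) (auto simp: high binomial_eq_0 Tp_simps algebra_simps)
    then show "md a (int m) (md b (- int j - 1) v) = ksign ((r - 1) * s) *\<^sub>c md b (- int j - 1) (md a (int m) v) +
        (\<Sum>k<K. of_nat (m choose k) *\<^sub>c mul (Tp (int k + int j - int m) (br (int k) a b)) v)"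
      by (simp add: br_mul[OF pa has_parity_Tp[OF pb]] mul_simps add.commute)
  next
    fix n i v
    have "ksign ((s - 1) * r) = ksign (r * (s - 1))" by (simp add: mult.commute)
    then show "md b (int n) (md a (- int i - 1) v) = ksign (r * (s - 1)) *\<^sub>c md a (- int i - 1) (md b (int n) v) +
        ksign (r * s) *\<^sub>c (\<Sum>k<K. ((-1) ^ k * of_nat (k + i choose k)) *\<^sub>c mul (Tp (int k + int i - int n) (br (int k) a b)) v)"
      using br_Tp_skew[OF pa pb N, of K n i]
      by (simp add: br_mul[OF pb has_parity_Tp[OF pa]] mul_simps K_def add.commute)
  next
    fix k l v assume "(l :: int) < 0"
    then show "mul (Tp l (br (int k) a b)) v = 0" by (simp add: mul_simps)
  next
    fix v
    obtain M where M: "ann M v" using ann_exists by blast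
    show "(shift_diff ^^ K) (\<lambda>m n. md a (int m) (md b (int n) v) -
        ksign ((r - 1) * (s - 1)) *\<^sub>c md b (int n) (md a (int m) v)) = (\<lambda>m n. 0)"
      unfolding md_nonneg br_commutator[OF pa pb N M, of K, unfolded K_def, OF order_refl, folded K_def]
        shift_diff_add
        shift_diff_first[of K "br_first_order a b N M v"]
        shift_diff_second[of K "\<lambda>k l. - ksign ((r - 1) * (s - 1)) *\<^sub>c br_first_order b a N M v k l"]
      by simp
  qed
qed

lemma ann_ket_0: "ann 0 (fock_ket 0)"
  by (simp add: ann_def annihilate)

lemma br_vacuum [simp]: "br n (fock_ket 0) v = 0" "br n a (fock_ket 0) = 0"
  by (simp_all add: br_eq[OF ann_ket_0 ann_bound] br_eq[OF ann_bound ann_ket_0])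

lemma tr_vacuum [simp]: "tr (fock_ket 0) = 0"
  by (simp add: tr_ket)

lemma Tp_vacuum: "Tp j (fock_ket 0) = (if j = 0 then fock_ket 0 else 0)"
proof -
  have "(tr ^^ Suc n) (fock_ket 0) = 0" for n
    by (induction n) (simp_all add: tr_simps)
  then have "(tr ^^ n) (fock_ket 0) = 0" if "n > 0" for n
    using that by (metis gr0_implies_Suc)
  then show ?thesis by (simp add: Tp_def)
qed

definition lattice_raviolo :: "lattice_fock raviolo" where
  "lattice_raviolo = \<lparr>rspace = UNIV, rdegree = fock_degree, vacuum = fock_ket 0, translation = tr, modes = md\<rparr>"

lemma lattice_raviolo_simps [simp]:
  "rspace lattice_raviolo = UNIV" "rdegree lattice_raviolo = fock_degree" "vacuum lattice_raviolo = fock_ket 0"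
  "translation lattice_raviolo = tr" "modes lattice_raviolo = md"
  by (simp_all add: lattice_raviolo_def)

lemma sub_raviolo_simps [simp]:
  "rspace (sub_raviolo V W) = W" "rdegree (sub_raviolo V W) = (\<lambda>n. W \<inter> rdegree V n)" "vacuum (sub_raviolo V W) = vacuum V"
  "translation (sub_raviolo V W) = translation V" "modes (sub_raviolo V W) = modes V"
  by (simp_all add: sub_raviolo_def)

lemma sub_raviolo_UNIV: "sub_raviolo lattice_raviolo UNIV = lattice_raviolo"
  by (simp add: sub_raviolo_def lattice_raviolo_def)

theorem raviolo_vertex_algebra_sub:
  assumes W: "mode_closed W" and G: "graded_subspace W fock_degree"
  shows "raviolo_vertex_algebra (sub_raviolo lattice_raviolo W)"
  unfolding raviolo_vertex_algebra_def sub_raviolo_simps lattice_raviolo_simps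
proof (intro conjI allI ballI impI)
  have sub: "cs.subspace W" and ket: "fock_ket 0 \<in> W" and trW: "tr ` W \<subseteq> W"
    and mdW: "\<And>a v m. a \<in> W \<Longrightarrow> v \<in> W \<Longrightarrow> md a m v \<in> W" using W by (auto simp: mode_closed_def)
  show "grading_on W (\<lambda>n. W \<inter> fock_degree n)"
    using G by (simp add: graded_subspace_def)
  show "fock_ket 0 \<in> W \<inter> fock_degree 0" using ket fock_ket_degree by blast
  show "endo_on W tr" unfolding endo_on_def using trW clinear_linear_on[OF clinear_tr] by blast
  show "tr ` (W \<inter> fock_degree n) \<subseteq> W \<inter> fock_degree n" for n using trW tr_degree by blast
  show "linear_on W (\<lambda>a. md a m v)" for m v by (rule clinear_linear_on[OF clinear_md(1)])
  show "raviolo_field W (md a)" if "a \<in> W" for a by (rule raviolo_field_md[OF W that])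
  show "field_degree (\<lambda>n. W \<inter> fock_degree n) r (md a)" if "a \<in> W \<inter> fock_degree r" for r a
    unfolding field_degree_def using that md_degree[of a r] mdW by blast
  show "tr (md a m v) - md a m (tr v) = of_int (- m) *\<^sub>c md a (m - 1) v" for a m v by (rule tr_md)
  show "tr (fock_ket 0) = 0" by simp
  show "md (fock_ket 0) m v = (if m = -1 then v else 0)" for m v
    by (auto simp: md_def Tp_vacuum mul_simps)
  show "md a (-1) (fock_ket 0) = a" for a by (simp add: md_def)
  show "md a m (fock_ket 0) = 0" if "0 \<le> m" for a m using that by (simp add: md_def)
  show "mutually_local W r (md a) s (md b)" if "a \<in> W \<inter> fock_degree r" "b \<in> W \<inter> fock_degree s" for a b r s
    using md_mutually_local[OF W] that by blast
qed

section \<open>The conformal vector\<close>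

lemma conformal_vec_eq: "conformal_vec = - bb 0 (nn 0 (fock_ket 0))"
  by (simp add: conformal_vec_def bb_def nn_def)

lemma Tp_creation:
  "Tp j (bb 0 (fock_ket 0)) = (if j < 0 then 0 else bb (nat j) (fock_ket 0))"
  "Tp j (nn 0 (fock_ket 0)) = (if j < 0 then 0 else nn (nat j) (fock_ket 0))"
proof -
  have *: "Tp (int j) (bb 0 (fock_ket 0)) = bb j (fock_ket 0) \<and> Tp (int j) (nn 0 (fock_ket 0)) = nn j (fock_ket 0)" for j
  proof (induction j)
    case (Suc j)
    have "of_nat (Suc j) *\<^sub>c Tp (int (Suc j)) (bb 0 (fock_ket 0)) = of_nat (Suc j) *\<^sub>c bb (Suc j) (fock_ket 0)"
      "of_nat (Suc j) *\<^sub>c Tp (int (Suc j)) (nn 0 (fock_ket 0)) = of_nat (Suc j) *\<^sub>c nn (Suc j) (fock_ket 0)"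
      using Suc unfolding Tp_Suc by (simp_all add: tr_bb tr_nn creation_simps)
    then show ?case using Tp_eqI by blast
  qed simp
  show "Tp j (bb 0 (fock_ket 0)) = (if j < 0 then 0 else bb (nat j) (fock_ket 0))"
    "Tp j (nn 0 (fock_ket 0)) = (if j < 0 then 0 else nn (nat j) (fock_ket 0))"
    using *[of "nat j"] by auto
qed

definition bb_int :: "int \<Rightarrow> lattice_fock \<Rightarrow> lattice_fock" where "bb_int l v = (if l < 0 then 0 else bb (nat l) v)"
definition nn_int :: "int \<Rightarrow> lattice_fock \<Rightarrow> lattice_fock" where "nn_int l v = (if l < 0 then 0 else nn (nat l) v)"

lemma mul_Tp_creation: "mul (Tp j (bb 0 (fock_ket 0))) v = bb_int j v" "mul (Tp j (nn 0 (fock_ket 0))) v = nn_int j v"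
  by (simp_all add: Tp_creation bb_int_def nn_int_def mul_simps mul_rec flip: mul_rec(1))

lemma ann_creation: "ann N v \<Longrightarrow> k + 2 \<le> N \<Longrightarrow> ann N (bb k v)" "ann N v \<Longrightarrow> k + 2 \<le> N \<Longrightarrow> ann N (nn k v)"
  by (auto simp: ann_def annihilate creation_simps)

lemma sum_lessThan_2: "(\<Sum>i<2. f i) = f 0 + f (Suc 0)" for f :: "nat \<Rightarrow> 'b::comm_monoid_add"
  by (simp add: numeral_2_eq_2)

lemma ann_2: "ann 2 (fock_ket 0)" "ann 2 (bb 0 (fock_ket 0))" "ann 2 (nn 0 (fock_ket 0))" "ann 2 (bb 0 (nn 0 (fock_ket 0)))"
  "ann 2 conformal_vec"
proof -
  show k: "ann 2 (fock_ket 0)" by (rule ann_mono[OF ann_ket_0]) simp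
  show "ann 2 (bb 0 (fock_ket 0))" "ann 2 (nn 0 (fock_ket 0))" "ann 2 (bb 0 (nn 0 (fock_ket 0)))"
    by (intro ann_creation k; simp)+
  then show "ann 2 conformal_vec" by (simp add: conformal_vec_eq ann_def clinear_simps[OF clinear_cc] clinear_simps[OF clinear_dd])
qed

text \<open>The vector \<open>\<gamma>\<close> has only two nonzero derivatives, so \<open>\<gamma>\<^bsub>(n)\<^esub>\<close> is the vector field of the coordinate change
  generated by \<open>z\<^sup>n \<partial>\<^sub>z\<close>.\<close>

lemma br_conformal:
  assumes "ann N v"
  shows "br n conformal_vec v = (\<Sum>m<N. of_nat (Suc m) *\<^sub>c nn_int (int m + 1 - n) (dd m v) - bb_int (int m - n) (cc m v))"
proof -
  have c: "cc 0 (par conformal_vec) = 0" "cc (Suc 0) (par conformal_vec) = - nn 0 (fock_ket 0)"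
    "dd 0 conformal_vec = - bb 0 (fock_ket 0)" "dd (Suc 0) conformal_vec = 0"
    by (simp_all add: conformal_vec_eq par_simps par_rec annihilate mode_simps)
  show ?thesis
    unfolding br_eq[OF ann_2(5) assms] sum_lessThan_2 brt_def c Tp_simps mul_simps mul_Tp_creation
    by (simp add: bcoef_def sum.distrib[symmetric] algebra_simps)
qed

lemma bb_int_nn_int_commute: "bb_int l (bb k v) = bb k (bb_int l v)" "bb_int l (nn k v) = nn k (bb_int l v)"
  "nn_int l (bb k v) = bb k (nn_int l v)" "nn_int l (nn k v) = - nn k (nn_int l v)"
  by (auto simp: bb_int_def nn_int_def creation_simps bb_bb[of k] bb_nn nn_nn[of k])

lemma clinear_bb_int: "clinear (bb_int l)" and clinear_nn_int: "clinear (nn_int l)"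
  by (auto simp: clinear_def bb_int_def nn_int_def creation_simps)

lemmas bb_int_simps = clinear_simps[OF clinear_bb_int] clinear_simps[OF clinear_nn_int]

definition Gm :: "nat \<Rightarrow> lattice_fock \<Rightarrow> lattice_fock" where "Gm n = br (int n) conformal_vec"

lemma clinear_Gm: "clinear (Gm n)"
  unfolding Gm_def by (rule clinear_br_right)

lemmas Gm_simps = clinear_simps[OF clinear_Gm]

lemma Gm_ket: "Gm n (fock_ket m) = (if n = 0 then - (of_int m *\<^sub>c bb 0 (fock_ket m)) else 0)"
proof -
  have "ann 1 (fock_ket m)" by (simp add: ann_def annihilate)
  then show ?thesis by (simp add: Gm_def br_conformal annihilate bb_int_simps) (simp add: bb_int_def)
qed

lemma Gm_bb: "Gm n (bb k v) = bb k (Gm n v) + of_nat (Suc k) *\<^sub>c bb_int (int k + 1 - int n) v"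
proof -
  obtain N where N: "ann N v" "ann N (bb k v)" "k + 2 \<le> N" using ann_common[of "{v, bb k v}" "k + 2"] by auto
  have "Gm n (bb k v) = (\<Sum>m<N. bb k (of_nat (Suc m) *\<^sub>c nn_int (int m + 1 - int n) (dd m v) - bb_int (int m - int n) (cc m v)) +
      (if m = Suc k then of_nat (Suc k) *\<^sub>c bb_int (int k + 1 - int n) v else 0))"
    unfolding Gm_def br_conformal[OF N(2)]
    by (rule sum.cong) (auto simp: annihilate mode_simps bb_int_simps bb_int_nn_int_commute ac_simps simp del: of_nat_Suc
        simp add: of_nat_Suc[where 'a = int])
  also have "\<dots> = bb k (Gm n v) + of_nat (Suc k) *\<^sub>c bb_int (int k + 1 - int n) v"
    using N(3) by (simp add: Gm_def br_conformal[OF N(1)] mode_simps sum.distrib del: of_nat_Suc)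
  finally show ?thesis .
qed

lemma Gm_nn: "Gm n (nn k v) = nn k (Gm n v) + of_nat (Suc k) *\<^sub>c nn_int (int k + 1 - int n) v"
proof -
  obtain N where N: "ann N v" "ann N (nn k v)" "k + 2 \<le> N" using ann_common[of "{v, nn k v}" "k + 2"] by auto
  have "Gm n (nn k v) = (\<Sum>m<N. nn k (of_nat (Suc m) *\<^sub>c nn_int (int m + 1 - int n) (dd m v) - bb_int (int m - int n) (cc m v)) +
      (if m = k then of_nat (Suc k) *\<^sub>c nn_int (int k + 1 - int n) v else 0))"
    unfolding Gm_def br_conformal[OF N(2)]
    by (rule sum.cong) (auto simp: annihilate mode_simps bb_int_simps bb_int_nn_int_commute cs.scale_right_distrib ac_simps simp del: of_nat_Suc)
  also have "\<dots> = nn k (Gm n v) + of_nat (Suc k) *\<^sub>c nn_int (int k + 1 - int n) v"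
    using N(3) by (simp add: Gm_def br_conformal[OF N(1)] mode_simps sum.distrib del: of_nat_Suc)
  finally show ?thesis .
qed

lemma Gm_0: "Gm 0 v = tr v"
  by (induction v rule: creation_induct)
    (simp_all add: Gm_simps tr_simps Gm_ket tr_ket Gm_bb tr_bb Gm_nn tr_nn bb_int_def nn_int_def nat_add_distrib del: of_nat_Suc)

text \<open>The commutators of \<open>\<gamma>\<^bsub>(n)\<^esub>\<close> with the creation operators are again creation operators, so the identity reduces
  to the vectors \<open>|j\<rangle>\<close>, on which only \<open>\<gamma>\<^bsub>(0)\<^esub>\<close> is nonzero.\<close>

lemma Gm_Gm: "Gm m (Gm n v) - Gm n (Gm m v) = (of_nat m - of_nat n) *\<^sub>c Gm (m + n - 1) v"
proof (cases "m = 0 \<and> n = 0")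
  case False
  then have idx: "int (m + n - 1) = int m + int n - 1" by auto
  have bb_int: "Gm n (bb_int l v) = bb_int l (Gm n v) + of_int (l + 1) *\<^sub>c bb_int (l + 1 - int n) v"
    "Gm n (nn_int l v) = nn_int l (Gm n v) + of_int (l + 1) *\<^sub>c nn_int (l + 1 - int n) v" for l n v
  proof -
    consider "l < -1" | "l = -1" | k where "l = int k"
    proof -
      have "l < -1 \<or> l = -1 \<or> l = int (nat l)" by arith
      then show ?thesis using that by blast
    qed
    then have "Gm n (bb_int l v) = bb_int l (Gm n v) + of_int (l + 1) *\<^sub>c bb_int (l + 1 - int n) v \<and>
      Gm n (nn_int l v) = nn_int l (Gm n v) + of_int (l + 1) *\<^sub>c nn_int (l + 1 - int n) v"
    proof cases
      case (3 k)
      have "bb_int l w = bb k w" "nn_int l w = nn k w" for w by (simp_all add: bb_int_def nn_int_def 3)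
      then show ?thesis by (simp add: Gm_bb Gm_nn 3 add.commute)
    qed (simp_all add: bb_int_def nn_int_def Gm_simps)
    then show "Gm n (bb_int l v) = bb_int l (Gm n v) + of_int (l + 1) *\<^sub>c bb_int (l + 1 - int n) v"
      "Gm n (nn_int l v) = nn_int l (Gm n v) + of_int (l + 1) *\<^sub>c nn_int (l + 1 - int n) v" by blast+
  qed
  show ?thesis
  proof (induction v rule: creation_induct)
    case (add v w)
    then show ?case by (simp add: Gm_simps cs.scale_right_distrib algebra_simps)
  next
    case (scale a v)
    then show ?case by (simp add: Gm_simps mult.commute flip: cs.scale_right_diff_distrib)
  next
    case (ket j)
    consider "m > 1 \<or> n > 1" | "m = 0" "n = 1" | "m = 1" "n = 0" | "m = 1" "n = 1" using False by linarith
    then show ?case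
      by cases (auto simp: Gm_ket Gm_bb Gm_simps bb_int_def creation_simps)
  next
    case (bb k v)
    have "Gm m (Gm n (bb k v)) - Gm n (Gm m (bb k v)) = bb k (Gm m (Gm n v) - Gm n (Gm m v)) +
        (of_nat (Suc k) * (of_nat m - of_nat n)) *\<^sub>c bb_int (int (Suc k) + 1 - int m - int n) v"
      by (simp add: Gm_bb bb_int Gm_simps creation_simps algebra_simps cs.scale_left_distrib cs.scale_left_diff_distrib)
    also have "\<dots> = (of_nat m - of_nat n) *\<^sub>c (bb k (Gm (m + n - 1) v) +
        of_nat (Suc k) *\<^sub>c bb_int (int (Suc k) + 1 - int m - int n) v)"
      unfolding bb by (simp only: creation_simps cs.scale_right_distrib cs.scale_scale mult.commute)
    also have "int (Suc k) + 1 - int m - int n = int k + 1 - int (m + n - 1)" using idx by simp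
    finally show ?case unfolding Gm_bb .
  next
    case (nn k v)
    have "Gm m (Gm n (nn k v)) - Gm n (Gm m (nn k v)) = nn k (Gm m (Gm n v) - Gm n (Gm m v)) +
        (of_nat (Suc k) * (of_nat m - of_nat n)) *\<^sub>c nn_int (int (Suc k) + 1 - int m - int n) v"
      by (simp add: Gm_nn bb_int Gm_simps creation_simps algebra_simps cs.scale_left_distrib cs.scale_left_diff_distrib)
    also have "\<dots> = (of_nat m - of_nat n) *\<^sub>c (nn k (Gm (m + n - 1) v) +
        of_nat (Suc k) *\<^sub>c nn_int (int (Suc k) + 1 - int m - int n) v)"
      unfolding nn by (simp only: creation_simps cs.scale_right_distrib cs.scale_scale mult.commute)
    also have "int (Suc k) + 1 - int m - int n = int k + 1 - int (m + n - 1)" using idx by simp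
    finally show ?case unfolding Gm_nn .
  qed
qed simp

text \<open>The words that span a spin space also contain annihilation modes.  The eigenvectors of \<open>\<gamma>\<^bsub>(1)\<^esub>\<close> in the spin spaces
  are closed under creation operators and hence form a grading; it coincides with the grading by spin because
  both consist of the eigenspaces of the same scaling automorphism.\<close>

lemma Gm_1_spin:
  assumes "v \<in> fock_spin s"
  shows "Gm 1 v = of_int s *\<^sub>c v"
proof -
  let ?G = "\<lambda>n. fock_spin n \<inter> {v. Gm 1 v = of_int n *\<^sub>c v}"
  have sub: "cs.subspace (?G n)" for n
    by (intro cs.subspace_inter subspace_fock_spin subspace_eigen clinear_Gm)
  have ket: "fock_ket m \<in> ?G 0" for m by (simp add: fock_ket_spin Gm_ket)
  have cr: "bb k v \<in> ?G (n + int (Suc k))" "nn k v \<in> ?G (n + int (Suc k))" if "v \<in> ?G n" for k n v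
    using that creation_spin[of v n k]
    by (auto simp: Gm_bb Gm_nn bb_int_def nn_int_def creation_simps cs.scale_left_distrib)
  have ex: "\<exists>g. (\<forall>n. g n \<in> ?G n) \<and> finite {n. g n \<noteq> 0} \<and> v = (\<Sum>n | g n \<noteq> 0. g n)" for v
    by (rule creation_decomposition[where G = ?G and w = "\<lambda>_. 0" and wb = "\<lambda>k. int (Suc k)" and wn = "\<lambda>k. int (Suc k)",
          OF sub ket cr])
  have "?G s = {v. spin_op v = 2 powi s *\<^sub>c v}"
    by (rule grading_by_eigenvalues(2)[OF clinear_scal sub _ ex]) (use spin_op_eigen in blast)
  then show ?thesis using assms fock_spin_eq[of s] by blast
qed

lemma conformal_vec_degree: "conformal_vec \<in> fock_degree 1" and conformal_vec_spin: "conformal_vec \<in> fock_spin 2"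
proof -
  have "bb 0 (nn 0 (fock_ket 0)) \<in> fock_degree (0 + 1)"
    by (intro creation_degree fock_ket_degree)
  moreover have "bb 0 (nn 0 (fock_ket 0)) \<in> fock_spin (0 + int (Suc 0) + int (Suc 0))"
    by (intro creation_spin fock_ket_spin)
  ultimately show "conformal_vec \<in> fock_degree 1" "conformal_vec \<in> fock_spin 2"
    unfolding conformal_vec_eq by (simp_all add: cs.subspace_neg subspace_fock_degree subspace_fock_spin)
qed

lemma conformal_vec_nonzero: "conformal_vec \<noteq> 0"
proof
  assume "conformal_vec = 0"
  then have "cc 1 (dd 0 conformal_vec) = 0" by (simp add: mode_simps)
  then show False using fock_ket_nonzero[of 0] by (simp add: conformal_vec_eq annihilate mode_simps)
qed

lemma Gm_conformal: "Gm 0 conformal_vec = tr conformal_vec" "Gm 1 conformal_vec = 2 *\<^sub>c conformal_vec"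
  "k \<ge> 2 \<Longrightarrow> Gm k conformal_vec = 0"
proof -
  show "Gm 0 conformal_vec = tr conformal_vec" by (rule Gm_0)
  show "Gm 1 conformal_vec = 2 *\<^sub>c conformal_vec" using Gm_1_spin[OF conformal_vec_spin] by simp
qed (simp add: conformal_vec_eq Gm_simps Gm_bb Gm_nn Gm_ket bb_int_def nn_int_def creation_simps)

text \<open>Only \<open>\<gamma>\<^bsub>(0)\<^esub> \<gamma> = T \<gamma>\<close> and \<open>\<gamma>\<^bsub>(1)\<^esub> \<gamma> = 2 \<gamma>\<close> contribute, which accounts for the coefficient
  \<open>(n + 1 - m) + 2 m\<close>.\<close>

lemma Gm_Tp_conformal:
  "Gm m (Tp (int n) conformal_vec) = of_nat (m + n + 1) *\<^sub>c Tp (int n + 1 - int m) conformal_vec"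
proof -
  have "Gm m (Tp (int n) conformal_vec) =
      (\<Sum>k\<le>m. of_nat (m choose k) *\<^sub>c Tp (int n - int m + int k) (Gm k conformal_vec))"
    unfolding Gm_def by (rule br_Tp)
  also have "\<dots> = (\<Sum>k<2. of_nat (m choose k) *\<^sub>c Tp (int n - int m + int k) (Gm k conformal_vec))"
    by (rule sum.mono_neutral_cong) (auto simp: Gm_conformal Tp_simps binomial_eq_0)
  also have "\<dots> = of_nat (m + n + 1) *\<^sub>c Tp (int n + 1 - int m) conformal_vec"
    using Gm_conformal(2) by (simp add: sum_lessThan_2 Gm_conformal(1) Tp_tr Tp_simps algebra_simps
        flip: cs.scale_left_distrib)
  finally show ?thesis .
qed

theorem conformal_structure_sub:
  assumes W: "mode_closed W" and \<gamma>: "conformal_vec \<in> W"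
    and gs: "graded_subspace W fock_spin" and gd: "graded_subspace W fock_degree"
  shows "conformal_structure (sub_raviolo lattice_raviolo W) (\<lambda>s. W \<inter> fock_spin s) conformal_vec"
proof -
  have sub: "cs.subspace W" and ket: "fock_ket 0 \<in> W" and trW: "tr ` W \<subseteq> W"
    and mdW: "\<And>a v m. a \<in> W \<Longrightarrow> v \<in> W \<Longrightarrow> md a m v \<in> W" using W by (auto simp: mode_closed_def)
  have spin_pres: "spin_op v \<in> fock_degree n" if "v \<in> fock_degree n" for v n
  proof -
    have "deg_op (spin_op w) = spin_op (deg_op w)" for w
      by (induction w rule: creation_induct) (simp_all add: scal_simps scal_rec mult.commute)
    then show ?thesis using that by (simp add: fock_degree_eq scal_simps)
  qed
  have "graded_subspace (fock_spin s) fock_degree" for s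
    unfolding fock_spin_eq by (rule graded_subspace_eigen[OF fock_degree_grading clinear_scal spin_pres])
  then have gss: "graded_subspace (W \<inter> fock_spin s) fock_degree" for s
    by (rule graded_subspace_Int[OF fock_degree_grading gd])
  have int: "(\<lambda>n. W \<inter> fock_spin s \<inter> (W \<inter> fock_degree n)) = (\<lambda>n. W \<inter> fock_spin s \<inter> fock_degree n)" for s by auto
  have spin: "spin_grading (sub_raviolo lattice_raviolo W) (\<lambda>s. W \<inter> fock_spin s)"
    unfolding spin_grading_def sub_raviolo_simps lattice_raviolo_simps
  proof (intro conjI allI ballI)
    show "grading_on W (\<lambda>s. W \<inter> fock_spin s)" using gs by (simp add: graded_subspace_def)
    show "graded_subspace (W \<inter> fock_spin s) (\<lambda>n. W \<inter> fock_degree n)" for s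
      using gss[of s] by (simp add: graded_subspace_def int)
    show "fock_ket 0 \<in> W \<inter> fock_spin 0" using ket fock_ket_spin by blast
    show "tr ` (W \<inter> fock_spin s) \<subseteq> W \<inter> fock_spin (s + 1)" for s using trW tr_spin by blast
    show "md a n ` (W \<inter> fock_spin t) \<subseteq> W \<inter> fock_spin (t + (s - n - 1))" if "a \<in> W \<inter> fock_spin s" for s t n a
      using that mdW md_spin by blast
  qed
  have par: "has_parity 1 conformal_vec" by (rule has_parity_degree[OF conformal_vec_degree])
  have \<Gamma>: "md conformal_vec (- int n - 1) v = mul (Tp (int n) conformal_vec) v" for n v by simp
  have G: "md conformal_vec (int n) = Gm n" for n by (simp add: fun_eq_iff Gm_def)
  show ?thesis
    unfolding conformal_structure_def sub_raviolo_simps lattice_raviolo_simps Let_def G \<Gamma>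
  proof (intro conjI allI ballI)
    fix m n v
    show "Gm m (Gm n v) - Gm n (Gm m v) = (of_nat m - of_nat n) *\<^sub>c Gm (m + n - 1) v" by (rule Gm_Gm)
    show "mul (Tp (int m) conformal_vec) (mul (Tp (int n) conformal_vec) v) +
        mul (Tp (int n) conformal_vec) (mul (Tp (int m) conformal_vec) v) = 0"
      by (subst mul_left_commute[OF has_parity_Tp[OF par] has_parity_Tp[OF par]]) (simp add: ksign_def)
    have "Gm m (mul (Tp (int n) conformal_vec) v) =
        mul (Gm m (Tp (int n) conformal_vec)) v + mul (Tp (int n) conformal_vec) (Gm m v)"
      unfolding Gm_def by (subst br_mul[OF par has_parity_Tp[OF par]]) (simp add: ksign_def)
    then show "Gm m (mul (Tp (int n) conformal_vec) v) - mul (Tp (int n) conformal_vec) (Gm m v) =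
        (if m \<le> n + 1 then of_nat (m + n + 1) *\<^sub>c mul (Tp (int (n + 1 - m)) conformal_vec) v else 0)"
      unfolding Gm_Tp_conformal by (auto simp: mul_simps of_nat_diff add.commute)
  next
    show "Gm 0 v = tr v" for v by (rule Gm_0)
    show "Gm 1 v = of_int s *\<^sub>c v" if "v \<in> W \<inter> fock_spin s" for s v using Gm_1_spin that by blast
  qed (use spin conformal_vec_nonzero \<gamma> conformal_vec_degree conformal_vec_spin in auto)
qed

section \<open>The Heisenberg subalgebra and the theorem\<close>

lemma mode_closed_UNIV: "mode_closed UNIV"
  by (simp add: mode_closed_def)

lemma mode_closed_fock_0: "mode_closed (fock 0)"
proof -
  have Tp: "cc 0 (Tp r v) = Tp r (cc 0 v)" for r v
    using cc_Tp[of 0 r v] by simp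
  have "cc 0 (md a m v) = 0" if "cc 0 a = 0" "cc 0 v = 0" for a m v
  proof -
    obtain N where N: "ann N a" "ann N v" using ann_common[of "{a, v}" 0] by auto
    have "cc 0 (br n a v) = 0" for n
      unfolding br_eq[OF N] brt_def
      using that by (simp add: clinear_simps[OF clinear_cc] cc_mul Tp cc_cc[of 0] cc_dd par_cc[symmetric] mul_simps
          Tp_simps par_simps clinear_simps[OF clinear_dd])
    then show ?thesis using that by (simp add: md_def cc_mul Tp mul_simps Tp_simps)
  qed
  moreover have "cc 0 (tr v) = 0" if "cc 0 v = 0" for v
    using tr_cc[of 0 v] that by (simp add: tr_simps)
  ultimately show ?thesis
    using subspace_fock[of 0] unfolding mode_closed_def fock_0_eq by (auto simp: cc_ket)
qed

lemma graded_subspace_fock_0: "graded_subspace (fock 0) fock_degree" "graded_subspace (fock 0) fock_spin"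
proof -
  have e: "fock 0 = {v. cc 0 v = 0 *\<^sub>c v}" by (simp add: fock_0_eq)
  have "cc 0 v \<in> fock_degree n" if "v \<in> fock_degree n" for v n
    using fock_action_degree[of "Heis 1 0 0 0 0" 0 v n] that by (simp add: cc_def heis_degree_def)
  then show "graded_subspace (fock 0) fock_degree"
    unfolding e by (intro graded_subspace_eigen[OF fock_degree_grading clinear_cc])
  have "cc 0 v \<in> fock_spin n" if "v \<in> fock_spin n" for v n
    using fock_action_spin[of "Heis 1 0 0 0 0" 0 v n] that by (simp add: cc_def heis_spin_def)
  then show "graded_subspace (fock 0) fock_spin"
    unfolding e by (intro graded_subspace_eigen[OF fock_spin_grading clinear_cc])
qed

lemma md_b_vec: "md b_vec m v = b_field m v"
proof (cases m rule: md_cases)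
  case (1 j)
  have b: "b_vec = bb 0 (fock_ket 0)" by (simp add: b_vec_def bb_def)
  show ?thesis
    unfolding 1 md_neg b mul_Tp_creation by (simp add: bb_int_def b_field_def bb_def)
next
  case (2 j)
  obtain N where N: "ann N v" "j \<le> N" using ann_common[of "{v}" j] by auto
  have b: "b_vec = bb 0 (fock_ket 0)" by (simp add: b_vec_def bb_def)
  have c: "cc 0 (par b_vec) = 0" "cc (Suc 0) (par b_vec) = - fock_ket 0" "dd i b_vec = 0" for i
    by (simp_all add: b par_rec annihilate mode_simps)
  have "md b_vec m v = (\<Sum>m<N. if Suc m = j then of_nat (Suc m) *\<^sub>c dd m v else 0)"
    unfolding 2 md_nonneg br_eq[OF ann_2(2)[folded b] N(1)] sum_lessThan_2 brt_def c Tp_simps mul_simps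
    by (simp add: sum.distrib[symmetric]) (rule sum.cong, auto simp: bcoef_def Tp_vacuum mul_simps
        cs.scale_left_diff_distrib cs.scale_left_distrib)
  also have "\<dots> = \<phi>_act (fps_X ^ j) v"
  proof (cases j)
    case 0
    then show ?thesis by (simp add: \<phi>_0)
  next
    case (Suc k)
    then show ?thesis using N(2) unfolding Suc \<phi>_act_Suc by simp
  qed
  finally show ?thesis by (simp add: 2 b_field_def)
qed

lemma md_\<nu>_vec: "md \<nu>_vec m v = \<nu>_field m v"
proof (cases m rule: md_cases)
  case (1 j)
  have b: "\<nu>_vec = nn 0 (fock_ket 0)" by (simp add: \<nu>_vec_def nn_def)
  show ?thesis
    unfolding 1 md_neg b mul_Tp_creation by (simp add: nn_int_def \<nu>_field_def nn_def)
next
  case (2 j)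
  obtain N where N: "ann N v" "Suc j \<le> N" using ann_common[of "{v}" "Suc j"] by auto
  have b: "\<nu>_vec = nn 0 (fock_ket 0)" by (simp add: \<nu>_vec_def nn_def)
  have c: "cc i (par \<nu>_vec) = 0" "dd 0 \<nu>_vec = fock_ket 0" "dd (Suc 0) \<nu>_vec = 0" for i
    by (simp_all add: b par_rec annihilate mode_simps par_simps)
  have "md \<nu>_vec m v = (\<Sum>m<N. bcoef m 0 *\<^sub>c mul (Tp (int m - int j) (fock_ket 0)) (cc m v))"
    unfolding 2 md_nonneg br_eq[OF ann_2(3)[folded b] N(1)] sum_lessThan_2 brt_def c Tp_simps mul_simps by simp
  also have "\<dots> = (\<Sum>m<N. if m = j then cc m v else 0)"
    by (rule sum.cong) (auto simp: bcoef_def Tp_vacuum mul_simps)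
  also have "\<dots> = cc j v" using N(2) by simp
  finally show ?thesis by (simp add: 2 \<nu>_field_def cc_def)
qed

text \<open>Both infinite sums are cut off at \<open>N + 1\<close>, so that the shifted sum \<open>\<Sum> n f\<^sub>n c\<^bsub>n-1\<^esub>\<close> ends at \<open>N\<close>.\<close>

lemma tr_smeared:
  "tr (c_act f v) = c_act (- fps_deriv f) v + c_act f (tr v)"
  "tr (\<phi>_act f v) = \<phi>_act (- fps_deriv f) v + \<phi>_act f (tr v)"
proof -
  obtain N1 where N1: "\<And>N f. N \<ge> N1 \<Longrightarrow> c_act f v = (\<Sum>n<N. fps_nth f n *\<^sub>c cc n v) \<and>
      \<phi>_act f v = (\<Sum>n<N. fps_nth f n *\<^sub>c \<phi>_act (fps_X ^ n) v)"
    using smeared_as_finite_sum[of v] by blast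
  obtain N2 where N2: "\<And>N f. N \<ge> N2 \<Longrightarrow> c_act f (tr v) = (\<Sum>n<N. fps_nth f n *\<^sub>c cc n (tr v)) \<and>
      \<phi>_act f (tr v) = (\<Sum>n<N. fps_nth f n *\<^sub>c \<phi>_act (fps_X ^ n) (tr v))"
    using smeared_as_finite_sum[of "tr v"] by blast
  define N where "N = max N1 N2"
  have NN: "N \<ge> N1" "Suc N \<ge> N1" "Suc N \<ge> N2" by (simp_all add: N_def)
  note N = N1[OF NN(1)] N1[OF NN(2)] N2[OF NN(3)]
  have *: "tr (\<Sum>n<Suc N. fps_nth f n *\<^sub>c X n v) = (\<Sum>n<N. fps_nth (- fps_deriv f) n *\<^sub>c X n v) + (\<Sum>n<Suc N. fps_nth f n *\<^sub>c X n (tr v))"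
    if X: "\<And>n. tr (X n v) = X n (tr v) - of_nat n *\<^sub>c X (n - 1) v" for X :: "nat \<Rightarrow> lattice_fock \<Rightarrow> lattice_fock"
  proof -
    have "tr (\<Sum>n<Suc N. fps_nth f n *\<^sub>c X n v) = (\<Sum>n<Suc N. fps_nth f n *\<^sub>c X n (tr v)) - (\<Sum>n<Suc N. (fps_nth f n * of_nat n) *\<^sub>c X (n - 1) v)"
      unfolding tr_simps X sum_subtractf[symmetric] by (simp add: cs.scale_right_diff_distrib)
    also have "(\<Sum>n<Suc N. (fps_nth f n * of_nat n) *\<^sub>c X (n - 1) v) = - (\<Sum>n<N. fps_nth (- fps_deriv f) n *\<^sub>c X n v)"
      unfolding sum.lessThan_Suc_shift by (simp add: sum_negf mult.commute)
    finally show ?thesis by simp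
  qed
  have \<phi>: "tr (\<phi>_act (fps_X ^ n) v) = \<phi>_act (fps_X ^ n) (tr v) - of_nat n *\<^sub>c \<phi>_act (fps_X ^ (n - 1)) v" for n
  proof (cases n)
    case 0
    then show ?thesis by (simp add: \<phi>_0 tr_simps)
  next
    case (Suc k)
    have "\<phi>_act (fps_X ^ k) v = of_nat k *\<^sub>c dd (k - 1) v"
      using \<phi>_act_Suc[of "k - 1" v] by (cases k) (simp_all add: \<phi>_0)
    then show ?thesis unfolding Suc \<phi>_act_Suc by (simp add: tr_simps tr_dd cs.scale_right_diff_distrib del: of_nat_Suc)
  qed
  show "tr (c_act f v) = c_act (- fps_deriv f) v + c_act f (tr v)"
    unfolding conjunct1[OF N(1), of "- fps_deriv f"] conjunct1[OF N(2), of f] conjunct1[OF N(3), of f]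
    by (rule *[where X = cc]) (rule tr_cc)
  show "tr (\<phi>_act f v) = \<phi>_act (- fps_deriv f) v + \<phi>_act f (tr v)"
    unfolding conjunct2[OF N(1), of "- fps_deriv f"] conjunct2[OF N(2), of f] conjunct2[OF N(3), of f]
    by (rule *[where X = "\<lambda>n. \<phi>_act (fps_X ^ n)"]) (rule \<phi>)
qed

lemma smeared_sum_bound:
  assumes "degree p < N"
  shows "b_act p v = (\<Sum>i<N. coeff p i *\<^sub>c bb i v)" "\<nu>_act p v = (\<Sum>i<N. coeff p i *\<^sub>c nn i v)"
  unfolding b_act_sum[of p] \<nu>_act_sum[of p] using assms
  by (auto intro!: sum.mono_neutral_left intro: le_degree)

lemma tr_smeared_poly:
  "tr (b_act p v) = b_act (pCons 0 (pderiv (pCons 0 p))) v + b_act p (tr v)"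
  "tr (\<nu>_act p v) = \<nu>_act (pCons 0 (pderiv (pCons 0 p))) v + \<nu>_act p (tr v)"
proof -
  let ?q = "pCons 0 (pderiv (pCons 0 p))"
  obtain N where N: "degree p < N" "degree ?q < Suc N"
    using that[of "Suc (max (degree p) (degree ?q))"] by linarith
  have q: "coeff ?q 0 = 0" "coeff ?q (Suc i) = of_nat (Suc i) * coeff p i" for i
    by (simp_all add: coeff_pderiv)
  show "tr (b_act p v) = b_act ?q v + b_act p (tr v)"
    unfolding smeared_sum_bound(1)[OF N(1)] smeared_sum_bound(1)[OF N(2)] sum.lessThan_Suc_shift q
    by (simp add: tr_simps tr_bb cs.scale_right_distrib sum.distrib mult.commute add.commute del: of_nat_Suc)
  show "tr (\<nu>_act p v) = \<nu>_act ?q v + \<nu>_act p (tr v)"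
    unfolding smeared_sum_bound(2)[OF N(1)] smeared_sum_bound(2)[OF N(2)] sum.lessThan_Suc_shift q
    by (simp add: tr_simps tr_nn cs.scale_right_distrib sum.distrib mult.commute add.commute del: of_nat_Suc)
qed

lemma tr_fock_action: "tr (fock_action x v) = fock_action (heis_translation x) v + fock_action x (tr v)"
proof -
  obtain f p g q k where x: "x = Heis f p g q k" by (cases x)
  show ?thesis
    unfolding x heis_translation_def heis.sel
    by (subst (1 2 3) fock_action_split) (simp add: tr_simps tr_smeared tr_smeared_poly)
qed

lemma strongly_generated_fock_0: "strongly_generated (sub_raviolo lattice_raviolo (fock 0)) {b_vec, \<nu>_vec}"
proof -
  define X where "X = {foldr (\<lambda>(a, m) v. md a m v) ams (fock_ket 0) | ams. set ams \<subseteq> {b_vec, \<nu>_vec} \<times> {..<0}}"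
  have F: "mode_closed (fock 0)" by (rule mode_closed_fock_0)
  have gen: "b_vec \<in> fock 0" "\<nu>_vec \<in> fock 0"
    by (simp_all add: fock_0_eq b_vec_def \<nu>_vec_def c_action_central cc_ket fock_action_simps)
  have "foldr (\<lambda>(a, m) v. md a m v) ams (fock_ket 0) \<in> fock 0" if "set ams \<subseteq> {b_vec, \<nu>_vec} \<times> {..<0}" for ams
    using that by (induction ams) (use F gen in \<open>auto simp: mode_closed_def\<close>)
  then have "cs.span X \<subseteq> fock 0"
    unfolding X_def by (intro cs.span_minimal subspace_fock) blast
  moreover have step: "md a m v \<in> cs.span X" if v: "v \<in> cs.span X" and am: "a \<in> {b_vec, \<nu>_vec}" "m < 0" for a m v
    using v
  proof (induction rule: cs.span_induct_alt)
    case base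
    show ?case by (simp add: clinear_simps[OF clinear_md(2)] cs.span_zero)
  next
    case (step c x y)
    obtain ams where ams: "x = foldr (\<lambda>(a, m) v. md a m v) ams (fock_ket 0)" "set ams \<subseteq> {b_vec, \<nu>_vec} \<times> {..<0}"
      using step(1) unfolding X_def by blast
    have "md a m x = foldr (\<lambda>(a, m) v. md a m v) ((a, m) # ams) (fock_ket 0)" "set ((a, m) # ams) \<subseteq> {b_vec, \<nu>_vec} \<times> {..<0}"
      using ams am by auto
    then have "md a m x \<in> X" unfolding X_def by blast
    then show ?case using step(2)
      by (simp add: clinear_simps[OF clinear_md(2)] cs.span_add cs.span_scale cs.span_base)
  qed
  have "fock 0 \<subseteq> cs.span X"
  proof (rule fock_0_created)
    have "fock_ket 0 = foldr (\<lambda>(a, m) v. md a m v) [] (fock_ket 0)" by simp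
    then have "fock_ket 0 \<in> X" unfolding X_def by (intro CollectI exI[of _ "[]"]) simp
    then show "fock_ket 0 \<in> cs.span X" by (rule cs.span_base)
    show "bb k v \<in> cs.span X" if "v \<in> cs.span X" for k v
      using step[OF that, of b_vec "- int k - 1"] by (simp add: md_b_vec b_field_def bb_def del: md_neg)
    show "nn k v \<in> cs.span X" if "v \<in> cs.span X" for k v
      using step[OF that, of \<nu>_vec "- int k - 1"] by (simp add: md_\<nu>_vec \<nu>_field_def nn_def del: md_neg)
    show "cs.span X \<subseteq> fock 0" by fact
  qed simp
  ultimately have "fock 0 = cs.span X" by blast
  then show ?thesis unfolding strongly_generated_def X_def by simp
qed

theorem proposition5p2p2:
  shows "\<exists>V :: lattice_fock raviolo.
     rspace V = UNIV \<and> rdegree V = fock_degree \<and> extends_heisenberg_module V \<and>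
     conformal_raviolo_vertex_algebra V fock_spin conformal_vec \<and>
     conformal_subalgebra V fock_spin conformal_vec (fock 0) \<and>
     heisenberg_raviolo_algebra (sub_raviolo V (fock 0))"
proof (intro exI[of _ lattice_raviolo] conjI)
  have gU: "graded_subspace UNIV fock_degree" "graded_subspace UNIV fock_spin"
    using fock_degree_grading fock_spin_grading by (simp_all add: graded_subspace_def)
  have \<gamma>: "conformal_vec \<in> fock 0"
    by (simp add: fock_0_eq conformal_vec_eq annihilate mode_simps)
  show "rspace lattice_raviolo = UNIV" "rdegree lattice_raviolo = fock_degree" by simp_all
  show "extends_heisenberg_module lattice_raviolo"
    by (simp add: extends_heisenberg_module_def md_b_vec md_\<nu>_vec)
  show "conformal_raviolo_vertex_algebra lattice_raviolo fock_spin conformal_vec"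
    using raviolo_vertex_algebra_sub[OF mode_closed_UNIV gU(1)]
      conformal_structure_sub[OF mode_closed_UNIV UNIV_I gU(2,1)]
    by (simp add: conformal_raviolo_vertex_algebra_def sub_raviolo_UNIV)
  have rva: "raviolo_vertex_algebra (sub_raviolo lattice_raviolo (fock 0))"
    by (rule raviolo_vertex_algebra_sub[OF mode_closed_fock_0 graded_subspace_fock_0(1)])
  show "conformal_subalgebra lattice_raviolo fock_spin conformal_vec (fock 0)"
    unfolding conformal_subalgebra_def conformal_raviolo_vertex_algebra_def raviolo_subalgebra_def lattice_raviolo_simps
    using rva \<gamma> conformal_structure_sub[OF mode_closed_fock_0 \<gamma> graded_subspace_fock_0(2,1)]
      graded_subspace_fock_0(1) mode_closed_fock_0
    unfolding mode_closed_def by blast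
  show "heisenberg_raviolo_algebra (sub_raviolo lattice_raviolo (fock 0))"
    unfolding heisenberg_raviolo_algebra_def
    using rva strongly_generated_fock_0 by (simp add: tr_fock_action md_b_vec md_\<nu>_vec)
qed

end
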